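(* The restriction of $\mathrm{INV}\circ\Delta$ to $\mathbb H^{\mathrm{symb}}$, i.e. the map $(\mathrm{INV}\otimes\mathrm{INV})\circ\Delta|_{\mathbb H^{\mathrm{symb}}}\colon\mathbb H^{\mathrm{symb}}\to\mathbb H^{\mathrm{symb}}\otimes\mathbb H^{\mathrm{symb}}$, is coassociative and endows $\mathbb H^{\mathrm{symb}}$ with a graded Hopf algebra structure.
   Context: **The algebras.** Let $x_1,x_2,\dots$ be free variables and $x_{i\to j}=\prod_{r=i}^{j-1}x_r$ for $i<j$. $\overline{\mathbb H}^{\mathrm{symb}}$ is the free commutative graded $\mathbb Q$-algebra generated by: elements $[x_i]_0$, $i\ge1$, of weight $1$; regular symbols $[x_{i_1\to i_2},\dots,x_{i_d\to i_{d+1}}]_{n_1,\dots,n_d}$ ($d\ge1$, $1\le i_1<\dots<i_{d+1}$, $n_r\ge1$) of weight $n_1+\dots+n_d$; and inverted symbols $[x_{i_d\to i_{d+1}}^{-1},\dots,x_{i_1\to i_2}^{-1}]_{n_d,\dots,n_1}$ of weight $n_1+\dots+n_d$. $\mathbb H^{\mathrm{symb}}$ is the subalgebra generated by the $[x_i]_0$ and the regular symbols. Put $[x_{i\to j}]_0=-[x_{i\to j}^{-1}]_0=\sum_{r=i}^{j-1}[x_r]_0$, $[1]_0=0$. Generating series: $[y_1,\dots,y_d|t_1,\dots,t_d]=\sum_{n_i\ge1}[y_1,\dots,y_d]_{n_1,\dots,n_d}t_1^{n_1-1}\cdots t_d^{n_d-1}$, $[\emptyset|\emptyset]=1$, $\exp([y]_0t)=\sum_{n\ge0}[y]_0^nt^n/n!$;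 linear forms in the $t$'s may be substituted for the $t_i$. **Coproduct on $\overline{\mathbb H}^{\mathrm{symb}}$.** $\Delta$ is the algebra homomorphism $\overline{\mathbb H}^{\mathrm{symb}}\to\overline{\mathbb H}^{\mathrm{symb}}\otimes\overline{\mathbb H}^{\mathrm{symb}}$ with $\Delta([x_i]_0)=[x_i]_0\otimes1+1\otimes[x_i]_0$ and, for $(y_1,\dots,y_d)$ the argument of a regular or inverted symbol and $y_{i\to j}=\prod_{r=i}^{j-1}y_r$, $$\Delta[y_1,\dots,y_d|t_1,\dots,t_d]=\sum[y_{i_1\to i_2},\dots,y_{i_k\to i_{k+1}}|t_{j_1},\dots,t_{j_k}]\otimes[y_1,\dots,y_{i_1-1}|t_1,\dots,t_{i_1-1}]\prod_{\alpha=1}^k(-1)^{j_\alpha-i_\alpha}\exp([y_{i_\alpha\to i_{\alpha+1}}]_0t_{j_\alpha})\,[y_{j_\alpha-1}^{-1},\dots,y_{i_\alpha}^{-1}|t_{j_\alpha}-t_{j_\alpha-1},\dots,t_{j_\alpha}-t_{i_\alpha}]\,[y_{j_\alpha+1},\dots,y_{i_{\alpha+1}-1}|t_{j_\alpha+1}-t_{j_\alpha},\dots,t_{i_{\alpha+1}-1}-t_{j_\alpha}],$$ summed over $k\ge0$ and $1\le i_1\le j_1<i_2\le j_2<\dots<i_k\le j_k<i_{k+1}=d+1$. **Inversion.** $\mathrm{INV}\colon\overline{\mathbb H}^{\mathrm{symb}}\to\mathbb H^{\mathrm{symb}}$ is the algebra homomorphism fixing $[x_i]_0$ and the regular symbols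 and given on inverted symbols inductively (for $[y_1,\dots,y_d]$ regular) by $$\mathrm{INV}[y_d^{-1},\dots,y_1^{-1}|-t_d,\dots,-t_1]=\sum_{j=0}^{d-1}(-1)^{d-1+j}\,\mathrm{INV}[y_j^{-1},\dots,y_1^{-1}|-t_j,\dots,-t_1]\,[y_{j+1},\dots,y_d|t_{j+1},\dots,t_d]$$ $$+\sum_{j=1}^d\tfrac{(-1)^{d-1+j}}{t_j}\mathrm{INV}[y_{j-1}^{-1},\dots,y_1^{-1}|-t_{j-1},\dots,-t_1]\,[y_{j+1},\dots,y_d|t_{j+1},\dots,t_d]$$ $$+\sum_{j=1}^d\tfrac{(-1)^{d+j}}{t_j}\mathrm{INV}[y_{j-1}^{-1},\dots,y_1^{-1}|t_j-t_{j-1},\dots,t_j-t_1]\exp([y_{1\to d+1}]_0t_j)\,[y_{j+1},\dots,y_d|t_{j+1}-t_j,\dots,t_d-t_j].$$ For example $\mathrm{INV}[y^{-1}|-t]=[y|t]+\frac{\exp([y]_0t)-1}{t}$. The unit and counit of $\mathbb H^{\mathrm{symb}}$ are inclusion of, and projection onto, the weight $0$ part $\mathbb Q$. *)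

theory Defs
  imports "HOL-Library.Poly_Mapping" "HOL-Library.Product_Plus"
    "HOL-Computational_Algebra.Formal_Power_Series"
begin

section \<open>Monoid algebras over the rationals and their tensor products\<close>

text \<open>
  For a commutative monoid \<open>'m\<close>, the type \<open>'m \<Rightarrow>\<^sub>0 rat\<close> is the monoid algebra \<open>\<rat>['m]\<close>; for
  \<open>'m = 'g \<Rightarrow>\<^sub>0 nat\<close> it is the free commutative algebra on \<open>'g\<close>.
  The tensor product of \<open>\<rat>['m]\<close> and \<open>\<rat>['n]\<close> over \<open>\<rat>\<close> is \<open>\<rat>['m \<times> 'n]\<close>, with the pure tensors
  \<open>tensor a b\<close>; its ring structure is the library one on \<open>'m \<times> 'n \<Rightarrow>\<^sub>0 rat\<close>
  (see \<open>tensor_mult\<close>), and its universal property is \<open>linear_tensor_lift\<close>,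
  \<open>tensor_lift_tensor\<close> and \<open>tensor_linear_eqI\<close>.
\<close>

abbreviation "lookup \<equiv> Poly_Mapping.lookup"
abbreviation "keys \<equiv> Poly_Mapping.keys"
abbreviation "single \<equiv> Poly_Mapping.single"

definition smult :: "rat \<Rightarrow> ('m::comm_monoid_add \<Rightarrow>\<^sub>0 rat) \<Rightarrow> 'm \<Rightarrow>\<^sub>0 rat" where
  "smult c a = single 0 c * a"

interpretation pm: vector_space "smult :: rat \<Rightarrow> ('m::comm_monoid_add \<Rightarrow>\<^sub>0 rat) \<Rightarrow> _"
  by unfold_locales
    (simp_all add: smult_def algebra_simps single_add mult_single flip: mult.assoc)

abbreviation linear_map ::
  "(('m::comm_monoid_add \<Rightarrow>\<^sub>0 rat) \<Rightarrow> ('n::comm_monoid_add \<Rightarrow>\<^sub>0 rat)) \<Rightarrow> bool" where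
  "linear_map \<equiv> Vector_Spaces.linear smult smult"

definition subalgebra :: "('m::comm_monoid_add \<Rightarrow>\<^sub>0 rat) set \<Rightarrow> bool" where
  "subalgebra B \<longleftrightarrow> pm.subspace B \<and> 1 \<in> B \<and> (\<forall>a\<in>B. \<forall>b\<in>B. a * b \<in> B)"

definition tensor ::
  "('m::comm_monoid_add \<Rightarrow>\<^sub>0 rat) \<Rightarrow> ('n::comm_monoid_add \<Rightarrow>\<^sub>0 rat) \<Rightarrow> ('m \<times> 'n) \<Rightarrow>\<^sub>0 rat" where
  "tensor a b = (\<Sum>m\<in>keys a. \<Sum>n\<in>keys b.
     single (m, n) (lookup a m * lookup b n))"

text \<open>The linear map on the tensor product induced by a bilinear map \<open>f\<close>.\<close>

definition tensor_lift ::
  "(('m::comm_monoid_add \<Rightarrow>\<^sub>0 rat) \<Rightarrow> ('n::comm_monoid_add \<Rightarrow>\<^sub>0 rat) \<Rightarrow> ('p::comm_monoid_add \<Rightarrow>\<^sub>0 rat))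
    \<Rightarrow> (('m \<times> 'n) \<Rightarrow>\<^sub>0 rat) \<Rightarrow> 'p \<Rightarrow>\<^sub>0 rat" where
  "tensor_lift f w = (\<Sum>(m, n)\<in>keys w.
     smult (lookup w (m, n)) (f (single m 1) (single n 1)))"

definition tensor_map ::
  "(('m::comm_monoid_add \<Rightarrow>\<^sub>0 rat) \<Rightarrow> ('p::comm_monoid_add \<Rightarrow>\<^sub>0 rat))
    \<Rightarrow> (('n::comm_monoid_add \<Rightarrow>\<^sub>0 rat) \<Rightarrow> ('q::comm_monoid_add \<Rightarrow>\<^sub>0 rat))
    \<Rightarrow> (('m \<times> 'n) \<Rightarrow>\<^sub>0 rat) \<Rightarrow> ('p \<times> 'q) \<Rightarrow>\<^sub>0 rat" where
  "tensor_map f g = tensor_lift (\<lambda>a b. tensor (f a) (g b))"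

definition tensor_assoc ::
  "((('m::comm_monoid_add \<times> 'n::comm_monoid_add) \<times> 'p::comm_monoid_add) \<Rightarrow>\<^sub>0 rat)
    \<Rightarrow> ('m \<times> 'n \<times> 'p) \<Rightarrow>\<^sub>0 rat" where
  "tensor_assoc = tensor_lift (\<lambda>u c. tensor_lift (\<lambda>a b. tensor a (tensor b c)) u)"

text \<open>The image of \<open>A \<otimes> B\<close> in the tensor product of the ambient algebras, for subspaces
  \<open>A\<close> and \<open>B\<close>.\<close>

definition tensor_space ::
  "('m::comm_monoid_add \<Rightarrow>\<^sub>0 rat) set \<Rightarrow> ('n::comm_monoid_add \<Rightarrow>\<^sub>0 rat) set
    \<Rightarrow> (('m \<times> 'n) \<Rightarrow>\<^sub>0 rat) set" where
  "tensor_space A B = pm.span {tensor a b |a b. a \<in> A \<and> b \<in> B}"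

lemma lookup_tensor: "lookup (tensor a b) (m, n) = lookup a m * lookup b n"
proof -
  have "lookup (tensor a b) (m, n) = (\<Sum>m'\<in>keys a. \<Sum>n'\<in>keys b.
      if n' = n then (if m' = m then lookup a m' * lookup b n' else 0) else 0)"
    unfolding tensor_def by (simp add: lookup_sum lookup_single when_def if_distrib if_bool_eq_conj
        cong: if_cong) (auto intro!: sum.cong)
  also have "\<dots> = (\<Sum>m'\<in>keys a. if m' = m then lookup a m' * lookup b n else 0)"
    by (intro sum.cong refl) (auto simp: sum.delta in_keys_iff)
  also have "\<dots> = lookup a m * lookup b n"
    by (auto simp: sum.delta in_keys_iff)
  finally show ?thesis .
qed

lemma lookup_smult: "lookup (smult c a) m = c * lookup a m"
  by (simp add: smult_def flip: mult_map_scale_conv_mult) (simp add: map.rep_eq when_def)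

lemma smult_single: "smult c (single m d) = single m (c * d)"
  by (simp add: smult_def mult_single)

lemma tensor_single:
  "tensor (single m c) (single n d) = single (m, n) (c * d)"
  by (rule poly_mapping_eqI) (auto simp: lookup_tensor lookup_single when_def split: if_splits)

lemma tensor_add_left: "tensor (a + a') b = tensor a b + tensor a' b"
  and tensor_add_right: "tensor a (b + b') = tensor a b + tensor a b'"
  and tensor_smult_left: "tensor (smult c a) b = smult c (tensor a b)"
  and tensor_smult_right: "tensor a (smult c b) = smult c (tensor a b)"
  by (auto intro!: poly_mapping_eqI
      simp: lookup_tensor lookup_add lookup_smult algebra_simps)

lemma poly_mapping_expand:
  fixes a :: "'m::comm_monoid_add \<Rightarrow>\<^sub>0 rat"
  shows "a = (\<Sum>m\<in>keys a. smult (lookup a m) (single m 1))"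
  by (rule poly_mapping_eqI)
    (simp add: lookup_sum smult_single lookup_single when_def in_keys_iff sum.delta)

lemma tensor_zero_left [simp]: "tensor 0 b = 0"
  and tensor_zero_right [simp]: "tensor a 0 = 0"
  by (simp_all add: tensor_def)

lemma tensor_sum_left: "tensor (sum f A) b = (\<Sum>x\<in>A. tensor (f x) b)"
  by (induction A rule: infinite_finite_induct) (simp_all add: tensor_add_left)

lemma tensor_sum_right: "tensor a (sum f A) = (\<Sum>x\<in>A. tensor a (f x))"
  by (induction A rule: infinite_finite_induct) (simp_all add: tensor_add_right)

lemma tensor_mult:
  fixes a a' :: "'a::comm_monoid_add \<Rightarrow>\<^sub>0 rat" and b b' :: "'b::comm_monoid_add \<Rightarrow>\<^sub>0 rat"
  shows "tensor a b * tensor a' b' = tensor (a * a') (b * b')"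
proof -
  have single: "tensor (single m 1) (single n 1)
      * tensor (single m' 1) (single n' 1)
    = tensor (single m 1 * single m' 1)
        (single n 1 * single n' (1::rat))"
    for m m' :: "'a" and n n' :: "'b"
    by (simp add: tensor_single mult_single)
  have smult_mult: "smult c x * y = smult c (x * y)" "x * smult c y = smult c (x * y)"
    for c and x y :: "'c::comm_monoid_add \<Rightarrow>\<^sub>0 rat"
    by (simp_all add: smult_def mult.assoc mult.left_commute)
  note lin = tensor_sum_left tensor_sum_right tensor_smult_left tensor_smult_right
    sum_distrib_left sum_distrib_right smult_mult
  have 1: "tensor (single m 1) (single n 1)
      * tensor (single m' 1) b'
    = tensor (single m 1 * single m' 1)
        (single n 1 * b')" for m m' :: "'a" and n :: "'b"
    by (subst (1 2) poly_mapping_expand[of b']) (simp only: lin single)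
  have 2: "tensor (single m 1) (single n 1) * tensor a' b'
    = tensor (single m 1 * a') (single n 1 * b')" for m :: "'a" and n :: "'b"
    by (subst (1 2) poly_mapping_expand[of a']) (simp only: lin 1)
  have 3: "tensor (single m 1) b * tensor a' b'
    = tensor (single m 1 * a') (b * b')" for m :: "'a"
    by (subst (1 2) poly_mapping_expand[of b]) (simp only: lin 2)
  show ?thesis
    by (subst (1 2) poly_mapping_expand[of a]) (simp only: lin 3)
qed

lemma tensor_lift_superset:
  assumes "finite A" "keys w \<subseteq> A"
  shows "tensor_lift f w = (\<Sum>(m, n)\<in>A.
    smult (lookup w (m, n)) (f (single m 1) (single n 1)))"
  unfolding tensor_lift_def
  by (rule sum.mono_neutral_left) (use assms in \<open>auto simp: in_keys_iff\<close>)

lemma linear_tensor_lift: "linear_map (tensor_lift f)"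
proof (unfold_locales, goal_cases)
  case (1 v w)
  let ?A = "keys v \<union> keys w"
  have "keys (v + w) \<subseteq> ?A" by (rule keys_add)
  then show ?case
    by (simp add: tensor_lift_superset[of ?A] lookup_add pm.scale_left_distrib
        flip: sum.distrib) (simp add: case_prod_unfold)
next
  case (2 c w)
  have "keys (smult c w) \<subseteq> keys w" by (auto simp: in_keys_iff lookup_smult)
  then show ?case
    by (simp add: tensor_lift_superset[of "keys w"] lookup_smult pm.scale_sum_right
        case_prod_unfold)
qed

lemma tensor_lift_tensor:
  assumes left: "\<And>b. linear_map (\<lambda>a. f a b)" and right: "\<And>a. linear_map (f a)"
  shows "tensor_lift f (tensor a b) = f a b"
proof -
  have keys: "keys (tensor a b) \<subseteq> keys a \<times> keys b"
    by (auto simp: in_keys_iff lookup_tensor)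
  have "f a b = f (\<Sum>m\<in>keys a. smult (lookup a m) (single m 1)) b"
    using poly_mapping_expand[of a] by simp
  also have "\<dots> = (\<Sum>m\<in>keys a. smult (lookup a m) (f (single m 1) b))"
    by (simp add: Vector_Spaces.linear.axioms(3)[OF left, THEN module_hom.sum]
        Vector_Spaces.linear.axioms(3)[OF left, THEN module_hom.scale])
  also have "\<dots> = (\<Sum>m\<in>keys a. smult (lookup a m)
      (f (single m 1) (\<Sum>n\<in>keys b. smult (lookup b n) (single n 1))))"
    using poly_mapping_expand[of b] by simp
  also have "\<dots> = (\<Sum>m\<in>keys a. \<Sum>n\<in>keys b. smult (lookup a m * lookup b n)
      (f (single m 1) (single n 1)))"
    by (simp add: Vector_Spaces.linear.axioms(3)[OF right, THEN module_hom.sum] pm.scale_sum_right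
        Vector_Spaces.linear.axioms(3)[OF right, THEN module_hom.scale])
  also have "\<dots> = tensor_lift f (tensor a b)"
    using keys by (simp add: tensor_lift_superset[of "keys a \<times> keys b"] lookup_tensor
        sum.cartesian_product)
  finally show ?thesis ..
qed

lemma tensor_linear_eqI:
  assumes "linear_map f" "linear_map g" "\<And>a b. f (tensor a b) = g (tensor a b)"
  shows "f w = g w"
proof -
  have *: "h w = (\<Sum>(m, n)\<in>keys w. smult (lookup w (m, n))
      (h (tensor (single m 1) (single n 1))))"
    if "linear_map h" for h :: "(('a \<times> 'b) \<Rightarrow>\<^sub>0 rat) \<Rightarrow> 'c \<Rightarrow>\<^sub>0 rat"
    by (subst poly_mapping_expand[of w])
      (simp add: Vector_Spaces.linear.axioms(3)[OF that, THEN module_hom.sum] case_prod_unfold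
        Vector_Spaces.linear.axioms(3)[OF that, THEN module_hom.scale] tensor_single)
  show ?thesis
    unfolding *[OF assms(1)] *[OF assms(2)] by (simp only: assms(3))
qed


section \<open>Graded Hopf algebras\<close>

text \<open>
  A Hopf algebra structure on a subalgebra \<open>H\<close> of a monoid algebra.  The structure maps are given
  as linear maps on the ambient algebra; only their restrictions to \<open>H\<close> matter, since
  \<open>tensor_map f g\<close> on \<open>tensor_space H H\<close> depends only on \<open>f\<close> and \<open>g\<close> on \<open>H\<close>.
  The unit map is \<open>\<lambda>c. smult c 1\<close>.
\<close>

definition coassociative_on ::
  "('m::comm_monoid_add \<Rightarrow>\<^sub>0 rat) set \<Rightarrow> (('m \<Rightarrow>\<^sub>0 rat) \<Rightarrow> ('m \<times> 'm) \<Rightarrow>\<^sub>0 rat) \<Rightarrow> bool" where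
  "coassociative_on H D \<longleftrightarrow>
     (\<forall>a\<in>H. tensor_assoc (tensor_map D id (D a)) = tensor_map id D (D a))"

locale graded_algebra =
  fixes H :: "('m::comm_monoid_add \<Rightarrow>\<^sub>0 rat) set"
    and Hgr :: "nat \<Rightarrow> ('m \<Rightarrow>\<^sub>0 rat) set"
  assumes subalgebra: "subalgebra H"
    and subspace_gr: "pm.subspace (Hgr n)"
    and gr_subset: "Hgr n \<subseteq> H"
    and direct_sum: "a \<in> H \<Longrightarrow>
      \<exists>!f. (\<forall>n. f n \<in> Hgr n) \<and> finite {n. f n \<noteq> 0} \<and> a = (\<Sum>n | f n \<noteq> 0. f n)"
    and one_gr: "1 \<in> Hgr 0"
    and mult_gr: "a \<in> Hgr i \<Longrightarrow> b \<in> Hgr j \<Longrightarrow> a * b \<in> Hgr (i + j)"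

locale graded_bialgebra = graded_algebra H Hgr
  for H :: "('m::comm_monoid_add \<Rightarrow>\<^sub>0 rat) set" and Hgr +
  fixes D :: "('m \<Rightarrow>\<^sub>0 rat) \<Rightarrow> ('m \<times> 'm) \<Rightarrow>\<^sub>0 rat"
    and \<epsilon> :: "('m \<Rightarrow>\<^sub>0 rat) \<Rightarrow> rat"
  assumes comul_linear: "linear_map D"
    and comul_closed: "a \<in> H \<Longrightarrow> D a \<in> tensor_space H H"
    and comul_gr: "a \<in> Hgr n \<Longrightarrow> D a \<in> pm.span (\<Union>i\<le>n. tensor_space (Hgr i) (Hgr (n - i)))"
    and comul_one: "D 1 = 1"
    and comul_mult: "a \<in> H \<Longrightarrow> b \<in> H \<Longrightarrow> D (a * b) = D a * D b"
    and coassoc: "coassociative_on H D"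
    and counit_linear: "Vector_Spaces.linear smult (*) \<epsilon>"
    and counit_one: "\<epsilon> 1 = 1"
    and counit_mult: "a \<in> H \<Longrightarrow> b \<in> H \<Longrightarrow> \<epsilon> (a * b) = \<epsilon> a * \<epsilon> b"
    and counit_gr: "a \<in> Hgr n \<Longrightarrow> n > 0 \<Longrightarrow> \<epsilon> a = 0"
    and counit_left: "a \<in> H \<Longrightarrow> tensor_lift (\<lambda>b c. smult (\<epsilon> b) c) (D a) = a"
    and counit_right: "a \<in> H \<Longrightarrow> tensor_lift (\<lambda>b c. smult (\<epsilon> c) b) (D a) = a"

locale graded_hopf_algebra = graded_bialgebra +
  assumes antipode: "\<exists>S. linear_map S \<and> (\<forall>n. S ` Hgr n \<subseteq> Hgr n) \<and>
    (\<forall>a\<in>H. tensor_lift (\<lambda>b c. S b * c) (D a) = smult (\<epsilon> a) 1 \<and>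
            tensor_lift (\<lambda>b c. b * S c) (D a) = smult (\<epsilon> a) 1)"


section \<open>The algebras of symbols\<close>

text \<open>
  Arguments of symbols are Laurent monomials in the variables \<open>x\<^sub>1, x\<^sub>2, \<dots>\<close>, that is elements of the
  free abelian group on the variables, written additively: products become sums and inverses become
  negatives.
\<close>

type_synonym laurent_monomial = "nat \<Rightarrow>\<^sub>0 int"

definition xprod :: "nat \<Rightarrow> nat \<Rightarrow> laurent_monomial" where
  "xprod i j = (\<Sum>r=i..<j. single r 1)"

text \<open>
  \<open>Log i\<close> stands for \<open>[x\<^sub>i]\<^sub>0\<close> and \<open>Sym ys ns\<close> for \<open>[y\<^sub>1, \<dots>, y\<^sub>d]\<close> with index \<open>n\<^sub>1, \<dots>, n\<^sub>d\<close>.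
  The ambient algebra is free on all such formal symbols.  The algebras \<open>Hbar_symb\<close> and \<open>H_symb\<close> are
  the subalgebras generated by the admissible ones among them, hence are themselves free on these;
  symbols that are neither regular nor inverted never enter them.  The homomorphisms \<open>comul\<close> and \<open>INV\<close>
  below are defined on the ambient algebra, with arbitrary values on inadmissible symbols; they are
  meant as maps on \<open>Hbar_symb\<close>.
\<close>

datatype generator = Log nat | Sym "laurent_monomial list" "nat list"

type_synonym monomial = "generator \<Rightarrow>\<^sub>0 nat"
type_synonym symb_alg = "monomial \<Rightarrow>\<^sub>0 rat"
type_synonym symb_alg2 = "(monomial \<times> monomial) \<Rightarrow>\<^sub>0 rat"

definition regular :: "laurent_monomial list \<Rightarrow> bool" where
  "regular ys \<longleftrightarrow> ys \<noteq> [] \<and> (\<exists>p. length p = length ys + 1 \<and> sorted_wrt (<) p \<and>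
     (\<forall>i\<in>set p. 1 \<le> i) \<and> (\<forall>r<length ys. ys ! r = xprod (p ! r) (p ! (r + 1))))"

definition invert :: "laurent_monomial list \<Rightarrow> laurent_monomial list" where
  "invert ys = rev (map uminus ys)"

definition gen :: "generator \<Rightarrow> symb_alg" where
  "gen g = single (single g 1) 1"

definition symb :: "laurent_monomial list \<Rightarrow> nat list \<Rightarrow> symb_alg" where
  "symb ys ns = (if ys = [] then 1 else gen (Sym ys ns))"

text \<open>\<open>[y]\<^sub>0\<close>, so that \<open>[x\<^sub>i \<cdots> x\<^bsub>j-1\<^esub>]\<^sub>0 = [x\<^sub>i]\<^sub>0 + \<cdots> + [x\<^bsub>j-1\<^esub>]\<^sub>0\<close> and \<open>[y\<^sup>-\<^sup>1]\<^sub>0 = - [y]\<^sub>0\<close>.\<close>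

definition log_symb :: "laurent_monomial \<Rightarrow> symb_alg" where
  "log_symb y = (\<Sum>i\<in>keys y. of_int (lookup y i) * gen (Log i))"

definition index_for :: "laurent_monomial list \<Rightarrow> nat list \<Rightarrow> bool" where
  "index_for ys ns \<longleftrightarrow> length ns = length ys \<and> (\<forall>n\<in>set ns. 1 \<le> n)"

definition regular_generators :: "generator set" where
  "regular_generators = {Log i |i. 1 \<le> i} \<union> {Sym ys ns |ys ns. regular ys \<and> index_for ys ns}"

definition inverted_generators :: "generator set" where
  "inverted_generators = {Sym (invert ys) ns |ys ns. regular ys \<and> index_for ys ns}"

definition Hbar_symb :: "symb_alg set" where
  "Hbar_symb = subalgebra hull (gen ` (regular_generators \<union> inverted_generators))"

definition H_symb :: "symb_alg set" where
  "H_symb = subalgebra hull (gen ` regular_generators)"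

primrec gen_weight :: "generator \<Rightarrow> nat" where
  "gen_weight (Log i) = 1"
| "gen_weight (Sym ys ns) = sum_list ns"

definition weight :: "monomial \<Rightarrow> nat" where
  "weight m = (\<Sum>g\<in>keys m. lookup m g * gen_weight g)"

definition H_symb_gr :: "nat \<Rightarrow> symb_alg set" where
  "H_symb_gr n = {a \<in> H_symb. \<forall>m\<in>keys a. weight m = n}"

text \<open>
  The projection onto the weight 0 part \<open>\<rat>\<close>: among the monomials occurring in elements of \<open>H_symb\<close>,
  only the trivial one has weight 0 (see \<open>H_symb_gr_0\<close>).
\<close>

definition symb_counit :: "symb_alg \<Rightarrow> rat" where
  "symb_counit a = lookup a 0"

text \<open>The algebra homomorphism on a free commutative algebra with given values on the generators.\<close>

definition alg_hom ::
  "('g \<Rightarrow> ('m::comm_monoid_add \<Rightarrow>\<^sub>0 rat)) \<Rightarrow> (('g \<Rightarrow>\<^sub>0 nat) \<Rightarrow>\<^sub>0 rat) \<Rightarrow> 'm \<Rightarrow>\<^sub>0 rat" where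
  "alg_hom f a = (\<Sum>m\<in>keys a. smult (lookup a m) (\<Prod>g\<in>keys m. f g ^ lookup m g))"


lemma subalgebra_generated: "subalgebra (subalgebra hull S)"
  by (rule hull_in) (auto simp: subalgebra_def intro!: pm.subspace_Inter)

lemma H_symb_keys:
  assumes "a \<in> H_symb" "m \<in> keys a"
  shows "keys m \<subseteq> regular_generators"
proof -
  let ?B = "{a :: symb_alg. \<forall>m\<in>keys a. keys m \<subseteq> regular_generators}"
  have "subalgebra ?B"
    unfolding subalgebra_def pm.subspace_def
  proof (intro conjI ballI allI)
    fix a b assume "a \<in> ?B" "b \<in> ?B"
    then show "a + b \<in> ?B"
      using keys_add[of a b] by blast
    show "a * b \<in> ?B"
    proof (intro CollectI ballI)
      fix m assume "m \<in> keys (a * b)"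
      then obtain m1 m2 where m: "m = m1 + m2" "m1 \<in> keys a" "m2 \<in> keys b"
        using keys_mult[of a b] by blast
      then show "keys m \<subseteq> regular_generators"
        using \<open>a \<in> ?B\<close> \<open>b \<in> ?B\<close> keys_add[of m1 m2] by blast
    qed
  next
    fix c a assume "a \<in> ?B"
    then show "smult c a \<in> ?B"
      by (auto simp: in_keys_iff lookup_smult)
  qed (auto simp: lookup_one in_keys_iff when_def split: if_splits)
  moreover have "gen ` regular_generators \<subseteq> ?B"
    by (auto simp: gen_def)
  ultimately have "H_symb \<subseteq> ?B"
    unfolding H_symb_def by (rule hull_minimal[rotated])
  then show ?thesis using assms by blast
qed

lemma H_symb_gr_0: "H_symb_gr 0 = range (\<lambda>c. smult c 1)"
proof (intro equalityI subsetI)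
  fix a assume a: "a \<in> H_symb_gr 0"
  have "m = 0" if m: "m \<in> keys a" for m
  proof (rule ccontr)
    assume "m \<noteq> 0"
    then obtain g where g: "g \<in> keys m"
      using keys_eq_empty[of m] by blast
    then have "g \<in> regular_generators"
      using H_symb_keys[of a m] a m by (auto simp: H_symb_gr_def)
    then have "gen_weight g > 0"
      by (auto simp: regular_generators_def regular_def index_for_def neq_Nil_conv length_Suc_conv)
    moreover have "weight m = 0" using a m by (auto simp: H_symb_gr_def)
    ultimately show False
      using g by (auto simp: weight_def in_keys_iff)
  qed
  then have "a = smult (lookup a 0) 1"
    by (intro poly_mapping_eqI) (auto simp: lookup_smult lookup_one when_def in_keys_iff)
  then show "a \<in> range (\<lambda>c. smult c 1)" by blast
next
  fix a :: symb_alg assume "a \<in> range (\<lambda>c. smult c 1)"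
  then obtain c where a: "a = smult c 1" by blast
  have "subalgebra H_symb" by (simp add: H_symb_def subalgebra_generated)
  then have "a \<in> H_symb" by (auto simp: a subalgebra_def pm.subspace_scale)
  then show "a \<in> H_symb_gr 0"
    by (auto simp: H_symb_gr_def a in_keys_iff lookup_smult lookup_one when_def weight_def
        split: if_splits)
qed

lemma linear_alg_hom: "linear_map (alg_hom f)"
proof (unfold_locales, goal_cases)
  case (1 v w)
  have *: "alg_hom f u = (\<Sum>m\<in>keys v \<union> keys w.
      smult (lookup u m) (\<Prod>g\<in>keys m. f g ^ lookup m g))"
    if "keys u \<subseteq> keys v \<union> keys w" for u
    unfolding alg_hom_def
    by (rule sum.mono_neutral_left) (use that in \<open>auto simp: in_keys_iff\<close>)
  show ?case
    by (simp add: * keys_add lookup_add pm.scale_left_distrib sum.distrib)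
next
  case (2 c w)
  have "alg_hom f (smult c w) = (\<Sum>m\<in>keys w.
      smult (lookup (smult c w) m) (\<Prod>g\<in>keys m. f g ^ lookup m g))"
    unfolding alg_hom_def
    by (rule sum.mono_neutral_left) (auto simp: in_keys_iff lookup_smult)
  then show ?case
    by (simp add: alg_hom_def lookup_smult pm.scale_sum_right)
qed

lemma alg_hom_single: "alg_hom f (single m c) = smult c (\<Prod>g\<in>keys m. f g ^ lookup m g)"
  by (simp add: alg_hom_def)

lemma alg_hom_generator: "alg_hom f (single (single g 1) 1) = f g"
  by (simp add: alg_hom_single)

lemma alg_hom_one: "alg_hom f 1 = 1"
  by (simp add: alg_hom_single flip: single_one)

lemma alg_hom_mult: "alg_hom f (a * b) = alg_hom f a * alg_hom f b"
proof -
  have eval: "(\<Prod>g\<in>keys m. f g ^ lookup m g) = (\<Prod>g\<in>A. f g ^ lookup m g)"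
    if "finite A" "keys m \<subseteq> A" for m A
    by (rule prod.mono_neutral_left) (use that in \<open>auto simp: in_keys_iff\<close>)
  have eval_add: "(\<Prod>g\<in>keys (m + n). f g ^ lookup (m + n) g)
    = (\<Prod>g\<in>keys m. f g ^ lookup m g) * (\<Prod>g\<in>keys n. f g ^ lookup n g)" for m n
    unfolding eval[of "keys m \<union> keys n" "m + n", OF _ keys_add, simplified]
      eval[of "keys m \<union> keys n" m, simplified] eval[of "keys m \<union> keys n" n, simplified]
    by (simp add: lookup_add power_add prod.distrib)
  have smult_mult: "smult c x * y = smult c (x * y)" "x * smult c y = smult c (x * y)"
    for c and x y :: "'c::comm_monoid_add \<Rightarrow>\<^sub>0 rat"
    by (simp_all add: smult_def mult.assoc mult.left_commute)
  note lin = module_hom.sum[OF Vector_Spaces.linear.axioms(3)[OF linear_alg_hom]]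
    module_hom.scale[OF Vector_Spaces.linear.axioms(3)[OF linear_alg_hom]]
    sum_distrib_left sum_distrib_right smult_mult
  have 1: "alg_hom f (single m 1 * single n 1) = alg_hom f (single m 1) * alg_hom f (single n 1)"
    for m n
    by (simp only: mult_single alg_hom_single eval_add) simp
  have 2: "alg_hom f (single m 1 * b) = alg_hom f (single m 1) * alg_hom f b" for m
    by (subst (1 2) poly_mapping_expand[of b]) (simp only: lin 1)
  show ?thesis
    by (subst (1 2) poly_mapping_expand[of a]) (simp only: lin 2)
qed


section \<open>Generating series\<close>

text \<open>
  Power series in \<open>t\<^sub>1, t\<^sub>2, \<dots>\<close> over \<open>'a\<close> are represented by the sequence of their homogeneous
  components: \<open>F\<close> is stored as the element \<open>F(s t\<^sub>1, s t\<^sub>2, \<dots>)\<close> of \<open>'a[t\<^sub>1, t\<^sub>2, \<dots>][[s]]\<close>, so \<open>fps_nth F k\<close>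
  is the component of degree \<open>k\<close>.  Sums and products of series are those of the library.
\<close>

type_synonym 'a tpoly = "(nat \<Rightarrow>\<^sub>0 nat) \<Rightarrow>\<^sub>0 'a"
type_synonym 'a series = "'a tpoly fps"

definition tvar :: "nat \<Rightarrow> 'a::comm_ring_1 tpoly" where
  "tvar r = single (single r 1) 1"

definition tcoeff :: "(nat \<Rightarrow>\<^sub>0 nat) \<Rightarrow> 'a::comm_ring_1 series \<Rightarrow> 'a" where
  "tcoeff e F = lookup (fps_nth F (\<Sum>r\<in>keys e. lookup e r)) e"

text \<open>\<open>gen_series c [l\<^sub>1, \<dots>, l\<^sub>d]\<close> is the sum of \<open>c [n\<^sub>1, \<dots>, n\<^sub>d] l\<^sub>1\<^bsup>n\<^sub>1 - 1\<^esup> \<cdots> l\<^sub>d\<^bsup>n\<^sub>d - 1\<^esup>\<close> over all \<open>n\<^sub>i \<ge> 1\<close>, for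
  linear forms \<open>l\<^sub>i\<close>; similarly \<open>exp_series c l\<close> is \<open>exp (c l)\<close>.\<close>

definition gen_series :: "(nat list \<Rightarrow> 'a::comm_ring_1) \<Rightarrow> 'a tpoly list \<Rightarrow> 'a series" where
  "gen_series c ls = Abs_fps (\<lambda>k.
     \<Sum>ns | length ns = length ls \<and> (\<forall>n\<in>set ns. 1 \<le> n) \<and> sum_list ns = k + length ls.
       single 0 (c ns) * (\<Prod>r<length ls. (ls ! r) ^ (ns ! r - 1)))"

definition exp_series ::
  "('m::comm_monoid_add \<Rightarrow>\<^sub>0 rat) \<Rightarrow> ('m \<Rightarrow>\<^sub>0 rat) tpoly \<Rightarrow> ('m \<Rightarrow>\<^sub>0 rat) series" where
  "exp_series c l = Abs_fps (\<lambda>k. single 0 (smult (1 / fact k) (c ^ k)) * l ^ k)"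

text \<open>The exponent of \<open>t\<^sub>1\<^bsup>n\<^sub>1 - 1\<^esup> \<cdots> t\<^sub>d\<^bsup>n\<^sub>d - 1\<^esup>\<close>.\<close>

definition texponent :: "nat list \<Rightarrow> nat \<Rightarrow>\<^sub>0 nat" where
  "texponent ns = (\<Sum>r<length ns. single (r + 1) (ns ! r - 1))"

text \<open>Finiteness of the index sets of the sums (infinite ones would be silently zero).\<close>

lemma finite_gen_series_index:
  "finite {ns. length ns = d \<and> (\<forall>n\<in>set ns. 1 \<le> n) \<and> sum_list ns = (k::nat)}"
proof (rule finite_subset)
  show "finite {ns. set ns \<subseteq> {..k} \<and> length ns = d}"
    by (rule finite_lists_length_eq) simp
qed (auto simp: member_le_sum_list)


section \<open>The coproduct\<close>

text \<open>Pairs of \<open>(i\<^sub>1, \<dots>, i\<^sub>k, i\<^bsub>k+1\<^esub>)\<close> and \<open>(j\<^sub>1, \<dots>, j\<^sub>k)\<close> with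
  \<open>1 \<le> i\<^sub>1 \<le> j\<^sub>1 < i\<^sub>2 \<le> \<dots> \<le> j\<^sub>k < i\<^bsub>k+1\<^esub> = d + 1\<close>.\<close>

definition comul_indices :: "nat \<Rightarrow> (nat list \<times> nat list) set" where
  "comul_indices d = {(iv, jv). length iv = length jv + 1 \<and> last iv = d + 1 \<and> 1 \<le> hd iv \<and>
     (\<forall>\<alpha><length jv. iv ! \<alpha> \<le> jv ! \<alpha> \<and> jv ! \<alpha> < iv ! (\<alpha> + 1))}"

lemma finite_comul_indices: "finite (comul_indices d)"
proof (rule finite_subset)
  let ?L = "{xs. set xs \<subseteq> {..d + 1} \<and> length xs \<le> d + 1}"
  show "finite (?L \<times> ?L)"
    by (intro finite_cartesian_product finite_lists_length_le) simp_all
  show "comul_indices d \<subseteq> ?L \<times> ?L"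
  proof
    fix p assume p: "p \<in> comul_indices d"
    obtain iv jv where p_eq: "p = (iv, jv)" by (cases p)
    have step: "iv ! a \<le> jv ! a" "jv ! a < iv ! (a + 1)" if "a < length jv" for a
      using p that by (auto simp: comul_indices_def p_eq)
    have len: "length iv = length jv + 1" and last: "last iv = d + 1" and hd: "1 \<le> hd iv"
      using p by (auto simp: comul_indices_def p_eq)
    have lower: "a + 1 \<le> iv ! a" if "a \<le> length jv" for a
      using that
    proof (induction a)
      case 0 then show ?case using hd len by (cases iv) auto
    next
      case (Suc a) then show ?case using step[of a] by auto
    qed
    have top: "iv ! length jv = d + 1"
      using last len
      by (metis add_diff_cancel_right' last_conv_nth length_0_conv nat.simps(3) Suc_eq_plus1)
    have upper: "iv ! a \<le> d + 1" if "a \<le> length jv" for a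
      using that
    proof (induction rule: inc_induct)
      case (step a) then show ?case using \<open>\<And>a. a < length jv \<Longrightarrow> iv ! a \<le> jv ! a\<close>
        \<open>\<And>a. a < length jv \<Longrightarrow> jv ! a < iv ! (a + 1)\<close> by fastforce
    qed (simp add: top)
    have "length jv \<le> d" using lower[of "length jv"] top by simp
    moreover have "set iv \<subseteq> {..d + 1}"
      using upper len by (auto simp: in_set_conv_nth)
    moreover have "set jv \<subseteq> {..d + 1}"
    proof
      fix j assume "j \<in> set jv"
      then obtain a where "a < length jv" "j = jv ! a" by (auto simp: in_set_conv_nth)
      then show "j \<in> {..d + 1}" using step(2)[of a] upper[of "a + 1"] by auto
    qed
    ultimately show "p \<in> ?L \<times> ?L" using len by (auto simp: p_eq)
  qed
qed

definition comul_series :: "laurent_monomial list \<Rightarrow> symb_alg2 series" where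
  "comul_series ys =
    (let y = (\<lambda>r. ys ! (r - 1));
         yprod = (\<lambda>i j. \<Sum>r=i..<j. y r);
         left = (\<lambda>zs. gen_series (\<lambda>ns. tensor (symb zs ns) 1));
         right = (\<lambda>zs. gen_series (\<lambda>ns. tensor 1 (symb zs ns)))
     in \<Sum>(iv, jv)\<in>comul_indices (length ys).
          left (map (\<lambda>\<alpha>. yprod (iv ! \<alpha>) (iv ! (\<alpha> + 1))) [0..<length jv]) (map tvar jv) *
          right (map y [1..<hd iv]) (map tvar [1..<hd iv]) *
          (\<Prod>\<alpha><length jv. let i = iv ! \<alpha>; j = jv ! \<alpha>; i' = iv ! (\<alpha> + 1) in
             (- 1) ^ (j - i) *
             exp_series (tensor 1 (log_symb (yprod i i'))) (tvar j) *
             right (map (\<lambda>r. - y r) (rev [i..<j])) (map (\<lambda>r. tvar j - tvar r) (rev [i..<j])) *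
             right (map y [j + 1..<i']) (map (\<lambda>r. tvar r - tvar j) [j + 1..<i'])))"

primrec comul_gen :: "generator \<Rightarrow> symb_alg2" where
  "comul_gen (Log i) = tensor (gen (Log i)) 1 + tensor 1 (gen (Log i))"
| "comul_gen (Sym ys ns) = tcoeff (texponent ns) (comul_series ys)"

definition comul :: "symb_alg \<Rightarrow> symb_alg2" where
  "comul = alg_hom comul_gen"


section \<open>Inversion\<close>

text \<open>
  For \<open>ys = [y\<^sub>1, \<dots>, y\<^sub>d]\<close>, \<open>inv_symb ys [n\<^sub>d, \<dots>, n\<^sub>1]\<close> is the image under inversion of the symbol
  \<open>[y\<^sub>d\<^sup>-\<^sup>1, \<dots>, y\<^sub>1\<^sup>-\<^sup>1]\<close> with index \<open>n\<^sub>d, \<dots>, n\<^sub>1\<close>, read off from the coefficient of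
  \<open>t\<^sub>1\<^bsup>n\<^sub>1 - 1\<^esup> \<cdots> t\<^sub>d\<^bsup>n\<^sub>d - 1\<^esup>\<close>; the sign in front comes from the arguments \<open>- t\<^sub>i\<close> of the defining series.
  The coefficient of \<open>t\<^sup>e\<close> in \<open>F / t\<^sub>j\<close> is that of \<open>t\<^sup>e t\<^sub>j\<close> in \<open>F\<close>.
\<close>

function inv_symb :: "laurent_monomial list \<Rightarrow> nat list \<Rightarrow> symb_alg" where
  "inv_symb ys ns =
    (if ys = [] then 1
     else
       let d = length ys;
           y = (\<lambda>r. ys ! (r - 1));
           e = texponent (rev ns);
           tail = (\<lambda>j. gen_series (symb (map y [j + 1..<d + 1])))
       in (- 1) ^ sum_list (map (\<lambda>n. n - 1) ns) *
          ((\<Sum>j=0..<d. (- 1) ^ (d - 1 + j) *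
              tcoeff e
                (gen_series (\<lambda>ks. inv_symb (take j ys) ks) (map (\<lambda>r. - tvar r) (rev [1..<j + 1])) *
                 tail j (map tvar [j + 1..<d + 1]))) +
           (\<Sum>j=1..<d + 1. (- 1) ^ (d - 1 + j) *
              tcoeff (e + single j 1)
                (gen_series (\<lambda>ks. inv_symb (take (j - 1) ys) ks) (map (\<lambda>r. - tvar r) (rev [1..<j])) *
                 tail j (map tvar [j + 1..<d + 1]))) +
           (\<Sum>j=1..<d + 1. (- 1) ^ (d + j) *
              tcoeff (e + single j 1)
                (gen_series (\<lambda>ks. inv_symb (take (j - 1) ys) ks)
                   (map (\<lambda>r. tvar j - tvar r) (rev [1..<j])) *
                 exp_series (log_symb (sum_list ys)) (tvar j) *
                 tail j (map (\<lambda>r. tvar r - tvar j) [j + 1..<d + 1])))))"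
  by pat_completeness auto
termination
  by (relation "Wellfounded.measure (\<lambda>(ys, ns). length ys)") auto

text \<open>An inverted argument \<open>zs\<close> is \<open>invert ys\<close> for the regular \<open>ys = invert zs\<close>.\<close>

primrec INV_gen :: "generator \<Rightarrow> symb_alg" where
  "INV_gen (Log i) = gen (Log i)"
| "INV_gen (Sym zs ns) = (if regular (invert zs) then inv_symb (invert zs) ns else gen (Sym zs ns))"

definition INV :: "symb_alg \<Rightarrow> symb_alg" where
  "INV = alg_hom INV_gen"

definition inv_comul :: "symb_alg \<Rightarrow> symb_alg2" where
  "inv_comul a = tensor_map INV INV (comul a)"

end

theory Submission
  imports Defs
begin

text \<open>
  Evaluating the \<open>t\<^sub>i\<close> at rational numbers and grading by weight turns all generating series into
  functions on words in edges \<open>(t, y)\<close>, multiplied by deconcatenation.  Let \<open>F\<close> be the function of the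
  regular symbols, \<open>G\<close> that of the (sign-twisted) inverted ones, and let \<open>S\<close> be the endomorphism which
  contracts a block of edges with label sequence \<open>t\<^sub>1, \<dots>, t\<^sub>d\<close> to one edge with label \<open>t\<^sub>j\<close>, with weight
  \<open>exp([y]\<^sub>0 t\<^sub>j)\<close> times the values of \<open>G\<close> and \<open>F\<close> left and right of \<open>j\<close>, translated by \<open>- t\<^sub>j\<close>.  The
  coproduct says that the composite of two such data is \<open>F = F\<^sub>2 * S\<^sub>2 F\<^sub>1\<close>.  The definition of the
  inversion is equivalent to \<open>G * (1 - \<tau>) * F = S (1 - \<tau>)\<close>, where \<open>\<tau>\<close> is supported on words of length
  one with value \<open>1 / t\<close>.  With \<open>G = S\<^sub>2 G\<^sub>1 * G\<^sub>2\<close> one has \<open>S = S\<^sub>2 \<circ> S\<^sub>1\<close>, and the inversion relation is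
  inherited: \<open>S\<^sub>2 G\<^sub>1 * G\<^sub>2 * (1 - \<tau>) * F\<^sub>2 * S\<^sub>2 F\<^sub>1 = S\<^sub>2 (G\<^sub>1 * (1 - \<tau>) * F\<^sub>1) = S\<^sub>2 (S\<^sub>1 (1 - \<tau>))\<close>.
  As it determines \<open>G\<close> from \<open>F\<close>, inversion is compatible with composition, and coassociativity becomes
  the associativity of the composition.  The antipode exists since the bialgebra is graded and connected.
\<close>

text \<open>The obstacle is that the right tensor factor contains images of inverted symbols,
  polynomials in regular symbols that are given only by recursion, so that a second coproduct would
  need a formula for their coproduct. Uniqueness in the inversion relation supplies it: after
  composition with the coproduct both candidates for \<open>G\<close> belong to the same
  \<open>F\<close>, hence agree. This works because \<tau> has constant values, which every algebra
  map preserves, so that one relation serves the data of all algebra maps out of the symbol algebra.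

  At rational points a translation of the variables is a subtraction of labels, and the division by
  \<open>t\<close> is a division by a number. For the latter the labels must be nonzero, and they
  must stay so after translation by the label of another edge. Hence only words with distinct
  nonzero labels are considered, a condition that is inherited by contractions and by the translated
  words on both sides of an edge. The points that remain are enough to recover all
  coefficients.\<close>

type_synonym 'y word = "(rat \<times> 'y) list"

section \<open>Decompositions of a word\<close>

primrec splits :: "'a list \<Rightarrow> ('a list \<Rightarrow> 'a list \<Rightarrow> 'r::comm_ring_1) \<Rightarrow> 'r" where
  "splits [] g = g [] []"
| "splits (x # xs) g = g [] (x # xs) + splits xs (\<lambda>a b. g (x # a) b)"

primrec marks :: "'a list \<Rightarrow> ('a list \<Rightarrow> 'a \<Rightarrow> 'a list \<Rightarrow> 'r::comm_ring_1) \<Rightarrow> 'r" where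
  "marks [] g = 0"
| "marks (x # xs) g = g [] x xs + marks xs (\<lambda>a. g (x # a))"

text \<open>As a \<open>fundef_cong\<close> rule it hands \<open>a @ b = xs\<close> to the
  termination proof of \<open>subst\<close>, where a nonempty first block makes the remainder
  shorter.\<close>

lemma splits_cong [fundef_cong]:
  assumes "xs = ys" "\<And>a b. a @ b = ys \<Longrightarrow> g a b = h a b"
  shows "splits xs g = splits ys h"
  unfolding assms(1) using assms(2)
proof (induction ys arbitrary: g h)
  case (Cons y ys)
  have "splits ys (\<lambda>a. g (y # a)) = splits ys (\<lambda>a. h (y # a))"
    by (rule Cons.IH) (simp add: Cons.prems)
  then show ?case using Cons.prems[of "[]" "y # ys"] by simp
qed simp

lemma marks_cong [fundef_cong]:
  assumes "xs = ys" "\<And>a x b. a @ x # b = ys \<Longrightarrow> g a x b = h a x b"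
  shows "marks xs g = marks ys h"
  unfolding assms(1) using assms(2)
proof (induction ys arbitrary: g h)
  case (Cons y ys)
  have "marks ys (\<lambda>a. g (y # a)) = marks ys (\<lambda>a. h (y # a))"
    by (rule Cons.IH) (simp add: Cons.prems)
  then show ?case using Cons.prems[of "[]" y ys] by simp
qed simp

text \<open>
  Sums over decompositions of words and the substitutions below are finite functionals; this is what
  allows them to be interchanged.
\<close>

definition finite_functional :: "(('a \<Rightarrow> 'r::comm_ring_1) \<Rightarrow> 'r) \<Rightarrow> bool" where
  "finite_functional \<Lambda> \<longleftrightarrow> (\<exists>l. \<forall>f. \<Lambda> f = (\<Sum>(w, x)\<leftarrow>l. w * f x))"

lemma finite_functional_add:
  assumes "finite_functional \<Lambda>" shows "\<Lambda> (\<lambda>x. f x + g x) = \<Lambda> f + \<Lambda> g"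
  using assms unfolding finite_functional_def
  by (auto simp: case_prod_unfold algebra_simps sum_list_addf)

lemma finite_functional_diff:
  assumes "finite_functional \<Lambda>" shows "\<Lambda> (\<lambda>x. f x - g x) = \<Lambda> f - \<Lambda> g"
  using assms unfolding finite_functional_def
  by (auto simp: case_prod_unfold algebra_simps sum_list_subtractf)

lemma finite_functional_mult_left:
  assumes "finite_functional \<Lambda>" shows "\<Lambda> (\<lambda>x. c * f x) = c * \<Lambda> f"
proof -
  obtain l where l: "\<And>f. \<Lambda> f = (\<Sum>(w, x)\<leftarrow>l. w * f x)"
    using assms unfolding finite_functional_def by blast
  show ?thesis unfolding l by (induction l) (auto simp: algebra_simps)
qed

lemma finite_functional_mult_right:
  assumes "finite_functional \<Lambda>" shows "\<Lambda> (\<lambda>x. f x * c) = \<Lambda> f * c"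
  using finite_functional_mult_left[OF assms, of c f] by (simp add: mult.commute)

lemma finite_functional_zero:
  assumes "finite_functional \<Lambda>" shows "\<Lambda> (\<lambda>x. 0) = 0"
  using finite_functional_mult_left[OF assms, of 0 "\<lambda>_. 0"] by simp

text \<open>Fubini for finite sums: one functional is written out, and linearity of the other does
  the rest.\<close>

lemma finite_functional_commute:
  assumes "finite_functional \<Lambda>" and M: "finite_functional M"
  shows "\<Lambda> (\<lambda>x. M (\<lambda>y. g x y)) = M (\<lambda>y. \<Lambda> (\<lambda>x. g x y))"
proof -
  obtain l where l: "\<And>f. \<Lambda> f = (\<Sum>(w, x)\<leftarrow>l. w * f x)"
    using assms unfolding finite_functional_def by blast
  have "(\<Sum>p\<leftarrow>l. fst p * M (g (snd p))) = M (\<lambda>y. \<Sum>p\<leftarrow>l. fst p * g (snd p) y)"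
    by (induction l)
      (simp_all add: finite_functional_add[OF M] finite_functional_mult_left[OF M] finite_functional_zero[OF M])
  then show ?thesis unfolding l case_prod_unfold .
qed

lemma finite_functional_const: "finite_functional (\<lambda>f. 0)"
  unfolding finite_functional_def by (rule exI[of _ "[]"]) simp

lemma finite_functional_eval: "finite_functional (\<lambda>f. c * f x)"
  unfolding finite_functional_def by (rule exI[of _ "[(c, x)]"]) simp

lemma finite_functional_apply: "finite_functional (\<lambda>f. f x)"
  using finite_functional_eval[of 1 x] by simp

lemma finite_functional_plus:
  assumes "finite_functional \<Lambda>" "finite_functional M"
  shows "finite_functional (\<lambda>f. \<Lambda> f + M f)"
proof -
  obtain l k where "\<And>f. \<Lambda> f = (\<Sum>(w, x)\<leftarrow>l. w * f x)"
    and "\<And>f. M f = (\<Sum>(w, x)\<leftarrow>k. w * f x)"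
    using assms unfolding finite_functional_def by blast
  then show ?thesis
    unfolding finite_functional_def by (intro exI[of _ "l @ k"]) simp
qed

lemma finite_functional_scale:
  assumes "finite_functional \<Lambda>"
  shows "finite_functional (\<lambda>f. \<Lambda> f * c)"
proof -
  obtain l where l: "\<And>f. \<Lambda> f = (\<Sum>(w, x)\<leftarrow>l. w * f x)"
    using assms unfolding finite_functional_def by blast
  have "\<Lambda> f * c = (\<Sum>(w, x)\<leftarrow>map (\<lambda>(w, x). (w * c, x)) l. w * f x)" for f
    unfolding l by (induction l) (auto simp: algebra_simps)
  then show ?thesis unfolding finite_functional_def by blast
qed

lemma finite_functional_reindex:
  assumes "finite_functional \<Lambda>"
  shows "finite_functional (\<lambda>f. \<Lambda> (\<lambda>x. f (h x)))"
proof -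
  obtain l where l: "\<And>f. \<Lambda> f = (\<Sum>(w, x)\<leftarrow>l. w * f x)"
    using assms unfolding finite_functional_def by blast
  have "\<Lambda> (\<lambda>x. f (h x)) = (\<Sum>(w, x)\<leftarrow>map (\<lambda>(w, x). (w, h x)) l. w * f x)" for f
    unfolding l by (induction l) auto
  then show ?thesis unfolding finite_functional_def by blast
qed

lemma finite_functional_splits:
  assumes "\<And>a b. a @ b = xs \<Longrightarrow> finite_functional (\<Lambda> a b)"
  shows "finite_functional (\<lambda>f. splits xs (\<lambda>a b. \<Lambda> a b f))"
  using assms
proof (induction xs arbitrary: \<Lambda>)
  case (Cons x xs)
  show ?case
    by (simp, rule finite_functional_plus, rule Cons.prems, simp, rule Cons.IH, rule Cons.prems, simp)
qed simp

lemma finite_functional_marks: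
  assumes "\<And>a x b. a @ x # b = xs \<Longrightarrow> finite_functional (\<Lambda> a x b)"
  shows "finite_functional (\<lambda>f. marks xs (\<lambda>a x b. \<Lambda> a x b f))"
  using assms
proof (induction xs arbitrary: \<Lambda>)
  case (Cons x xs)
  show ?case
    by (simp, rule finite_functional_plus, rule Cons.prems, simp, rule Cons.IH, rule Cons.prems, simp)
qed (simp add: finite_functional_const)

lemma splits_add: "splits xs (\<lambda>a b. f a b + g a b) = splits xs f + splits xs g"
  by (induction xs arbitrary: f g) simp_all

lemma splits_diff: "splits xs (\<lambda>a b. f a b - g a b) = splits xs f - splits xs g"
  by (induction xs arbitrary: f g) simp_all

lemma splits_zero [simp]: "splits xs (\<lambda>a b. 0) = 0"
  by (induction xs) simp_all

lemma splits_mult_left: "splits xs (\<lambda>a b. c * f a b) = c * splits xs f"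
  by (induction xs arbitrary: f) (simp_all add: algebra_simps)

lemma splits_mult_right: "splits xs (\<lambda>a b. f a b * c) = splits xs f * c"
  by (induction xs arbitrary: f) (simp_all add: algebra_simps)

lemma marks_mult_left: "marks xs (\<lambda>a x b. c * f a x b) = c * marks xs f"
  by (induction xs arbitrary: f) (simp_all add: algebra_simps)

lemma marks_add: "marks xs (\<lambda>a x b. f a x b + g a x b) = marks xs f + marks xs g"
  by (induction xs arbitrary: f g) simp_all

lemma splits_Nil_left: "splits xs (\<lambda>a b. if a = [] then f b else 0) = f xs"
  by (induction xs) simp_all

lemma splits_Nil_right: "splits xs (\<lambda>a b. if b = [] then f a else 0) = f xs"
  by (induction xs arbitrary: f) simp_all

text \<open>Both sides run over the factorisations of \<open>xs\<close> into three words.\<close>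

lemma splits_assoc:
  "splits xs (\<lambda>a r. splits r (\<lambda>b c. g a b c)) = splits xs (\<lambda>r c. splits r (\<lambda>a b. g a b c))"
  by (induction xs arbitrary: g) (simp_all add: splits_add)

lemma marks_eq_splits:
  "marks xs g = splits xs (\<lambda>a r. case r of [] \<Rightarrow> 0 | x # b \<Rightarrow> g a x b)"
  by (induction xs arbitrary: g) simp_all

lemma marks_splits_left:
  "marks xs (\<lambda>r x c. splits r (\<lambda>a b. g a b x c)) = splits xs (\<lambda>a r. marks r (\<lambda>b x c. g a b x c))"
  by (induction xs arbitrary: g) (simp_all add: marks_add)

lemma marks_splits_right:
  "marks xs (\<lambda>a x r. splits r (\<lambda>b c. g a x b c)) = splits xs (\<lambda>r c. marks r (\<lambda>a x b. g a x b c))"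
  by (induction xs arbitrary: g) (simp_all add: splits_add)

section \<open>Deconcatenation product of functions on words\<close>

definition conv :: "('a list \<Rightarrow> 'r) \<Rightarrow> ('a list \<Rightarrow> 'r) \<Rightarrow> 'a list \<Rightarrow> 'r::comm_ring_1" where
  "conv f g xs = splits xs (\<lambda>a b. f a * g b)"

definition unit_word :: "'a list \<Rightarrow> 'r::comm_ring_1" where
  "unit_word xs = (if xs = [] then 1 else 0)"

lemma conv_assoc: "conv (conv f g) h = conv f (conv g h)"
proof
  fix xs
  have "conv (conv f g) h xs = splits xs (\<lambda>r c. splits r (\<lambda>a b. f a * g b * h c))"
    unfolding conv_def by (simp add: splits_mult_right)
  also have "\<dots> = splits xs (\<lambda>a r. splits r (\<lambda>b c. f a * g b * h c))"
    by (rule splits_assoc[symmetric])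
  also have "\<dots> = conv f (conv g h) xs"
    unfolding conv_def by (simp add: splits_mult_left mult.assoc)
  finally show "conv (conv f g) h xs = conv f (conv g h) xs" .
qed

lemma conv_unit_left: "conv unit_word f = f"
proof
  fix xs
  have "conv unit_word f xs = splits xs (\<lambda>a b. if a = [] then f b else 0)"
    unfolding conv_def by (rule splits_cong) (simp_all add: unit_word_def)
  then show "conv unit_word f xs = f xs" by (simp add: splits_Nil_left)
qed

lemma conv_unit_right: "conv f unit_word = f"
proof
  fix xs
  have "conv f unit_word xs = splits xs (\<lambda>a b. if b = [] then f a else 0)"
    unfolding conv_def by (rule splits_cong) (simp_all add: unit_word_def)
  then show "conv f unit_word xs = f xs" by (simp add: splits_Nil_right)
qed

lemma conv_Nil: "conv f g [] = f [] * g []"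
  by (simp add: conv_def)

text \<open>Isolates the value of \<open>g\<close> at the whole word. When \<open>B [] = 1\<close>,
  an equation for \<open>conv g B\<close> can thus be solved for \<open>g xs\<close> in terms of
  values at shorter words.\<close>

lemma conv_split_last:
  "conv g B xs = g xs * B [] + splits xs (\<lambda>a b. if b = [] then 0 else g a * B b)"
proof -
  have "conv g B xs = splits xs (\<lambda>a b. (if b = [] then g a * B [] else 0) +
      (if b = [] then 0 else g a * B b))"
    unfolding conv_def by (rule splits_cong) auto
  then show ?thesis by (simp add: splits_add splits_Nil_right)
qed

section \<open>Total argument of a word and translation of its labels\<close>

definition ysum :: "'y::comm_monoid_add word \<Rightarrow> 'y" where
  "ysum b = sum_list (map snd b)"

lemma ysum_simps [simp]: "ysum [] = 0" "ysum (x # b) = snd x + ysum b"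
  "ysum (a @ b) = ysum a + ysum b"
  by (simp_all add: ysum_def)

definition shift :: "rat \<Rightarrow> 'y word \<Rightarrow> 'y word" where
  "shift t = map (\<lambda>(s, y). (s - t, y))"

lemma shift_simps [simp]: "shift t [] = []" "shift t (x # b) = (fst x - t, snd x) # shift t b"
  "shift t (a @ b) = shift t a @ shift t b" "shift s (shift t b) = shift (s + t) b"
  "length (shift t b) = length b" "map snd (shift t b) = map snd b" "shift t b = [] \<longleftrightarrow> b = []"
  by (auto simp: shift_def case_prod_unfold comp_def algebra_simps)

lemma ysum_shift [simp]: "ysum (shift t b) = ysum b"
  by (simp add: ysum_def)

lemma splits_shift: "splits (shift t xs) g = splits xs (\<lambda>a b. g (shift t a) (shift t b))"
  by (induction xs arbitrary: g) simp_all

lemma marks_shift: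
  "marks (shift t xs) g = marks xs (\<lambda>a x b. g (shift t a) (fst x - t, snd x) (shift t b))"
  by (induction xs arbitrary: g) simp_all

lemma conv_shift: "conv f g (shift t xs) = conv (\<lambda>w. f (shift t w)) (\<lambda>w. g (shift t w)) xs"
  by (simp add: conv_def splits_shift)

section \<open>Substitutions\<close>

text \<open>
  A block \<open>(t\<^sub>1, y\<^sub>1), \<dots>, (t\<^sub>d, y\<^sub>d)\<close> is contracted to the single edge \<open>(t\<^sub>j, y\<^sub>1 + \<dots> + y\<^sub>d)\<close>, for any
  choice of \<open>j\<close>.
\<close>

definition contract_block :: "('y::comm_monoid_add word \<Rightarrow> 'r) \<Rightarrow> ('y word \<Rightarrow> 'r) \<Rightarrow> (rat \<Rightarrow> 'y \<Rightarrow> 'r) \<Rightarrow>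
    (rat \<times> 'y \<Rightarrow> 'r) \<Rightarrow> 'y word \<Rightarrow> 'r::comm_ring_1" where
  "contract_block F G ex c b = marks b (\<lambda>a x a'.
     c (fst x, ysum b) * (ex (fst x) (ysum b) * G (shift (fst x) a) * F (shift (fst x) a')))"

text \<open>The substitution acts on functions \<open>f\<close>: the contracted word is built up
  inside the argument of \<open>f\<close>, one block at a time, so that \<open>f\<close> may be any
  function of the whole word. The test \<open>b = []\<close> makes the recursion terminate.\<close>

function subst :: "('y::comm_monoid_add word \<Rightarrow> 'r) \<Rightarrow> ('y word \<Rightarrow> 'r) \<Rightarrow> (rat \<Rightarrow> 'y \<Rightarrow> 'r) \<Rightarrow>
    ('y word \<Rightarrow> 'r) \<Rightarrow> 'y word \<Rightarrow> 'r::comm_ring_1" where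
  "subst F G ex f xs = (if xs = [] then f [] else
     splits xs (\<lambda>b r. if b = [] then 0
       else contract_block F G ex (\<lambda>e. subst F G ex (\<lambda>w. f (e # w)) r) b))"
  by pat_completeness auto
termination
  by (relation "Wellfounded.measure (\<lambda>(F, G, ex, f, xs). length xs)") auto

declare subst.simps [simp del]

lemma contract_block_Nil [simp]: "contract_block F G ex c [] = 0"
  by (simp add: contract_block_def)

text \<open>An empty block has no letter to mark and so contributes 0; the recursion becomes a plain
  sum over all first blocks.\<close>

lemma subst_unfold:
  "subst F G ex f xs = (if xs = [] then f [] else 0) +
     splits xs (\<lambda>b r. contract_block F G ex (\<lambda>e. subst F G ex (\<lambda>w. f (e # w)) r) b)"
proof (cases "xs = []")
  case False
  have "subst F G ex f xs = splits xs (\<lambda>b r. if b = [] then 0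
      else contract_block F G ex (\<lambda>e. subst F G ex (\<lambda>w. f (e # w)) r) b)"
    using False by (subst subst.simps) simp
  also have "\<dots> = splits xs (\<lambda>b r. contract_block F G ex (\<lambda>e. subst F G ex (\<lambda>w. f (e # w)) r) b)"
  proof (rule splits_cong[OF refl])
    fix a b
    show "(if a = [] then 0 else contract_block F G ex (\<lambda>e. subst F G ex (\<lambda>w. f (e # w)) b) a)
      = contract_block F G ex (\<lambda>e. subst F G ex (\<lambda>w. f (e # w)) b) a"
      by (cases "a = []") simp_all
  qed
  finally show ?thesis using False by simp
qed (simp add: subst.simps)

lemma subst_Nil [simp]: "subst F G ex f [] = f []"
  by (simp add: subst.simps)

lemma finite_functional_contract_block: "finite_functional (\<lambda>c. contract_block F G ex c b)"
  unfolding contract_block_def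
  by (intro finite_functional_marks finite_functional_scale finite_functional_apply)

lemma finite_functional_subst: "finite_functional (\<lambda>f. subst F G ex f xs)"
proof (induction xs rule: length_induct)
  case (1 xs)
  have "finite_functional (\<lambda>f. contract_block F G ex (\<lambda>e. subst F G ex (\<lambda>w. f (e # w)) r) b)"
    if "b @ r = xs" for b r
  proof (cases "b = []")
    case False
    then have "finite_functional (\<lambda>f. subst F G ex f r)" using 1 that by auto
    then show ?thesis
      unfolding contract_block_def
      by (intro finite_functional_marks finite_functional_scale)
        (rule finite_functional_reindex)
  qed (simp add: finite_functional_const)
  moreover have "finite_functional (\<lambda>f. if xs = [] then f [] else 0)"
    by (cases "xs = []") (simp_all add: finite_functional_apply finite_functional_const)
  ultimately show ?case
    unfolding subst_unfold[of F G ex _ xs]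
    by (intro finite_functional_plus finite_functional_splits)
qed

lemmas subst_add = finite_functional_add[OF finite_functional_subst]
  and subst_diff = finite_functional_diff[OF finite_functional_subst]
  and subst_mult_left = finite_functional_mult_left[OF finite_functional_subst]
  and subst_mult_right = finite_functional_mult_right[OF finite_functional_subst]
  and subst_zero = finite_functional_zero[OF finite_functional_subst]

lemma finite_functional_splits': "finite_functional (\<lambda>g. splits xs (\<lambda>a b. g (a, b)))"
  by (intro finite_functional_splits finite_functional_apply)

lemma finite_functional_splits_commute:
  assumes "finite_functional \<Lambda>"
  shows "\<Lambda> (\<lambda>x. splits xs (\<lambda>a b. g x a b)) = splits xs (\<lambda>a b. \<Lambda> (\<lambda>x. g x a b))"
  using finite_functional_commute[OF assms finite_functional_splits'[of xs], of "\<lambda>x p. g x (fst p) (snd p)"]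
  by simp

text \<open>
  For \<open>g a b = f a * h b\<close> this is multiplicativity; the bilinear form also covers factors that are
  coupled through the label of a common edge.
\<close>

lemma subst_splits:
  "subst F G ex (\<lambda>w. splits w g) xs
    = splits xs (\<lambda>a r. subst F G ex (\<lambda>a'. subst F G ex (\<lambda>r'. g a' r') r) a)"
proof (induction xs arbitrary: g rule: length_induct)
  case (1 xs)
  let ?S = "subst F G ex" and ?K = "contract_block F G ex"
  \<comment> \<open>The cut in front of the first contracted edge is separated from the cuts behind
    it, which leave the first block in the left part.\<close>
  have "?S (\<lambda>w. splits w g) xs = (if xs = [] then g [] [] else 0) +
      splits xs (\<lambda>b r. ?K (\<lambda>e. ?S (\<lambda>w. g [] (e # w)) r) b) +
      splits xs (\<lambda>b r. ?K (\<lambda>e. ?S (\<lambda>w. splits w (\<lambda>a. g (e # a))) r) b)"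
    by (subst subst_unfold) (simp add: subst_add splits_add add.assoc
        finite_functional_add[OF finite_functional_contract_block])
  also have "(if xs = [] then g [] [] else 0) +
      splits xs (\<lambda>b r. ?K (\<lambda>e. ?S (\<lambda>w. g [] (e # w)) r) b) = ?S (g []) xs"
    by (subst (2) subst_unfold) simp
  also have "splits xs (\<lambda>b r. ?K (\<lambda>e. ?S (\<lambda>w. splits w (\<lambda>a. g (e # a))) r) b)
    = splits xs (\<lambda>b r. splits r (\<lambda>a r2. ?K (\<lambda>e. ?S (\<lambda>a'. ?S (\<lambda>r'. g (e # a') r') r2) a) b))"
  proof (rule splits_cong[OF refl])
    fix b r assume br: "b @ r = xs"
    show "?K (\<lambda>e. ?S (\<lambda>w. splits w (\<lambda>a. g (e # a))) r) b
      = splits r (\<lambda>a r2. ?K (\<lambda>e. ?S (\<lambda>a'. ?S (\<lambda>r'. g (e # a') r') r2) a) b)"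
    proof (cases "b = []")
      case False
      then have "?S (\<lambda>w. splits w (\<lambda>a. g (e # a))) r
        = splits r (\<lambda>a r2. ?S (\<lambda>a'. ?S (\<lambda>r'. g (e # a') r') r2) a)" for e
        using 1[rule_format, of r "\<lambda>a. g (e # a)"] br by auto
      then show ?thesis
        by (simp add: finite_functional_splits_commute[OF finite_functional_contract_block])
    qed simp
  qed
  also have "\<dots> = splits xs (\<lambda>r c. splits r (\<lambda>b a. ?K (\<lambda>e. ?S (\<lambda>a'. ?S (\<lambda>r'. g (e # a') r') c) a) b))"
    by (rule splits_assoc)
  also have "?S (g []) xs + \<dots> = splits xs (\<lambda>a r. ?S (\<lambda>a'. ?S (\<lambda>r'. g a' r') r) a)"
  proof -
    have "?S (\<lambda>a'. ?S (g a') r) a = (if a = [] then ?S (g []) r else 0) +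
        splits a (\<lambda>b a. ?K (\<lambda>e. ?S (\<lambda>a'. ?S (g (e # a')) r) a) b)" for a r
      by (rule subst_unfold)
    then show ?thesis by (simp add: splits_add splits_Nil_left)
  qed
  finally show ?case .
qed

lemma subst_conv:
  "subst F G ex (conv f g) = conv (subst F G ex f) (subst F G ex g)"
  by (rule ext) (simp add: conv_def[abs_def] subst_splits subst_mult_left subst_mult_right)

lemma subst_unit: "subst F G ex unit_word = unit_word"
proof
  fix xs show "subst F G ex unit_word xs = (unit_word xs :: 'b)"
    by (subst subst_unfold)
      (simp add: unit_word_def subst_zero finite_functional_zero[OF finite_functional_contract_block])
qed

definition single_edge :: "('e \<Rightarrow> 'r) \<Rightarrow> 'e list \<Rightarrow> 'r::comm_ring_1" where
  "single_edge c w = (case w of [e] \<Rightarrow> c e | _ \<Rightarrow> 0)"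

lemma single_edge_simps [simp]: "single_edge c [] = 0" "single_edge c [e] = c e"
  "single_edge c (e # e' # w) = 0"
  by (simp_all add: single_edge_def)

text \<open>Only the decomposition into a single block contracts to a word of length one.\<close>

lemma subst_single_edge: "subst F G ex (single_edge c) = contract_block F G ex c"
proof
  fix xs
  have "subst F G ex (\<lambda>w. single_edge c (e # w)) r = (if r = [] then c e else 0)" for e r
  proof -
    have "(\<lambda>w. single_edge c (e # w)) = (\<lambda>w. c e * unit_word w)"
      by (auto simp: fun_eq_iff single_edge_def unit_word_def split: list.splits)
    then show ?thesis by (simp add: subst_mult_left subst_unit) (simp add: unit_word_def)
  qed
  then have "subst F G ex (single_edge c) xs
    = splits xs (\<lambda>b r. contract_block F G ex (\<lambda>e. if r = [] then c e else 0) b)"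
    by (subst subst_unfold) simp
  also have "\<dots> = splits xs (\<lambda>b r. if r = [] then contract_block F G ex c b else 0)"
    by (intro splits_cong refl) (simp add: finite_functional_zero[OF finite_functional_contract_block])
  finally show "subst F G ex (single_edge c) xs = contract_block F G ex c xs"
    by (simp add: splits_Nil_right)
qed


lemma finite_functional_contract_commute:
  assumes "finite_functional \<Lambda>"
  shows "\<Lambda> (\<lambda>x. contract_block F G ex (g x) b) = contract_block F G ex (\<lambda>e. \<Lambda> (\<lambda>x. g x e)) b"
  by (rule finite_functional_commute[OF assms finite_functional_contract_block])

text \<open>The words at which \<open>subst\<close> evaluates \<open>f\<close>. Recording them gives
  a congruence rule strong enough for identities that hold on admissible words only.\<close>

inductive contracts :: "'y::comm_monoid_add word \<Rightarrow> 'y word \<Rightarrow> bool" where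
  contracts_Nil: "contracts [] []"
| contracts_Cons: "contracts w r \<Longrightarrow> x \<in> set b \<Longrightarrow> contracts ((fst x, ysum b) # w) (b @ r)"

lemma contracts_ysum: "contracts w xs \<Longrightarrow> ysum w = ysum xs"
  by (induction rule: contracts.induct) simp_all

lemma contracts_labels:
  assumes "contracts w xs"
  shows "fst ` set w \<subseteq> fst ` set xs"
    and "distinct (map fst xs) \<Longrightarrow> distinct (map fst w)"
proof -
  have "fst ` set w \<subseteq> fst ` set xs \<and> (distinct (map fst xs) \<longrightarrow> distinct (map fst w))"
    using assms by (induction rule: contracts.induct) auto
  then show "fst ` set w \<subseteq> fst ` set xs" "distinct (map fst xs) \<Longrightarrow> distinct (map fst w)"
    by blast+
qed

lemma contract_block_cong:
  assumes "\<And>a x a'. a @ x # a' = b \<Longrightarrow> G (shift (fst x) a) = G' (shift (fst x) a)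
      \<and> F (shift (fst x) a') = F' (shift (fst x) a') \<and> ex (fst x) (ysum b) = ex' (fst x) (ysum b)
      \<and> c (fst x, ysum b) = c' (fst x, ysum b)"
  shows "contract_block F G ex c b = contract_block F' G' ex' c' b"
  unfolding contract_block_def by (rule marks_cong[OF refl]) (simp add: assms)

lemma subst_cong:
  assumes "\<And>w. contracts w xs \<Longrightarrow> f w = f' w"
  shows "subst F G ex f xs = subst F G ex f' xs"
  using assms
proof (induction xs arbitrary: f f' rule: length_induct)
  case (1 xs)
  have "contract_block F G ex (\<lambda>e. subst F G ex (\<lambda>w. f (e # w)) r) b
      = contract_block F G ex (\<lambda>e. subst F G ex (\<lambda>w. f' (e # w)) r) b" if br: "b @ r = xs" for b r
  proof (cases "b = []")
    case False
    show ?thesis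
    proof (rule contract_block_cong, intro conjI refl)
      fix a x a' assume b: "a @ x # a' = b"
      have "contracts ((fst x, ysum b) # w) xs" if "contracts w r" for w
        using contracts_Cons[OF that, of x b] br b by auto
      then show "subst F G ex (\<lambda>w. f ((fst x, ysum b) # w)) r = subst F G ex (\<lambda>w. f' ((fst x, ysum b) # w)) r"
        using 1(1)[rule_format, of r "\<lambda>w. f ((fst x, ysum b) # w)" "\<lambda>w. f' ((fst x, ysum b) # w)"]
          1(2) False br by auto
    qed
  qed simp
  moreover have "f [] = f' []" if "xs = []" using 1(2)[of "[]"] that by (simp add: contracts_Nil)
  ultimately show ?case
    unfolding subst_unfold[of F G ex f xs] subst_unfold[of F G ex f' xs]
    by (intro arg_cong2[where f = "(+)"] splits_cong refl) auto
qed

lemma subst_cong_data: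
  assumes "\<And>p a x a' q. p @ a @ x # a' @ q = xs \<Longrightarrow> G (shift (fst x) a) = G' (shift (fst x) a)
      \<and> F (shift (fst x) a') = F' (shift (fst x) a')" and "\<And>t y. ex t y = ex' t y"
  shows "subst F G ex f xs = subst F' G' ex' f xs"
  using assms(1)
proof (induction xs arbitrary: f rule: length_induct)
  case (1 xs)
  have "contract_block F G ex (\<lambda>e. subst F G ex (\<lambda>w. f (e # w)) r) b
      = contract_block F' G' ex' (\<lambda>e. subst F' G' ex' (\<lambda>w. f (e # w)) r) b" if br: "b @ r = xs" for b r
  proof (cases "b = []")
    case False
    have "subst F G ex h r = subst F' G' ex' h r" for h
    proof (rule 1(1)[rule_format])
      show "length r < length xs" using False br by auto
      fix p a x a' q assume "p @ a @ x # a' @ q = r"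
      then show "G (shift (fst x) a) = G' (shift (fst x) a) \<and> F (shift (fst x) a') = F' (shift (fst x) a')"
        using 1(2)[of "b @ p" a x a' q] br by simp
    qed
    moreover have "G (shift (fst x) a) = G' (shift (fst x) a) \<and> F (shift (fst x) a') = F' (shift (fst x) a')"
      if "a @ x # a' = b" for a x a'
      using 1(2)[of "[]" a x a' r] br that by auto
    ultimately show ?thesis by (intro contract_block_cong) (simp add: assms(2))
  qed simp
  then show ?case
    unfolding subst_unfold[of F G ex f xs] subst_unfold[of F' G' ex' f xs]
    by (intro arg_cong2[where f = "(+)"] splits_cong refl) auto
qed

text \<open>A bicharacter in \<open>t\<close> and \<open>y\<close>, modelled on
  \<open>exp([y]_0 t)\<close>.\<close>

definition additive_exp :: "(rat \<Rightarrow> 'y::comm_monoid_add \<Rightarrow> 'r::comm_ring_1) \<Rightarrow> bool" where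
  "additive_exp ex \<longleftrightarrow> (\<forall>s t y. ex (s + t) y = ex s y * ex t y) \<and> (\<forall>t y z. ex t (y + z) = ex t y * ex t z)
     \<and> (\<forall>y. ex 0 y = 1) \<and> (\<forall>t. ex t 0 = 1)"

text \<open>Inside a block only differences of labels enter, so a translation changes nothing but
  the label of the contracted edge and hence its exponential factor.\<close>

lemma contract_block_shift:
  assumes "additive_exp ex"
  shows "contract_block F G ex c (shift s b)
    = ex (- s) (ysum b) * contract_block F G ex (\<lambda>e. c (fst e - s, snd e)) b"
proof -
  have "ex (t - s) y = ex (- s) y * ex t y" for t y
    using assms unfolding additive_exp_def by (metis diff_conv_add_uminus add.commute)
  then show ?thesis
    unfolding contract_block_def marks_shift marks_mult_left[symmetric]
    by (intro marks_cong refl) (simp add: mult_ac)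
qed

text \<open>The exponential factors of the blocks multiply to one for the whole word, since
  \<open>ysum\<close> adds over blocks.\<close>

lemma subst_shift:
  assumes ex: "additive_exp ex"
  shows "subst F G ex f (shift s xs) = ex (- s) (ysum xs) * subst F G ex (\<lambda>w. f (shift s w)) xs"
proof (induction xs arbitrary: f rule: length_induct)
  case (1 xs)
  let ?K = "contract_block F G ex" and ?S = "subst F G ex"
  have "?K (\<lambda>e. ?S (\<lambda>w. f (e # w)) (shift s r)) (shift s b)
      = ex (- s) (ysum xs) * ?K (\<lambda>e. ?S (\<lambda>w. f (shift s (e # w))) r) b" if br: "b @ r = xs" for b r
  proof (cases "b = []")
    case False
    have "?S h (shift s r) = ex (- s) (ysum r) * ?S (\<lambda>w. h (shift s w)) r" for h
      using 1 br False by auto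
    moreover have "ex (- s) (ysum xs) = ex (- s) (ysum b) * ex (- s) (ysum r)"
      using ex br[symmetric] by (simp add: additive_exp_def)
    ultimately show ?thesis
      by (simp add: contract_block_shift[OF ex] mult.assoc
          finite_functional_mult_left[OF finite_functional_contract_block])
  qed simp
  moreover have "ex (- s) (ysum []) = 1" using ex by (simp add: additive_exp_def)
  ultimately show ?case
    by (subst (1 2) subst_unfold)
      (auto simp: splits_shift distrib_left splits_mult_left[symmetric] intro!: splits_cong)
qed

section \<open>Composition of substitutions\<close>

lemma splits_single_edge:
  "splits r (\<lambda>m b. single_edge (\<lambda>x. g x b) m) = (case r of [] \<Rightarrow> 0 | x # b \<Rightarrow> g x b)"
proof (cases r)
  case (Cons x b)
  have "splits b (\<lambda>m b. single_edge (\<lambda>x. g x b) (x # m)) = splits b (\<lambda>m b. if m = [] then g x b else 0)"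
    by (intro splits_cong refl) (auto simp: single_edge_def split: list.splits)
  then show ?thesis by (simp add: Cons splits_Nil_left)
qed simp

text \<open>A marked letter of the contracted word stems from a block \<open>m\<close> of
  \<open>xs\<close>; the words \<open>p\<close> and \<open>q\<close> on its two sides are contracted
  separately. As \<open>g\<close> may couple the three parts, this rests on the bilinear form
  \<open>subst_splits\<close> and not on multiplicativity alone.\<close>

lemma subst_marks:
  "subst F G ex (\<lambda>w. marks w g) xs = splits xs (\<lambda>p r. splits r (\<lambda>m q.
     contract_block F G ex (\<lambda>x. subst F G ex (\<lambda>a. subst F G ex (\<lambda>a'. g a x a') q) p) m))"
proof -
  let ?K = "contract_block F G ex" and ?S = "subst F G ex"
  have single: "?S (\<lambda>a'. single_edge (\<lambda>x. g a x a') m) q = single_edge (\<lambda>x. ?S (g a x) q) m" for a m q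
    by (cases m rule: remdups_adj.cases) (simp_all add: subst_zero)
  have "?S (\<lambda>w. marks w g) xs = ?S (\<lambda>w. splits w (\<lambda>a r. splits r (\<lambda>m a'. single_edge (\<lambda>x. g a x a') m))) xs"
    by (simp add: marks_eq_splits splits_single_edge)
  also have "\<dots> = splits xs (\<lambda>p r. ?S (\<lambda>a. splits r (\<lambda>m q. ?K (\<lambda>x. ?S (g a x) q) m)) p)"
    by (simp add: subst_splits single subst_single_edge)
  also have "\<dots> = splits xs (\<lambda>p r. splits r (\<lambda>m q. ?K (\<lambda>x. ?S (\<lambda>a. ?S (g a x) q) p) m))"
    by (simp add: finite_functional_splits_commute[OF finite_functional_subst]
        finite_functional_contract_commute[OF finite_functional_subst])
  finally show ?thesis .
qed

lemma marks_splits_both: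
  "marks xs (\<lambda>A x B. splits A (\<lambda>p a. splits B (\<lambda>b q. h p a x b q)))
    = splits xs (\<lambda>p r. splits r (\<lambda>m q. marks m (\<lambda>a x b. h p a x b q)))"
  by (simp add: marks_splits_left marks_splits_right)

text \<open>A marked letter of the contracted word is a block \<open>m\<close> with its own marked
  letter \<open>x\<close>, so that \<open>xs\<close> becomes \<open>p @ a @ x # b @ q\<close> with
  \<open>m = a @ x # b\<close>. On the left of \<open>x\<close>, the values of the substituted
  \<open>G2\<close> at \<open>p\<close> and of \<open>G3\<close> at \<open>a\<close> make up one
  product of the composed data; on the right, \<open>F3\<close> at \<open>b\<close> and the
  substituted \<open>F2\<close> at \<open>q\<close> make up the other. The factors
  \<open>ex3\<close> for \<open>p\<close> and \<open>q\<close>, which come from the translation,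
  combine with the one for \<open>m\<close> to that for \<open>xs\<close>.\<close>

lemma subst_contract_block:
  assumes ex2: "additive_exp ex2" and ex3: "additive_exp ex3"
  shows "subst F3 G3 ex3 (contract_block F2 G2 ex2 c)
    = contract_block (conv F3 (subst F3 G3 ex3 F2)) (conv (subst F3 G3 ex3 G2) G3)
        (\<lambda>t y. ex3 t y * ex2 t y) c"
proof
  fix xs
  let ?S = "subst F3 G3 ex3" and ?K = "contract_block F3 G3 ex3"
  let ?g = "\<lambda>a x a'. c (fst x, ysum a + snd x + ysum a') * (ex2 (fst x) (ysum a + snd x + ysum a') *
    G2 (shift (fst x) a) * F2 (shift (fst x) a'))"
  \<comment> \<open>\<open>subst_shift\<close> solved for its other side: the factor
    \<open>ex3 (- t)\<close> reappears as its inverse \<open>ex3 t\<close>.\<close>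
  have shift: "?S (\<lambda>a. f (shift t a)) p = ex3 t (ysum p) * ?S f (shift t p)" for f t p
  proof -
    have "ex3 t (ysum p) * ex3 (- t) (ysum p) = 1"
      using ex3 unfolding additive_exp_def by (metis add.right_inverse)
    then show ?thesis by (simp add: subst_shift[OF ex3] flip: mult.assoc)
  qed
  have pair: "?S (\<lambda>a. ?S (\<lambda>a'. ?g a x a') q) p
    = c (fst x, ysum p + snd x + ysum q) * (ex2 (fst x) (ysum p + snd x + ysum q) *
      (ex3 (fst x) (ysum p) * ex3 (fst x) (ysum q)) * ?S G2 (shift (fst x) p) * ?S F2 (shift (fst x) q))"
    for x p q
  proof -
    \<comment> \<open>Contraction preserves \<open>ysum\<close>, so factors that depend on the
      contracted word only through its sum are constants.\<close>
    have "?S (\<lambda>a'. ?g a x a') q = ?S (\<lambda>a'. (c (fst x, ysum a + snd x + ysum q) *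
        (ex2 (fst x) (ysum a + snd x + ysum q) * G2 (shift (fst x) a))) * F2 (shift (fst x) a')) q" for a
      by (rule subst_cong) (simp add: contracts_ysum mult.assoc)
    then have "?S (\<lambda>a. ?S (\<lambda>a'. ?g a x a') q) p = ?S (\<lambda>a. (c (fst x, ysum a + snd x + ysum q) *
        (ex2 (fst x) (ysum a + snd x + ysum q) * G2 (shift (fst x) a))) * ?S (\<lambda>a'. F2 (shift (fst x) a')) q) p"
      by (simp add: subst_mult_left)
    also have "\<dots> = ?S (\<lambda>a. (c (fst x, ysum p + snd x + ysum q) *
        ex2 (fst x) (ysum p + snd x + ysum q) * ?S (\<lambda>a'. F2 (shift (fst x) a')) q) * G2 (shift (fst x) a)) p"
      by (rule subst_cong) (simp add: contracts_ysum mult_ac)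
    finally show ?thesis unfolding subst_mult_left shift by (simp add: mult_ac)
  qed
  have "?S (contract_block F2 G2 ex2 c) xs = ?S (\<lambda>w. marks w ?g) xs"
    by (rule subst_cong) (auto simp: contract_block_def add.assoc intro!: marks_cong)
  also have "\<dots> = splits xs (\<lambda>p r. splits r (\<lambda>m q. marks m (\<lambda>a x b.
      c (fst x, ysum xs) * (ex3 (fst x) (ysum xs) * ex2 (fst x) (ysum xs)) *
      (?S G2 (shift (fst x) p) * G3 (shift (fst x) a)) * (F3 (shift (fst x) b) * ?S F2 (shift (fst x) q)))))"
    unfolding subst_marks pair contract_block_def
  proof (intro splits_cong marks_cong refl)
    fix p r m q a x b
    assume "p @ r = xs" "m @ q = r" "a @ x # b = m"
    then have y: "ysum p + ysum m + ysum q = ysum xs" by (auto simp: add.assoc)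
    then have "ex3 t (ysum xs) = ex3 t (ysum p) * ex3 t (ysum m) * ex3 t (ysum q)" for t
      using ex3 by (metis additive_exp_def)
    then show "c (fst (fst x, ysum m), ysum p + snd (fst x, ysum m) + ysum q) *
      (ex2 (fst (fst x, ysum m)) (ysum p + snd (fst x, ysum m) + ysum q) *
       (ex3 (fst (fst x, ysum m)) (ysum p) * ex3 (fst (fst x, ysum m)) (ysum q)) *
       ?S G2 (shift (fst (fst x, ysum m)) p) * ?S F2 (shift (fst (fst x, ysum m)) q)) *
      (ex3 (fst x) (ysum m) * G3 (shift (fst x) a) * F3 (shift (fst x) b)) =
      c (fst x, ysum xs) * (ex3 (fst x) (ysum xs) * ex2 (fst x) (ysum xs)) *
      (?S G2 (shift (fst x) p) * G3 (shift (fst x) a)) * (F3 (shift (fst x) b) * ?S F2 (shift (fst x) q))"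
      by (simp add: y mult_ac)
  qed
  also have "\<dots> = contract_block (conv F3 (?S F2)) (conv (?S G2) G3) (\<lambda>t y. ex3 t y * ex2 t y) c xs"
    unfolding contract_block_def conv_shift marks_splits_both[symmetric] conv_def
      splits_mult_left splits_mult_right
    by (simp add: mult.assoc splits_shift)
  finally show "?S (contract_block F2 G2 ex2 c) xs
    = contract_block (conv F3 (?S F2)) (conv (?S G2) G3) (\<lambda>t y. ex3 t y * ex2 t y) c xs" .
qed

text \<open>Blocks of blocks are blocks of the original word; \<open>subst_contract_block\<close>
  treats the first of them and induction the remaining word.\<close>

lemma subst_subst:
  assumes ex2: "additive_exp ex2" and ex3: "additive_exp ex3"
  shows "subst F3 G3 ex3 (subst F2 G2 ex2 f)
    = subst (conv F3 (subst F3 G3 ex3 F2)) (conv (subst F3 G3 ex3 G2) G3) (\<lambda>t y. ex3 t y * ex2 t y) f"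
proof
  fix xs
  let ?S2 = "subst F2 G2 ex2" and ?K2 = "contract_block F2 G2 ex2" and ?S3 = "subst F3 G3 ex3"
  let ?S = "subst (conv F3 (?S3 F2)) (conv (?S3 G2) G3) (\<lambda>t y. ex3 t y * ex2 t y)"
    and ?K = "contract_block (conv F3 (?S3 F2)) (conv (?S3 G2) G3) (\<lambda>t y. ex3 t y * ex2 t y)"
  show "?S3 (?S2 f) xs = ?S f xs"
  proof (induction xs arbitrary: f rule: length_induct)
    case (1 xs)
    have "?S3 (?S2 f) xs = ?S3 (\<lambda>w. f [] * unit_word w) xs
        + ?S3 (\<lambda>w. splits w (\<lambda>b r. ?K2 (\<lambda>e. ?S2 (\<lambda>w. f (e # w)) r) b)) xs"
      unfolding subst_add[symmetric]
      by (rule subst_cong, subst subst_unfold) (simp add: unit_word_def)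
    also have "\<dots> = (if xs = [] then f [] else 0)
        + splits xs (\<lambda>b r. ?K (\<lambda>e. ?S3 (?S2 (\<lambda>w. f (e # w))) r) b)"
      unfolding subst_splits finite_functional_contract_commute[OF finite_functional_subst]
        subst_contract_block[OF ex2 ex3] subst_mult_left subst_unit
      by (simp add: unit_word_def)
    also have "splits xs (\<lambda>b r. ?K (\<lambda>e. ?S3 (?S2 (\<lambda>w. f (e # w))) r) b)
        = splits xs (\<lambda>b r. ?K (\<lambda>e. ?S (\<lambda>w. f (e # w)) r) b)"
    proof (rule splits_cong[OF refl])
      fix b r assume br: "b @ r = xs"
      show "?K (\<lambda>e. ?S3 (?S2 (\<lambda>w. f (e # w))) r) b = ?K (\<lambda>e. ?S (\<lambda>w. f (e # w)) r) b"
      proof (cases "b = []")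
        case False
        then show ?thesis using 1 br by auto
      qed simp
    qed
    also have "(if xs = [] then f [] else 0) + \<dots> = ?S f xs" by (rule subst_unfold[symmetric])
    finally show ?case .
  qed
qed

section \<open>The inversion relation\<close>

text \<open>The closure properties match the operations that occur in the relation: factors of a
  word, contractions, and the two sides of a marked edge after translation by its label.\<close>

locale admissible_words =
  fixes adm :: "'y::comm_monoid_add word \<Rightarrow> bool"
  assumes adm_append: "adm (a @ b) \<Longrightarrow> adm a \<and> adm b"
    and adm_contracts: "contracts w xs \<Longrightarrow> adm xs \<Longrightarrow> adm w"
    and adm_shift: "adm (a @ x # b) \<Longrightarrow> adm (shift (fst x) a) \<and> adm (shift (fst x) b)"
begin

text \<open>The right-hand side is \<open>S (1 - \<tau>)\<close> in the form given by
  \<open>subst_unit\<close> and \<open>subst_single_edge\<close>. It is demanded on admissible words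
  only: when \<tau> is the reciprocal of the label, the relation is meaningful for nonzero
  labels.\<close>

definition inversion_relation :: "(rat \<times> 'y \<Rightarrow> 'r::comm_ring_1) \<Rightarrow> ('y word \<Rightarrow> 'r) \<Rightarrow> ('y word \<Rightarrow> 'r)
    \<Rightarrow> (rat \<Rightarrow> 'y \<Rightarrow> 'r) \<Rightarrow> bool" where
  "inversion_relation \<tau> F G ex \<longleftrightarrow> F [] = 1 \<and> G [] = 1 \<and> additive_exp ex \<and> (\<forall>xs. adm xs \<longrightarrow>
     conv G (conv (\<lambda>w. unit_word w - single_edge \<tau> w) F) xs = unit_word xs - contract_block F G ex \<tau> xs)"

lemma conv_adm_cong:
  assumes "adm xs" "\<And>w. adm w \<Longrightarrow> f w = f' w" "\<And>w. adm w \<Longrightarrow> g w = g' w"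
  shows "conv f g xs = conv f' g' xs"
  unfolding conv_def
proof (rule splits_cong[OF refl])
  fix a b assume "a @ b = xs"
  then have "adm a" "adm b" using assms(1) adm_append[of a b] by auto
  then show "f a * g b = f' a * g' b" by (simp add: assms(2,3))
qed

lemma subst_adm_cong:
  assumes "adm xs" "\<And>w. adm w \<Longrightarrow> f w = f' w"
  shows "subst F G ex f xs = subst F G ex f' xs"
  by (rule subst_cong) (rule assms(2), rule adm_contracts[OF _ assms(1)])

lemma subst_adm_cong_data:
  assumes "adm xs" "\<And>w. adm w \<Longrightarrow> F w = F' w" "\<And>w. adm w \<Longrightarrow> G w = G' w" "\<And>t y. ex t y = ex' t y"
  shows "subst F G ex f xs = subst F' G' ex' f xs"
proof (rule subst_cong_data)
  fix p a x a' q assume "p @ a @ x # a' @ q = xs"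
  then have "adm (a @ x # a')"
    using assms(1) adm_append[of p "(a @ x # a') @ q"] adm_append[of "a @ x # a'" q] by auto
  then show "G (shift (fst x) a) = G' (shift (fst x) a) \<and> F (shift (fst x) a') = F' (shift (fst x) a')"
    using adm_shift assms by blast
qed (rule assms)

lemma inversion_relation_compose:
  assumes r2: "inversion_relation \<tau> F2 G2 ex2" and r3: "inversion_relation \<tau> F3 G3 ex3"
  shows "inversion_relation \<tau> (conv F3 (subst F3 G3 ex3 F2)) (conv (subst F3 G3 ex3 G2) G3)
    (\<lambda>t y. ex3 t y * ex2 t y)"
proof -
  let ?S = "subst F3 G3 ex3" and ?u = "\<lambda>w. unit_word w - single_edge \<tau> w"
  have ex: "additive_exp ex2" "additive_exp ex3" using r2 r3 by (auto simp: inversion_relation_def)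
  have u: "?S ?u = (\<lambda>w. unit_word w - contract_block F3 G3 ex3 \<tau> w)"
    by (rule ext) (simp add: subst_diff subst_unit subst_single_edge)
  have "conv (conv (?S G2) G3) (conv ?u (conv F3 (?S F2))) xs
    = unit_word xs - contract_block (conv F3 (?S F2)) (conv (?S G2) G3) (\<lambda>t y. ex3 t y * ex2 t y) \<tau> xs"
    if adm: "adm xs" for xs
  proof -
    have "conv (conv (?S G2) G3) (conv ?u (conv F3 (?S F2))) xs
      = conv (?S G2) (conv (conv G3 (conv ?u F3)) (?S F2)) xs"
      by (simp add: conv_assoc)
    also have "\<dots> = conv (?S G2) (conv (?S ?u) (?S F2)) xs"
      by (intro conv_adm_cong adm refl) (use r3 in \<open>simp_all add: u inversion_relation_def\<close>)
    also have "\<dots> = ?S (conv G2 (conv ?u F2)) xs"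
      by (simp add: subst_conv)
    also have "\<dots> = ?S (\<lambda>w. unit_word w - contract_block F2 G2 ex2 \<tau> w) xs"
      by (rule subst_adm_cong[OF adm]) (use r2 in \<open>simp add: inversion_relation_def\<close>)
    finally show ?thesis
      by (simp add: subst_diff subst_unit subst_contract_block[OF ex])
  qed
  moreover have "additive_exp (\<lambda>t y. ex3 t y * ex2 t y)"
    using ex by (simp add: additive_exp_def mult_ac)
  ultimately show ?thesis
    using r2 r3 by (simp add: inversion_relation_def conv_Nil)
qed

text \<open>Induction on the length: \<open>G xs\<close> occurs once, with factor 1, and all other
  values of \<open>G\<close> are at shorter words, namely proper prefixes of \<open>xs\<close> and
  translated left sides of marked edges.\<close>

lemma inversion_relation_unique:
  assumes r: "inversion_relation \<tau> F G ex" and r': "inversion_relation \<tau> F' G' ex'"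
    and F: "\<And>w. adm w \<Longrightarrow> F w = F' w" and ex: "\<And>t y. ex t y = ex' t y" and "adm xs"
  shows "G xs = G' xs"
  using \<open>adm xs\<close>
proof (induction xs rule: length_induct)
  case (1 xs)
  let ?B = "conv (\<lambda>w. unit_word w - single_edge \<tau> w) F"
    and ?B' = "conv (\<lambda>w. unit_word w - single_edge \<tau> w) F'"
  have B: "?B w = ?B' w" if "adm w" for w by (rule conv_adm_cong[OF that]) (simp_all add: F)
  have Nil: "?B [] = 1" "?B' [] = 1" using r r' by (simp_all add: inversion_relation_def conv_Nil unit_word_def)
  have "splits xs (\<lambda>a b. if b = [] then 0 else G a * ?B b)
      = splits xs (\<lambda>a b. if b = [] then 0 else G' a * ?B' b)"
  proof (rule splits_cong[OF refl])
    fix a b assume ab: "a @ b = xs"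
    then have "adm a" "adm b" using 1(2) adm_append[of a b] by auto
    then show "(if b = [] then 0 else G a * ?B b) = (if b = [] then 0 else G' a * ?B' b)"
      using 1(1)[rule_format, of a] B[of b] ab by auto
  qed
  moreover have "contract_block F G ex \<tau> xs = contract_block F' G' ex' \<tau> xs"
  proof (rule contract_block_cong, intro conjI refl ex)
    fix a x a' assume "a @ x # a' = xs"
    with 1(2) have "adm (shift (fst x) a)" "adm (shift (fst x) a')" "length a < length xs"
      using adm_shift[of a x a'] by auto
    then show "G (shift (fst x) a) = G' (shift (fst x) a)" "F (shift (fst x) a') = F' (shift (fst x) a')"
      using 1(1) F by auto
  qed
  moreover have "conv G ?B xs = unit_word xs - contract_block F G ex \<tau> xs"
    "conv G' ?B' xs = unit_word xs - contract_block F' G' ex' \<tau> xs"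
    using r r' 1(2) by (simp_all add: inversion_relation_def)
  ultimately have "G xs + splits xs (\<lambda>a b. if b = [] then 0 else G' a * ?B' b)
      = G' xs + splits xs (\<lambda>a b. if b = [] then 0 else G' a * ?B' b)"
    unfolding conv_split_last[of _ _ xs] Nil by (simp only: mult_1_right)
  then show ?case by (rule add_right_imp_eq)
qed

end

section \<open>Scalars, algebra maps and their action on power series\<close>

definition scalar :: "rat \<Rightarrow> 'm::comm_monoid_add \<Rightarrow>\<^sub>0 rat" where
  "scalar q = single 0 q"

lemma smult_scalar: "smult c a = scalar c * a"
  by (simp add: smult_def scalar_def)

lemma lookup_mult_scalar: "lookup (a * scalar q) m = q * lookup a m"
  by (simp add: lookup_smult mult.commute[of a] flip: smult_scalar)

lemma scalar_simps: "scalar 0 = 0" "scalar 1 = 1" "scalar (a + b) = scalar a + scalar b"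
  "scalar (a * b) = scalar a * scalar b" "scalar (- a) = - scalar a" "scalar (a - b) = scalar a - scalar b"
  by (simp_all add: scalar_def single_add mult_single single_diff single_uminus)

lemma scalar_power: "scalar (a ^ n) = scalar a ^ n"
  by (induction n) (simp_all add: scalar_simps)

lemma scalar_prod: "scalar (prod f A) = (\<Prod>x\<in>A. scalar (f x))"
  by (induction A rule: infinite_finite_induct) (simp_all add: scalar_simps)

lemma scalar_of_nat: "scalar (of_nat n) = of_nat n"
  by (induction n) (simp_all add: scalar_simps)

lemma scalar_minus_one_power: "(- 1) ^ n = scalar ((- 1) ^ n)"
  by (simp add: scalar_power scalar_simps)

definition algebra_map :: "(('m::comm_monoid_add \<Rightarrow>\<^sub>0 rat) \<Rightarrow> 'n::comm_monoid_add \<Rightarrow>\<^sub>0 rat) \<Rightarrow> bool" where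
  "algebra_map h \<longleftrightarrow> linear_map h \<and> h 1 = 1 \<and> (\<forall>a b. h (a * b) = h a * h b)"

lemma linear_map_add: "linear_map h \<Longrightarrow> h (a + b) = h a + h b"
  and linear_map_diff: "linear_map h \<Longrightarrow> h (a - b) = h a - h b"
  and linear_map_scale: "linear_map h \<Longrightarrow> h (smult c a) = smult c (h a)"
  and linear_map_zero: "linear_map h \<Longrightarrow> h 0 = 0"
  and linear_map_uminus: "linear_map h \<Longrightarrow> h (- a) = - h a"
  and linear_map_sum: "linear_map h \<Longrightarrow> h (sum f A) = (\<Sum>x\<in>A. h (f x))"
  using module_hom.add module_hom.diff module_hom.scale module_hom.zero module_hom.neg module_hom.sum
    Vector_Spaces.linear.axioms(3) by metis+

lemma linear_mapI:
  assumes "\<And>a b. h (a + b) = h a + h b" "\<And>c a. h (smult c a) = smult c (h a)"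
  shows "linear_map h"
  by unfold_locales (simp_all add: assms)

lemma algebra_map_simps:
  assumes "algebra_map h"
  shows "h (a + b) = h a + h b" "h (a - b) = h a - h b" "h (smult c a) = smult c (h a)" "h 0 = 0"
    "h (- a) = - h a" "h (sum f A) = (\<Sum>x\<in>A. h (f x))" "h 1 = 1" "h (a * b) = h a * h b"
    "h (scalar q) = scalar q"
proof -
  have l: "linear_map h" and one: "h 1 = 1" using assms by (simp_all add: algebra_map_def)
  show "h (a + b) = h a + h b" "h (a - b) = h a - h b" "h (smult c a) = smult c (h a)" "h 0 = 0"
    "h (- a) = - h a" "h (sum f A) = (\<Sum>x\<in>A. h (f x))" "h 1 = 1" "h (a * b) = h a * h b"
    using assms linear_map_add[OF l] linear_map_diff[OF l] linear_map_scale[OF l] linear_map_zero[OF l]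
      linear_map_uminus[OF l] linear_map_sum[OF l] by (simp_all add: algebra_map_def)
  show "h (scalar q) = scalar q"
    using linear_map_scale[OF l, of q 1] one by (simp add: smult_scalar)
qed

lemma algebra_map_power: "algebra_map h \<Longrightarrow> h (a ^ n) = h a ^ n"
  by (induction n) (simp_all add: algebra_map_simps)

lemma algebra_map_prod: "algebra_map h \<Longrightarrow> h (prod f A) = (\<Prod>x\<in>A. h (f x))"
  by (induction A rule: infinite_finite_induct) (simp_all add: algebra_map_simps)

lemma algebra_map_compose: "algebra_map g \<Longrightarrow> algebra_map h \<Longrightarrow> algebra_map (\<lambda>a. g (h a))"
  unfolding algebra_map_def
  by (auto intro!: linear_mapI simp: linear_map_add linear_map_scale)

lemma algebra_map_alg_hom: "algebra_map (alg_hom f)"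
  by (simp add: algebra_map_def linear_alg_hom alg_hom_one alg_hom_mult)

lemma algebra_map_id: "algebra_map (\<lambda>a. a)"
  by (auto simp: algebra_map_def intro!: linear_mapI)

definition map_fps :: "('a \<Rightarrow> 'b) \<Rightarrow> 'a fps \<Rightarrow> 'b fps" where
  "map_fps h F = Abs_fps (\<lambda>k. h (fps_nth F k))"

lemma map_fps_nth [simp]: "fps_nth (map_fps h F) k = h (fps_nth F k)"
  by (simp add: map_fps_def)

lemma map_fps_map_fps: "map_fps g (map_fps h F) = map_fps (\<lambda>a. g (h a)) F"
  by (simp add: map_fps_def)

lemma map_fps_simps:
  assumes "algebra_map h"
  shows "map_fps h 0 = 0" "map_fps h 1 = 1" "map_fps h (F + G) = map_fps h F + map_fps h G"
    "map_fps h (F - G) = map_fps h F - map_fps h G" "map_fps h (- F) = - map_fps h F"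
    "map_fps h (fps_const (scalar q)) = fps_const (scalar q)"
    "map_fps h fps_X = fps_X"
  using algebra_map_simps[OF assms] by (simp_all add: fps_eq_iff)

lemma map_fps_mult: "algebra_map h \<Longrightarrow> map_fps h (F * G) = map_fps h F * map_fps h G"
  by (simp add: fps_eq_iff fps_mult_nth algebra_map_simps(6,8))

lemma map_fps_sum: "algebra_map h \<Longrightarrow> map_fps h (sum f A) = (\<Sum>x\<in>A. map_fps h (f x))"
  by (induction A rule: infinite_finite_induct) (simp_all add: map_fps_simps map_fps_mult)

lemma map_fps_prod: "algebra_map h \<Longrightarrow> map_fps h (prod f A) = (\<Prod>x\<in>A. map_fps h (f x))"
  by (induction A rule: infinite_finite_induct) (simp_all add: map_fps_simps map_fps_mult)

lemma map_fps_power: "algebra_map h \<Longrightarrow> map_fps h (F ^ n) = map_fps h F ^ n"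
  by (induction n) (simp_all add: map_fps_simps map_fps_mult)

text \<open>This is \<open>exp (a X)\<close> with \<open>X\<close> the variable of the power series.
  As \<open>[y]_0\<close> has weight 1, the degree in \<open>X\<close> is again the weight.\<close>

definition exps :: "('m::comm_monoid_add \<Rightarrow>\<^sub>0 rat) \<Rightarrow> ('m \<Rightarrow>\<^sub>0 rat) fps" where
  "exps a = Abs_fps (\<lambda>k. smult (1 / fact k) (a ^ k))"

lemma exps_zero: "exps 0 = 1"
  by (auto simp: exps_def fps_eq_iff power_0_left smult_scalar scalar_simps)

lemma exps_add: "exps (a + b) = exps a * exps b"
proof (rule fps_ext)
  fix n
  have "smult (1 / fact i) (a ^ i) * smult (1 / fact (n - i)) (b ^ (n - i))
    = smult (1 / fact n) (of_nat (n choose i) * a ^ i * b ^ (n - i))" if "i \<le> n" for i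
  proof -
    have "(1 / fact i * (1 / fact (n - i)) :: rat) = 1 / fact n * of_nat (n choose i)"
      using that by (simp add: binomial_fact)
    then have "scalar (1 / fact i) * scalar (1 / fact (n - i)) = (scalar (1 / fact n) * of_nat (n choose i) :: 'a \<Rightarrow>\<^sub>0 rat)"
      by (metis scalar_of_nat scalar_simps(4))
    moreover have "smult (1 / fact i) (a ^ i) * smult (1 / fact (n - i)) (b ^ (n - i))
      = (scalar (1 / fact i) * scalar (1 / fact (n - i))) * (a ^ i * b ^ (n - i))"
      by (simp only: smult_scalar mult_ac)
    ultimately show ?thesis by (simp only: smult_scalar mult.assoc)
  qed
  then show "fps_nth (exps (a + b)) n = fps_nth (exps a * exps b) n"
    by (simp add: exps_def fps_mult_nth binomial_ring pm.scale_sum_right atMost_atLeast0)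
qed

lemma map_fps_exps: "algebra_map h \<Longrightarrow> map_fps h (exps a) = exps (h a)"
  by (simp add: exps_def map_fps_def algebra_map_simps algebra_map_power)

section \<open>Evaluation of generating series at rational points\<close>

definition monom_value :: "(nat \<Rightarrow> rat) \<Rightarrow> (nat \<Rightarrow>\<^sub>0 nat) \<Rightarrow> rat" where
  "monom_value v e = (\<Prod>i\<in>keys e. v i ^ lookup e i)"

definition poly_value :: "(nat \<Rightarrow> rat) \<Rightarrow> ('m::comm_monoid_add \<Rightarrow>\<^sub>0 rat) tpoly \<Rightarrow> 'm \<Rightarrow>\<^sub>0 rat" where
  "poly_value v p = (\<Sum>e\<in>keys p. lookup p e * scalar (monom_value v e))"

text \<open>Only the \<open>t_i\<close> are specialised; the variable that records the degree
  remains, so no convergence is involved.\<close>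

definition series_value :: "(nat \<Rightarrow> rat) \<Rightarrow> ('m::comm_monoid_add \<Rightarrow>\<^sub>0 rat) series \<Rightarrow> ('m \<Rightarrow>\<^sub>0 rat) fps" where
  "series_value v F = map_fps (poly_value v) F"

lemma monom_value_superset:
  "finite A \<Longrightarrow> keys e \<subseteq> A \<Longrightarrow> monom_value v e = (\<Prod>i\<in>A. v i ^ lookup e i)"
  unfolding monom_value_def by (rule prod.mono_neutral_left) (auto simp: in_keys_iff)

lemma monom_value_add: "monom_value v (e + e') = monom_value v e * monom_value v e'"
  using keys_add[of e e']
  by (simp add: monom_value_superset[of "keys e \<union> keys e'"] lookup_add power_add prod.distrib)

lemma poly_value_superset:
  "finite A \<Longrightarrow> keys p \<subseteq> A \<Longrightarrow> poly_value v p = (\<Sum>e\<in>A. lookup p e * scalar (monom_value v e))"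
  unfolding poly_value_def by (rule sum.mono_neutral_left) (auto simp: in_keys_iff)

lemma poly_value_zero [simp]: "poly_value v 0 = 0"
  by (simp add: poly_value_def)

lemma poly_value_add: "poly_value v (p + q) = poly_value v p + poly_value v q"
  using keys_add[of p q]
  by (simp add: poly_value_superset[of "keys p \<union> keys q"] lookup_add distrib_right sum.distrib)

lemma poly_value_single: "poly_value v (single e a) = a * scalar (monom_value v e)"
  by (subst poly_value_superset[of "{e}"]) auto

lemma poly_value_sum: "poly_value v (sum f A) = (\<Sum>x\<in>A. poly_value v (f x))"
  by (induction A rule: infinite_finite_induct) (simp_all add: poly_value_add)

lemma poly_value_one [simp]: "poly_value v 1 = 1"
  using poly_value_single[of v 0 1] by (simp add: monom_value_def scalar_simps)

lemma poly_mapping_sum_single: "p = (\<Sum>e\<in>keys p. single e (lookup p e))"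
  by (rule poly_mapping_eqI) (simp add: lookup_sum lookup_single when_def in_keys_iff sum.delta)

lemma poly_value_mult: "poly_value v (p * q) = poly_value v p * poly_value v q"
proof -
  have 1: "poly_value v (single e a * single e' b) = poly_value v (single e a) * poly_value v (single e' b)"
    for e e' and a b :: "'a \<Rightarrow>\<^sub>0 rat"
    by (simp add: mult_single poly_value_single monom_value_add scalar_simps mult_ac)
  have 2: "poly_value v (single e a * q) = poly_value v (single e a) * poly_value v q" for e a
    by (subst (1 2) poly_mapping_sum_single[of q]) (simp only: sum_distrib_left poly_value_sum 1)
  show ?thesis
    by (subst (1 2) poly_mapping_sum_single[of p]) (simp only: sum_distrib_right poly_value_sum 2)
qed

lemma poly_value_uminus: "poly_value v (- p) = - poly_value v p"
  using poly_value_add[of v p "- p"] by (simp add: eq_neg_iff_add_eq_0 add.commute)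

lemma poly_value_diff: "poly_value v (p - q) = poly_value v p - poly_value v q"
  using poly_value_add[of v p "- q"] by (simp add: poly_value_uminus)

lemma poly_value_power: "poly_value v (p ^ n) = poly_value v p ^ n"
  by (induction n) (simp_all add: poly_value_mult)

lemma poly_value_prod: "poly_value v (prod f A) = (\<Prod>x\<in>A. poly_value v (f x))"
  by (induction A rule: infinite_finite_induct) (simp_all add: poly_value_mult)

lemma poly_value_tvar: "poly_value v (tvar r) = scalar (v r)"
  by (simp add: tvar_def poly_value_single monom_value_def)

lemma series_value_simps:
  "series_value v 0 = 0" "series_value v 1 = 1" "series_value v (F + G) = series_value v F + series_value v G"
  "series_value v (F * G) = series_value v F * series_value v G" "series_value v (- F) = - series_value v F"
  unfolding series_value_def
  by (simp_all add: fps_eq_iff fps_mult_nth poly_value_add poly_value_sum poly_value_mult poly_value_uminus)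

lemma series_value_sum: "series_value v (sum f A) = (\<Sum>x\<in>A. series_value v (f x))"
  by (induction A rule: infinite_finite_induct) (simp_all add: series_value_simps)

lemma series_value_prod: "series_value v (prod f A) = (\<Prod>x\<in>A. series_value v (f x))"
  by (induction A rule: infinite_finite_induct) (simp_all add: series_value_simps)

lemma series_value_minus_one_power: "series_value v ((- 1) ^ n) = (- 1) ^ n"
  by (induction n) (simp_all add: series_value_simps)

text \<open>Unlike in \<open>gen_series\<close>, the term of index \<open>n\<^sub>1, \<dots>, n\<^sub>d\<close> is put in degree \<open>n\<^sub>1 + \<dots> + n\<^sub>d\<close>, its weight.\<close>

definition gen_value :: "(nat list \<Rightarrow> 'm::comm_monoid_add \<Rightarrow>\<^sub>0 rat) \<Rightarrow> rat list \<Rightarrow> ('m \<Rightarrow>\<^sub>0 rat) fps" where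
  "gen_value c qs = Abs_fps (\<lambda>k.
     \<Sum>ns | length ns = length qs \<and> (\<forall>n\<in>set ns. 1 \<le> n) \<and> sum_list ns = k.
       c ns * scalar (\<Prod>r<length qs. (qs ! r) ^ (ns ! r - 1)))"

lemma sum_list_ge_length: "(\<forall>n\<in>set ns. 1 \<le> n) \<Longrightarrow> length ns \<le> sum_list (ns :: nat list)"
  by (induction ns) auto

lemma gen_value_nth_small: "k < length qs \<Longrightarrow> fps_nth (gen_value c qs) k = 0"
proof -
  assume "k < length qs"
  then have "{ns. length ns = length qs \<and> (\<forall>n\<in>set ns. 1 \<le> n) \<and> sum_list ns = k} = {}"
    using sum_list_ge_length by fastforce
  then show ?thesis unfolding gen_value_def fps_nth_Abs_fps by (simp only: sum.empty)
qed

text \<open>The power of \<open>fps_X\<close> makes up for the difference between the degree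
  \<open>n_1 + ... + n_d - d\<close> of a term in the linear forms and its weight.\<close>

lemma series_value_gen_series:
  assumes "length qs = length ls" "\<And>r. r < length ls \<Longrightarrow> poly_value v (ls ! r) = scalar (qs ! r)"
  shows "fps_X ^ length ls * series_value v (gen_series c ls) = gen_value c qs"
proof (rule fps_ext)
  fix n
  show "fps_nth (fps_X ^ length ls * series_value v (gen_series c ls)) n = fps_nth (gen_value c qs) n"
  proof (cases "n < length ls")
    case True
    then show ?thesis by (simp add: gen_value_nth_small assms fps_X_power_mult_nth)
  next
    case False
    have "poly_value v (\<Prod>r<length ls. ls ! r ^ (ns ! r - 1)) = scalar (\<Prod>r<length ls. (qs ! r) ^ (ns ! r - 1))" for ns
      by (simp add: poly_value_prod poly_value_power scalar_prod scalar_power assms)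
    with False show ?thesis
      by (simp add: fps_X_power_mult_nth series_value_def gen_series_def gen_value_def assms(1)
          poly_value_sum poly_value_mult poly_value_single monom_value_def scalar_simps)
  qed
qed

lemma series_value_exp_series:
  assumes "poly_value v l = scalar q"
  shows "series_value v (exp_series c l) = exps (smult q c)"
  by (simp add: fps_eq_iff series_value_def exp_series_def exps_def poly_value_mult poly_value_power
      poly_value_single assms monom_value_def smult_scalar scalar_simps power_mult_distrib mult_ac)

lemma map_fps_gen_value: "algebra_map h \<Longrightarrow> map_fps h (gen_value c qs) = gen_value (\<lambda>ns. h (c ns)) qs"
  by (simp add: fps_eq_iff gen_value_def algebra_map_simps)

lemma gen_value_diff: "gen_value (\<lambda>ns. c ns - c' ns) qs = gen_value c qs - gen_value c' qs"
  by (simp add: fps_eq_iff gen_value_def left_diff_distrib sum_subtractf)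

lemma gen_value_add: "gen_value (\<lambda>ns. c ns + c' ns) qs = gen_value c qs + gen_value c' qs"
  by (simp add: fps_eq_iff gen_value_def distrib_right sum.distrib)

lemma gen_value_cong:
  assumes "\<And>ns. length ns = length qs \<Longrightarrow> \<forall>n\<in>set ns. 1 \<le> n \<Longrightarrow> c ns = c' ns"
  shows "gen_value c qs = gen_value c' qs"
  unfolding gen_value_def by (rule arg_cong[where f = Abs_fps], rule ext, rule sum.cong) (auto simp: assms)

lemma gen_value_Nil: "gen_value c [] = fps_const (c [])"
proof (rule fps_ext)
  fix n :: nat
  have "{ns. length ns = length ([] :: rat list) \<and> (\<forall>n\<in>set ns. 1 \<le> n) \<and> sum_list ns = n} = (if n = 0 then {[]} else {})"
    by auto
  then show "fps_nth (gen_value c []) n = fps_nth (fps_const (c [])) n"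
    unfolding gen_value_def fps_nth_Abs_fps by (simp only:) (simp add: scalar_simps)
qed

section \<open>Homogeneous series\<close>

definition mdegree :: "(nat \<Rightarrow>\<^sub>0 nat) \<Rightarrow> nat" where
  "mdegree e = (\<Sum>r\<in>keys e. lookup e r)"

lemma mdegree_superset: "finite A \<Longrightarrow> keys e \<subseteq> A \<Longrightarrow> mdegree e = (\<Sum>r\<in>A. lookup e r)"
  unfolding mdegree_def by (rule sum.mono_neutral_left) (auto simp: in_keys_iff)

lemma mdegree_add: "mdegree (e + e') = mdegree e + mdegree e'"
  using keys_add[of e e']
  by (simp add: mdegree_superset[of "keys e \<union> keys e'"] lookup_add sum.distrib)

definition homogeneous :: "nat set \<Rightarrow> nat \<Rightarrow> 'a::comm_ring_1 tpoly \<Rightarrow> bool" where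
  "homogeneous V k p \<longleftrightarrow> (\<forall>e\<in>keys p. keys e \<subseteq> V \<and> mdegree e = k)"

text \<open>The type \<open>series\<close> admits any sequence of polynomials, while
  \<open>tcoeff\<close> looks for a monomial only in the component of its own degree. Homogeneity
  ensures that the coefficients found in this way make up the whole series. \<open>V\<close> bounds
  the variables that occur.\<close>

definition homogeneous_series :: "nat set \<Rightarrow> 'a::comm_ring_1 series \<Rightarrow> bool" where
  "homogeneous_series V F \<longleftrightarrow> (\<forall>k. homogeneous V k (fps_nth F k))"

lemma homogeneous_zero: "homogeneous V k 0"
  by (simp add: homogeneous_def)

lemma homogeneous_add: "homogeneous V k p \<Longrightarrow> homogeneous V k q \<Longrightarrow> homogeneous V k (p + q)"
  using keys_add[of p q] by (auto simp: homogeneous_def)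

lemma homogeneous_uminus: "homogeneous V k p \<Longrightarrow> homogeneous V k (- p)"
  by (simp add: homogeneous_def)

lemma homogeneous_diff: "homogeneous V k p \<Longrightarrow> homogeneous V k q \<Longrightarrow> homogeneous V k (p - q)"
  using homogeneous_add[of V k p "- q"] homogeneous_uminus[of V k q] by simp

lemma homogeneous_sum: "(\<And>x. x \<in> A \<Longrightarrow> homogeneous V k (f x)) \<Longrightarrow> homogeneous V k (sum f A)"
  by (induction A rule: infinite_finite_induct) (auto simp: homogeneous_zero homogeneous_add)

lemma homogeneous_mult:
  assumes "homogeneous V k p" "homogeneous V l q"
  shows "homogeneous V (k + l) (p * q)"
  unfolding homogeneous_def
proof
  fix e assume "e \<in> keys (p * q)"
  then obtain a b where e: "e = a + b" "a \<in> keys p" "b \<in> keys q"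
    using keys_mult[of p q] by blast
  then have "keys a \<subseteq> V" "keys b \<subseteq> V" "mdegree a = k" "mdegree b = l"
    using assms by (auto simp: homogeneous_def)
  then show "keys e \<subseteq> V \<and> mdegree e = k + l"
    using keys_add[of a b] by (simp add: e(1) mdegree_add) blast
qed

lemma homogeneous_const: "homogeneous V 0 (single 0 c)"
  by (simp add: homogeneous_def mdegree_def)

lemma homogeneous_one: "homogeneous V 0 1"
  using homogeneous_const[of V 1] by simp

lemma homogeneous_power: "homogeneous V k p \<Longrightarrow> homogeneous V (k * n) (p ^ n)"
  by (induction n) (use homogeneous_mult in \<open>auto simp: homogeneous_one\<close>)

lemma homogeneous_prod:
  "(\<And>x. x \<in> A \<Longrightarrow> homogeneous V (d x) (f x)) \<Longrightarrow> homogeneous V (sum d A) (prod f A)"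
  by (induction A rule: infinite_finite_induct) (auto simp: homogeneous_one intro: homogeneous_mult)

lemma homogeneous_tvar: "r \<in> V \<Longrightarrow> homogeneous V 1 (tvar r)"
  by (simp add: homogeneous_def tvar_def mdegree_def)

lemma homogeneous_series_add:
  "homogeneous_series V F \<Longrightarrow> homogeneous_series V G \<Longrightarrow> homogeneous_series V (F + G)"
  by (simp add: homogeneous_series_def homogeneous_add)

lemma homogeneous_series_zero: "homogeneous_series V 0"
  by (simp add: homogeneous_series_def homogeneous_zero)

lemma homogeneous_series_one: "homogeneous_series V 1"
  by (simp add: homogeneous_series_def homogeneous_zero homogeneous_one)

lemma homogeneous_series_uminus: "homogeneous_series V F \<Longrightarrow> homogeneous_series V (- F)"
  by (simp add: homogeneous_series_def homogeneous_uminus)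

lemma homogeneous_series_mult:
  assumes "homogeneous_series V F" "homogeneous_series V G"
  shows "homogeneous_series V (F * G)"
  unfolding homogeneous_series_def fps_mult_nth
proof (intro allI homogeneous_sum)
  fix k i :: nat assume "i \<in> {0..k}"
  then show "homogeneous V k (fps_nth F i * fps_nth G (k - i))"
    using homogeneous_mult[of V i "fps_nth F i" "k - i" "fps_nth G (k - i)"] assms
    by (auto simp: homogeneous_series_def)
qed

lemma homogeneous_series_sum:
  "(\<And>x. x \<in> A \<Longrightarrow> homogeneous_series V (f x)) \<Longrightarrow> homogeneous_series V (sum f A)"
  by (induction A rule: infinite_finite_induct) (auto simp: homogeneous_series_zero homogeneous_series_add)

lemma homogeneous_series_prod:
  "(\<And>x. x \<in> A \<Longrightarrow> homogeneous_series V (f x)) \<Longrightarrow> homogeneous_series V (prod f A)"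
  by (induction A rule: infinite_finite_induct) (auto simp: homogeneous_series_one homogeneous_series_mult)

lemma homogeneous_series_minus_one_power: "homogeneous_series V ((- 1) ^ n)"
  by (induction n) (auto simp: homogeneous_series_one homogeneous_series_uminus)

lemma homogeneous_series_gen_series:
  assumes "\<And>l. l \<in> set ls \<Longrightarrow> homogeneous V 1 l"
  shows "homogeneous_series V (gen_series c ls)"
  unfolding homogeneous_series_def gen_series_def fps_nth_Abs_fps
proof (intro allI homogeneous_sum)
  fix k ns assume "ns \<in> {ns. length ns = length ls \<and> (\<forall>n\<in>set ns. 1 \<le> n) \<and> sum_list ns = k + length ls}"
  then have ns: "length ns = length ls" "\<forall>n\<in>set ns. 1 \<le> n" "sum_list ns = k + length ls" by auto
  \<comment> \<open>All entries are at least 1, so the subtraction is not truncated.\<close>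
  have "(\<Sum>r<length ls. ns ! r - 1) + length ls = (\<Sum>r<length ls. ns ! r)"
  proof -
    have "(\<Sum>r<length ls. (ns ! r - 1) + 1) = (\<Sum>r<length ls. ns ! r)"
      by (rule sum.cong) (use ns in \<open>simp_all add: Suc_le_eq\<close>)
    then show ?thesis by (simp only: sum.distrib) simp
  qed
  also have "\<dots> = k + length ls" using ns by (simp add: sum_list_sum_nth lessThan_atLeast0)
  finally have k: "k = 0 + (\<Sum>r<length ls. 1 * (ns ! r - 1))" by simp
  show "homogeneous V k (single 0 (c ns) * (\<Prod>r<length ls. (ls ! r) ^ (ns ! r - 1)))"
    unfolding k
    by (intro homogeneous_mult homogeneous_const homogeneous_prod homogeneous_power) (use assms in simp)
qed

lemma homogeneous_series_exp_series:
  assumes "homogeneous V 1 l"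
  shows "homogeneous_series V (exp_series c l)"
  unfolding homogeneous_series_def exp_series_def fps_nth_Abs_fps
  using homogeneous_mult[OF homogeneous_const homogeneous_power[OF assms]] by fastforce

lemma lookup_texponent:
  "lookup (texponent ns) i = (if 1 \<le> i \<and> i \<le> length ns then ns ! (i - 1) - 1 else 0)"
proof -
  have "lookup (texponent ns) i = (\<Sum>r<length ns. if r = i - 1 \<and> 1 \<le> i then ns ! r - 1 else 0)"
    unfolding texponent_def lookup_sum lookup_single when_def by (rule sum.cong) auto
  also have "\<dots> = (if 1 \<le> i \<and> i \<le> length ns then ns ! (i - 1) - 1 else 0)"
    by (auto simp: sum.delta' if_distrib if_bool_eq_conj cong: if_cong)
  finally show ?thesis .
qed

lemma keys_texponent: "keys (texponent ns) \<subseteq> {1..length ns}"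
  by (auto simp: in_keys_iff lookup_texponent split: if_splits)

lemma mdegree_texponent:
  assumes "\<forall>n\<in>set ns. 1 \<le> n"
  shows "mdegree (texponent ns) + length ns = sum_list ns"
proof -
  have "mdegree (texponent ns) = (\<Sum>i=1..length ns. ns ! (i - 1) - 1)"
    by (subst mdegree_superset[OF _ keys_texponent]) (auto simp: lookup_texponent)
  also have "\<dots> = (\<Sum>r<length ns. ns ! r - 1)"
    by (rule sum.reindex_bij_witness[of _ Suc "\<lambda>i. i - 1"]) auto
  finally have "mdegree (texponent ns) + length ns = (\<Sum>r<length ns. (ns ! r - 1) + 1)"
    by (simp only: sum.distrib) simp
  also have "\<dots> = (\<Sum>r<length ns. ns ! r)" by (rule sum.cong) (use assms in \<open>simp_all add: Suc_le_eq\<close>)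
  finally show ?thesis by (simp add: sum_list_sum_nth lessThan_atLeast0)
qed

lemma tcoeff_mdegree: "tcoeff e F = lookup (fps_nth F (mdegree e)) e"
  by (simp add: tcoeff_def mdegree_def)

text \<open>Passes from the coefficient extractions in the definitions to values at points:
  monomials of degree \<open>n - d\<close> in \<open>t_1, ..., t_d\<close> correspond by
  \<open>texponent\<close> to indices of weight \<open>n\<close>.\<close>

lemma homogeneous_series_value:
  assumes "homogeneous_series {1..d} F"
  shows "fps_X ^ d * series_value v F = gen_value (\<lambda>ns. tcoeff (texponent ns) F) (map v [1..<d + 1])"
proof (rule fps_ext)
  fix n
  show "fps_nth (fps_X ^ d * series_value v F) n
    = fps_nth (gen_value (\<lambda>ns. tcoeff (texponent ns) F) (map v [1..<d + 1])) n"
  proof (cases "n < d")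
    case True
    then show ?thesis by (simp add: gen_value_nth_small fps_X_power_mult_nth)
  next
    case False
    let ?I = "{ns. length ns = d \<and> (\<forall>n\<in>set ns. 1 \<le> n) \<and> sum_list ns = n}"
    have inj: "inj_on texponent ?I"
    proof
      fix ns ns' assume ns: "ns \<in> ?I" "ns' \<in> ?I" and eq: "texponent ns = texponent ns'"
      show "ns = ns'"
      proof (rule nth_equalityI)
        fix i assume i: "i < length ns"
        then have "ns ! i - 1 = ns' ! i - 1"
          using arg_cong[OF eq, of "\<lambda>e. lookup e (i + 1)"] ns by (simp add: lookup_texponent)
        moreover have "1 \<le> ns ! i" "1 \<le> ns' ! i" using i ns by auto
        ultimately show "ns ! i = ns' ! i" by simp
      qed (use ns in auto)
    qed
    have keys: "keys (fps_nth F (n - d)) \<subseteq> texponent ` ?I"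
    proof
      fix e assume e: "e \<in> keys (fps_nth F (n - d))"
      \<comment> \<open>The entries of an index exceed the exponents of its monomial by one.\<close>
      let ?ns = "map (\<lambda>r. lookup e (r + 1) + 1) [0..<d]"
      have V: "keys e \<subseteq> {1..d}" and deg: "mdegree e = n - d"
        using assms e by (auto simp: homogeneous_series_def homogeneous_def)
      have *: "e = texponent ?ns"
      proof (rule poly_mapping_eqI)
        fix i show "lookup e i = lookup (texponent ?ns) i"
          using V by (cases "i \<in> keys e") (auto simp: lookup_texponent in_keys_iff Suc_le_eq dest!: subsetD[of _ _ i])
      qed
      moreover have "sum_list ?ns = n"
        using mdegree_texponent[of ?ns] deg False arg_cong[OF *, of mdegree] by simp
      ultimately show "e \<in> texponent ` ?I" by (intro image_eqI[of _ _ ?ns]) auto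
    qed
    have val: "monom_value v (texponent ns) = (\<Prod>r<d. v (r + 1) ^ (ns ! r - 1))" if "ns \<in> ?I" for ns
    proof -
      have "monom_value v (texponent ns) = (\<Prod>i=1..d. v i ^ (ns ! (i - 1) - 1))"
        using keys_texponent[of ns] that
        by (subst monom_value_superset[of "{1..d}"]) (auto simp: lookup_texponent)
      also have "\<dots> = (\<Prod>r<d. v (r + 1) ^ (ns ! r - 1))"
        by (rule prod.reindex_bij_witness[of _ Suc "\<lambda>i. i - 1"]) auto
      finally show ?thesis .
    qed
    have "fps_nth (fps_X ^ d * series_value v F) n = poly_value v (fps_nth F (n - d))"
      using False by (simp add: fps_X_power_mult_nth series_value_def)
    also have "\<dots> = (\<Sum>e\<in>texponent ` ?I. lookup (fps_nth F (n - d)) e * scalar (monom_value v e))"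
      by (rule poly_value_superset[OF _ keys], rule finite_imageI, rule finite_gen_series_index)
    also have "\<dots> = (\<Sum>ns\<in>?I. lookup (fps_nth F (n - d)) (texponent ns) * scalar (monom_value v (texponent ns)))"
      by (subst sum.reindex[OF inj]) (simp add: comp_def)
    also have "\<dots> = (\<Sum>ns\<in>?I. tcoeff (texponent ns) F * scalar (\<Prod>r<d. v (r + 1) ^ (ns ! r - 1)))"
    proof (rule sum.cong[OF refl])
      fix ns assume ns: "ns \<in> ?I"
      then have "mdegree (texponent ns) = n - d" using mdegree_texponent[of ns] by auto
      then show "lookup (fps_nth F (n - d)) (texponent ns) * scalar (monom_value v (texponent ns))
        = tcoeff (texponent ns) F * scalar (\<Prod>r<d. v (r + 1) ^ (ns ! r - 1))"
        by (simp add: tcoeff_mdegree val[OF ns])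
    qed
    also have "\<dots> = fps_nth (gen_value (\<lambda>ns. tcoeff (texponent ns) F) (map v [1..<d + 1])) n"
      unfolding gen_value_def fps_nth_Abs_fps
    proof (intro sum.cong, goal_cases)
      case (2 ns)
      have "(\<Prod>r<d. v (r + 1) ^ (ns ! r - 1)) = (\<Prod>r<d. (map v [1..<d + 1] ! r) ^ (ns ! r - 1))"
        by (rule prod.cong) (simp_all del: upt_Suc)
      then show ?case by (simp del: upt_Suc)
    qed (auto simp: not_le)
    finally show ?thesis .
  qed
qed

section \<open>Coefficients from values\<close>

text \<open>Uniqueness of the expansion in base \<open>B\<close> with digits \<open>n_r - 1\<close>:
  the remainder modulo \<open>B\<close> gives the first digit, the quotient the others.\<close>

lemma digit_sum_inj:
  fixes B :: nat
  assumes "length ns = length ns'" "\<And>n. n \<in> set ns \<union> set ns' \<Longrightarrow> 1 \<le> n \<and> n - 1 < B"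
    and "(\<Sum>r<length ns. (ns ! r - 1) * B ^ r) = (\<Sum>r<length ns'. (ns' ! r - 1) * B ^ r)"
  shows "ns = ns'"
  using assms
proof (induction ns ns' rule: list_induct2)
  case (Cons n ns n' ns')
  have step: "(\<Sum>r<length (m # ms). ((m # ms) ! r - 1) * B ^ r) = (m - 1) + B * (\<Sum>r<length ms. (ms ! r - 1) * B ^ r)"
    for m ms
    by (simp add: sum.lessThan_Suc_shift sum_distrib_left mult_ac del: sum.lessThan_Suc)
  have less: "n - 1 < B" "n' - 1 < B" "1 \<le> n" "1 \<le> n'" using Cons.prems(1) by auto
  have eq: "(n - 1) + B * (\<Sum>r<length ns. (ns ! r - 1) * B ^ r) = (n' - 1) + B * (\<Sum>r<length ns'. (ns' ! r - 1) * B ^ r)"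
    using Cons.prems(2) unfolding step .
  have "n - 1 = n' - 1" using arg_cong[OF eq, of "\<lambda>x. x mod B"] less(1,2) by (simp only: mod_mult_self2 mod_less)
  moreover have "(\<Sum>r<length ns. (ns ! r - 1) * B ^ r) = (\<Sum>r<length ns'. (ns' ! r - 1) * B ^ r)"
    using arg_cong[OF eq, of "\<lambda>x. x div B"] less(1,2) by (simp add: div_mult_self2 del: One_nat_def)
  ultimately show ?case using Cons.IH Cons.prems(1) less by (auto simp: eq_diff_iff)
qed simp

text \<open>Kronecker substitution: at the points \<open>t\<^sub>r = z\<^bsup>B\<^sup>r\<^esup>\<close> with \<open>B\<close> large, distinct monomials in the \<open>t\<^sub>r\<close>
  become distinct powers of \<open>z\<close>.\<close>

lemma gen_value_coeff_keys:
  assumes val: "\<And>qs k. length qs = d \<Longrightarrow> distinct (0 # qs) \<Longrightarrow> keys (fps_nth (gen_value c qs) k) \<subseteq> M k"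
    and ns: "length ns = d" "\<forall>n\<in>set ns. 1 \<le> n"
  shows "keys (c ns) \<subseteq> M (sum_list ns)"
proof
  fix m assume m: "m \<in> keys (c ns)"
  show "m \<in> M (sum_list ns)"
  proof (rule ccontr)
    assume nm: "m \<notin> M (sum_list ns)"
    define k where "k = sum_list ns"
    \<comment> \<open>The digits \<open>n_r - 1\<close> of an index of weight \<open>k\<close> are
      smaller than \<open>B\<close>, and \<open>B\<close> is at least 2, so that the exponents
      \<open>B ^ r\<close> are distinct.\<close>
    define B where "B = k + 2"
    define I where "I = {ns. length ns = d \<and> (\<forall>n\<in>set ns. 1 \<le> n) \<and> sum_list ns = k}"
    define \<phi> where "\<phi> ns = (\<Sum>r<length ns. (ns ! r - 1) * B ^ r)" for ns :: "nat list"
    \<comment> \<open>The coefficient of \<open>z ^ j\<close> after the substitution, taken in the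
      reals so that \<open>polyfun_roots_finite\<close> applies.\<close>
    define C where "C j = (\<Sum>ns\<in>I. if \<phi> ns = j then of_rat (lookup (c ns) m) else (0 :: real))" for j :: nat
    define N where "N = (\<Sum>ns\<in>I. \<phi> ns)"
    have fin: "finite I" unfolding I_def by (rule finite_gen_series_index)
    have N: "\<phi> ns \<le> N" if "ns \<in> I" for ns
      unfolding N_def using fin that by (simp add: member_le_sum)
    have C: "(\<Sum>j\<le>N. C j * x ^ j) = (\<Sum>ns\<in>I. of_rat (lookup (c ns) m) * x ^ \<phi> ns)" for x :: real
    proof -
      have "(\<Sum>j\<le>N. C j * x ^ j)
          = (\<Sum>j\<le>N. \<Sum>ns\<in>I. if \<phi> ns = j then of_rat (lookup (c ns) m) * x ^ j else 0)"
        unfolding C_def sum_distrib_right by (intro sum.cong refl) auto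
      also have "\<dots> = (\<Sum>ns\<in>I. \<Sum>j\<le>N. if \<phi> ns = j then of_rat (lookup (c ns) m) * x ^ j else 0)"
        by (rule sum.swap)
      also have "\<dots> = (\<Sum>ns\<in>I. of_rat (lookup (c ns) m) * x ^ \<phi> ns)"
        by (rule sum.cong) (simp_all add: N)
      finally show ?thesis .
    qed
    have root: "(\<Sum>j\<le>N. C j * real (n + 2) ^ j) = 0" for n
    proof -
      \<comment> \<open>Since \<open>z > 1\<close>, the points \<open>z ^ (B ^ r)\<close> are
        distinct and nonzero, as \<open>val\<close> demands. The infinitely many choices of
        \<open>z\<close> are all roots of the polynomial with coefficients \<open>C\<close>.\<close>
      define z :: rat where "z = of_nat (n + 2)"
      have z1: "1 < z" by (simp add: z_def)
      let ?qs = "map (\<lambda>r. z ^ (B ^ r)) [0..<d]"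
      have "inj_on (\<lambda>r. z ^ (B ^ r)) {0..<d}"
        by (rule inj_onI) (use z1 in \<open>simp add: power_inject_exp B_def\<close>)
      then have "distinct (0 # ?qs)" using z1 by (auto simp: distinct_map)
      then have "keys (fps_nth (gen_value c ?qs) k) \<subseteq> M k" by (intro val) simp_all
      then have "lookup (fps_nth (gen_value c ?qs) k) m = 0"
        using nm by (auto simp: k_def in_keys_iff)
      moreover have "lookup (fps_nth (gen_value c ?qs) k) m
        = (\<Sum>ns\<in>I. (\<Prod>r<d. (?qs ! r) ^ (ns ! r - 1)) * lookup (c ns) m)"
        unfolding gen_value_def fps_nth_Abs_fps lookup_sum I_def
        by (rule sum.cong) (simp_all add: lookup_mult_scalar)
      moreover have "(\<Prod>r<d. (?qs ! r) ^ (ns ! r - 1)) = z ^ \<phi> ns" if "ns \<in> I" for ns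
      proof -
        have "(\<Prod>r<d. (?qs ! r) ^ (ns ! r - 1)) = (\<Prod>r<d. z ^ ((ns ! r - 1) * B ^ r))"
          by (rule prod.cong) (simp_all add: power_mult[symmetric] mult.commute)
        then show ?thesis using that by (simp add: \<phi>_def I_def power_sum)
      qed
      ultimately have "(\<Sum>ns\<in>I. lookup (c ns) m * z ^ \<phi> ns) = 0"
        by (simp add: mult.commute)
      from arg_cong[OF this, of of_rat] show ?thesis
        unfolding C by (simp add: of_rat_sum of_rat_mult of_rat_power z_def of_rat_add)
    qed
    have "\<not> finite {x. (\<Sum>j\<le>N. C j * x ^ j) = 0}"
    proof
      assume "finite {x. (\<Sum>j\<le>N. C j * x ^ j) = 0}"
      then have "finite (range (\<lambda>n. real (n + 2)))"
        by (rule finite_subset[rotated]) (use root in auto)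
      then show False by (simp add: finite_image_iff inj_def)
    qed
    then have "C (\<phi> ns) = 0"
      using polyfun_roots_finite[of C "\<phi> ns" N] N[of ns] ns by (auto simp: I_def k_def)
    have inj: "ns' = ns" if "ns' \<in> I" "\<phi> ns' = \<phi> ns" for ns'
    proof (rule digit_sum_inj[where B = B])
      fix n assume "n \<in> set ns' \<union> set ns"
      then show "1 \<le> n \<and> n - 1 < B"
        using that ns member_le_sum_list[of n ns'] member_le_sum_list[of n ns] by (auto simp: I_def B_def k_def)
    qed (use that ns in \<open>auto simp: I_def \<phi>_def\<close>)
    have "C (\<phi> ns) = (\<Sum>ns'\<in>I. if ns' = ns then of_rat (lookup (c ns) m) else 0)"
      unfolding C_def by (rule sum.cong) (auto dest: inj)
    also have "\<dots> = of_rat (lookup (c ns) m)"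
      using fin ns by (simp add: sum.delta' I_def k_def)
    finally show False using \<open>C (\<phi> ns) = 0\<close> m by (simp add: in_keys_iff)
  qed
qed

text \<open>Distinct nonzero points are enough; the identities between series are established only
  there, namely on words that satisfy \<open>regular_word\<close>.\<close>

lemma gen_value_eqD:
  assumes "\<And>qs. length qs = d \<Longrightarrow> distinct (0 # qs) \<Longrightarrow> gen_value c qs = gen_value c' qs"
    and "length ns = d" "\<forall>n\<in>set ns. 1 \<le> n"
  shows "c ns = c' ns"
proof -
  have "keys (c ns - c' ns) \<subseteq> {}"
    by (rule gen_value_coeff_keys[where M = "\<lambda>_. {}" and d = d])
      (use assms in \<open>simp_all add: gen_value_diff\<close>)
  then show ?thesis by (simp only: subset_empty keys_eq_empty right_minus_eq)
qed

section \<open>Tensor products of algebra maps\<close>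

lemma smult_mult_left: "smult c x * y = smult c (x * y)"
  and smult_mult_right: "x * smult c y = smult c (x * y)"
  by (simp_all add: smult_def mult.assoc mult.left_commute)

lemma tensor_one: "tensor 1 1 = 1"
  by (simp add: tensor_single zero_prod_def[symmetric] flip: single_one)

text \<open>Pure tensors span, so multiplicativity extends by linearity, first in one factor and
  then in the other.\<close>

lemma algebra_map_tensorI:
  fixes h :: "('m::comm_monoid_add \<times> 'n::comm_monoid_add \<Rightarrow>\<^sub>0 rat) \<Rightarrow> 'p::comm_monoid_add \<Rightarrow>\<^sub>0 rat"
  assumes h: "linear_map h" and one: "h 1 = 1"
    and mult: "\<And>a b a' b'. h (tensor a b * tensor a' b') = h (tensor a b) * h (tensor a' b')"
  shows "algebra_map h"
proof -
  have 1: "h (tensor a b * w) = h (tensor a b) * h w" for a b w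
    by (rule tensor_linear_eqI[where w = w])
      (auto intro!: linear_mapI simp: mult distrib_left linear_map_add[OF h] linear_map_scale[OF h] smult_mult_right)
  have "h (u * w) = h u * h w" for u w
    by (rule tensor_linear_eqI[where w = u])
      (auto intro!: linear_mapI simp: 1 distrib_right linear_map_add[OF h] linear_map_scale[OF h] smult_mult_left)
  then show ?thesis using h one by (simp add: algebra_map_def)
qed

lemma tensor_map_tensor:
  assumes "linear_map f" "linear_map g"
  shows "tensor_map f g (tensor a b) = tensor (f a) (g b)"
  unfolding tensor_map_def
  by (rule tensor_lift_tensor)
    (auto intro!: linear_mapI simp: linear_map_add[OF assms(1)] linear_map_scale[OF assms(1)]
      linear_map_add[OF assms(2)] linear_map_scale[OF assms(2)]
      tensor_add_left tensor_add_right tensor_smult_left tensor_smult_right)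

lemma linear_tensor_map: "linear_map (tensor_map f g)"
  unfolding tensor_map_def by (rule linear_tensor_lift)

lemma algebra_map_tensor_map:
  assumes f: "algebra_map f" and g: "algebra_map g"
  shows "algebra_map (tensor_map f g)"
proof -
  have lin: "linear_map f" "linear_map g" using f g by (simp_all add: algebra_map_def)
  show ?thesis
    by (rule algebra_map_tensorI)
      (simp_all add: linear_tensor_map tensor_mult tensor_map_tensor[OF lin] tensor_one algebra_map_simps[OF f]
        algebra_map_simps[OF g] flip: tensor_one)
qed

lemma tensor_assoc_tensor: "tensor_assoc (tensor (tensor a b) c) = tensor a (tensor b c)"
proof -
  have 1: "tensor_lift (\<lambda>a b. tensor a (tensor b c)) (tensor a b) = tensor a (tensor b c)" for c a b
    by (rule tensor_lift_tensor)
      (auto intro!: linear_mapI simp: tensor_add_left tensor_add_right tensor_smult_left tensor_smult_right)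
  have lift_add: "tensor_lift (\<lambda>a b. tensor a (tensor b (c + c'))) u
    = tensor_lift (\<lambda>a b. tensor a (tensor b c)) u + tensor_lift (\<lambda>a b. tensor a (tensor b c')) u" for c c' u
    by (simp add: tensor_lift_def tensor_add_right pm.scale_right_distrib sum.distrib case_prod_unfold)
  have lift_scale: "tensor_lift (\<lambda>a b. tensor a (tensor b (smult q c))) u
    = smult q (tensor_lift (\<lambda>a b. tensor a (tensor b c)) u)" for q c u
    by (simp add: tensor_lift_def tensor_smult_right pm.scale_sum_right case_prod_unfold mult.commute)
  show ?thesis
    unfolding tensor_assoc_def
    by (subst tensor_lift_tensor)
      (auto intro!: linear_mapI linear_tensor_lift simp: 1 lift_add lift_scale)
qed

lemma algebra_map_tensor_assoc: "algebra_map tensor_assoc"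
proof -
  have lin: "linear_map tensor_assoc" unfolding tensor_assoc_def by (rule linear_tensor_lift)
  have 1: "tensor_assoc (tensor u c * tensor u' c') = tensor_assoc (tensor u c) * tensor_assoc (tensor u' c')"
    for u u' :: "'a \<times> 'b \<Rightarrow>\<^sub>0 rat" and c c' :: "'c \<Rightarrow>\<^sub>0 rat"
  proof -
    have 2: "tensor_assoc (tensor (tensor a b) c * tensor u' c')
        = tensor_assoc (tensor (tensor a b) c) * tensor_assoc (tensor u' c')"
      for a :: "'a \<Rightarrow>\<^sub>0 rat" and b :: "'b \<Rightarrow>\<^sub>0 rat"
      unfolding tensor_mult
      by (rule tensor_linear_eqI[where w = u'])
        (auto intro!: linear_mapI simp: tensor_mult tensor_assoc_tensor distrib_left tensor_add_left
          tensor_smult_left smult_mult_right linear_map_add[OF lin] linear_map_scale[OF lin])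
    show ?thesis
      by (rule tensor_linear_eqI[where w = u])
        (auto intro!: linear_mapI simp: 2 distrib_right tensor_add_left
          tensor_smult_left smult_mult_left linear_map_add[OF lin] linear_map_scale[OF lin])
  qed
  have "tensor_assoc 1 = 1"
    using tensor_assoc_tensor[of 1 1 1] by (simp add: tensor_one)
  then show ?thesis by (intro algebra_map_tensorI lin 1)
qed

lemma algebra_map_tensor_left: "algebra_map (\<lambda>a. tensor a 1)"
  and algebra_map_tensor_right: "algebra_map (\<lambda>a. tensor 1 a)"
  by (auto simp: algebra_map_def tensor_one tensor_mult tensor_add_left tensor_add_right
      tensor_smult_left tensor_smult_right intro!: linear_mapI)

section \<open>Regular sequences\<close>

text \<open>Regularity as a path from \<open>a\<close> to \<open>c\<close> with edges
  \<open>xprod a b\<close>: recording only the two end points turns concatenation, factors and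
  products of consecutive edges into composition of paths.\<close>

inductive chain :: "nat \<Rightarrow> laurent_monomial list \<Rightarrow> nat \<Rightarrow> bool" where
  chain_Nil: "chain a [] a"
| chain_Cons: "a < b \<Longrightarrow> chain b ys c \<Longrightarrow> chain a (xprod a b # ys) c"

inductive_cases chain_ConsE: "chain a (y # ys) c"
inductive_cases chain_NilE: "chain a [] c"

lemma chain_le: "chain a ys c \<Longrightarrow> a \<le> c \<and> (ys \<noteq> [] \<longrightarrow> a < c)"
  by (induction rule: chain.induct) auto

lemma xprod_add: "a \<le> b \<Longrightarrow> b \<le> c \<Longrightarrow> xprod a b + xprod b c = xprod a c"
  unfolding xprod_def by (rule sum.atLeastLessThan_concat)

lemma chain_sum: "chain a ys c \<Longrightarrow> sum_list ys = xprod a c"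
  by (induction rule: chain.induct) (auto simp: xprod_def[of a a for a] dest: chain_le intro!: xprod_add)

lemma chain_append: "chain a (ys @ zs) c \<longleftrightarrow> (\<exists>b. chain a ys b \<and> chain b zs c)"
proof (induction ys arbitrary: a)
  case Nil
  then show ?case by (auto intro: chain_Nil elim: chain_NilE)
next
  case (Cons y ys)
  then show ?case by (auto elim!: chain_ConsE intro: chain_Cons)
qed

lemma regular_imp_chain:
  assumes "length p = length ys + 1" "sorted_wrt (<) p" "\<forall>r<length ys. ys ! r = xprod (p ! r) (p ! (r + 1))"
  shows "chain (hd p) ys (last p)"
  using assms
proof (induction ys arbitrary: p)
  case Nil
  then show ?case by (cases p) (auto intro: chain_Nil)
next
  case (Cons y ys)
  then obtain a q where p: "p = a # q" and q: "length q = length ys + 1" by (cases p) auto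
  then obtain b q' where q': "q = b # q'" by (cases q) auto
  have "y = xprod a b" using Cons.prems(3) p q' by (metis length_Cons nth_Cons_0 nth_Cons_Suc Suc_eq_plus1 zero_less_Suc)
  moreover have "chain (hd q) ys (last q)"
    using Cons.prems p by (intro Cons.IH) (auto dest: spec[of _ "Suc _"])
  ultimately show ?case using Cons.prems(2) p q' by (auto intro: chain_Cons)
qed

lemma chain_imp_regular:
  assumes "chain a ys c"
  shows "\<exists>p. length p = length ys + 1 \<and> sorted_wrt (<) p \<and> hd p = a \<and>
    (\<forall>r<length ys. ys ! r = xprod (p ! r) (p ! (r + 1)))"
  using assms
proof (induction rule: chain.induct)
  case (chain_Nil a)
  show ?case by (rule exI[of _ "[a]"]) simp
next
  case (chain_Cons a b ys c)
  then obtain p where p: "length p = length ys + 1" "sorted_wrt (<) p" "hd p = b"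
    "\<forall>r<length ys. ys ! r = xprod (p ! r) (p ! (r + 1))" by blast
  then obtain q where q: "p = b # q" by (cases p) auto
  show ?case
  proof (intro exI[of _ "a # p"] conjI allI impI)
    show "sorted_wrt (<) (a # p)" using p q chain_Cons(1) by auto
    fix r assume "r < length (xprod a b # ys)"
    then show "(xprod a b # ys) ! r = xprod ((a # p) ! r) ((a # p) ! (r + 1))"
      using p q by (cases r) auto
  qed (use p in auto)
qed

lemma regular_iff_chain: "regular ys \<longleftrightarrow> ys \<noteq> [] \<and> (\<exists>a c. 1 \<le> a \<and> chain a ys c)"
proof
  assume "regular ys"
  then obtain p where p: "ys \<noteq> []" "length p = length ys + 1" "sorted_wrt (<) p" "\<forall>i\<in>set p. 1 \<le> i"
    "\<forall>r<length ys. ys ! r = xprod (p ! r) (p ! (r + 1))" by (auto simp: regular_def)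
  then have "chain (hd p) ys (last p)" "1 \<le> hd p" by (auto intro: regular_imp_chain simp: hd_in_set length_Suc_conv)
  then show "ys \<noteq> [] \<and> (\<exists>a c. 1 \<le> a \<and> chain a ys c)" using p by blast
next
  assume "ys \<noteq> [] \<and> (\<exists>a c. 1 \<le> a \<and> chain a ys c)"
  then obtain a p where p: "ys \<noteq> []" "1 \<le> a" "length p = length ys + 1" "sorted_wrt (<) p" "hd p = a"
    "\<forall>r<length ys. ys ! r = xprod (p ! r) (p ! (r + 1))" using chain_imp_regular by blast
  then have "\<forall>i\<in>set p. 1 \<le> i" by (cases p) auto
  then show "regular ys" using p by (auto simp: regular_def)
qed

text \<open>A nonempty block is a path of positive length, and its product telescopes to the single
  edge between its end points.\<close>

lemma chain_contracts:
  "contracts w xs \<Longrightarrow> chain a (map snd xs) c \<Longrightarrow> chain a (map snd w) c"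
proof (induction arbitrary: a rule: contracts.induct)
  case (contracts_Cons w r x b)
  then obtain m where m: "chain a (map snd b) m" "chain m (map snd r) c" by (auto simp: chain_append)
  moreover have "map snd b \<noteq> []" using contracts_Cons by auto
  ultimately show ?case
    using contracts_Cons.IH[OF m(2)] chain_sum[OF m(1)] chain_le[OF m(1)]
    by (auto simp: ysum_def intro: chain_Cons)
qed simp

text \<open>The labels are distinct as well as nonzero because the others must again be nonzero
  after translation by the label of an edge.\<close>

definition regular_word :: "laurent_monomial word \<Rightarrow> bool" where
  "regular_word xs \<longleftrightarrow> distinct (0 # map fst xs) \<and> (map snd xs = [] \<or> regular (map snd xs))"

lemma regular_word_chain:
  "regular_word xs \<longleftrightarrow> distinct (0 # map fst xs) \<and> (\<exists>a c. 1 \<le> a \<and> chain a (map snd xs) c)"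
  unfolding regular_word_def regular_iff_chain using chain_Nil[of 1] by auto

lemma chain_ge: "chain a ys c \<Longrightarrow> 1 \<le> a \<Longrightarrow> 1 \<le> c"
  using chain_le by fastforce

global_interpretation regular_words: admissible_words regular_word
proof
  fix a b assume ab: "regular_word (a @ b)"
  show "regular_word a \<and> regular_word b"
  proof -
    from ab obtain k l m where "1 \<le> k" "chain k (map snd a) l" "chain l (map snd b) m"
      by (auto simp: regular_word_chain chain_append)
    moreover from this have "1 \<le> l" by (blast intro: chain_ge)
    ultimately show ?thesis using ab unfolding regular_word_chain by auto
  qed
next
  fix w xs assume w: "contracts w xs" and xs: "regular_word xs"
  have "fst ` set w \<subseteq> fst ` set xs" "distinct (map fst w)"
    using contracts_labels[OF w] xs by (auto simp: regular_word_def)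
  moreover obtain a c where "1 \<le> a" "chain a (map snd xs) c" using xs by (auto simp: regular_word_chain)
  moreover from this(2) have "chain a (map snd w) c" by (rule chain_contracts[OF w])
  ultimately show "regular_word w" using xs unfolding regular_word_chain by auto
next
  fix a x b assume *: "regular_word (a @ x # b)"
  have "distinct (0 # map fst (shift t c))" if "distinct (map fst c)" "t \<notin> fst ` set c" for t and c :: "laurent_monomial word"
  proof -
    have eq: "map fst (shift t c) = map (\<lambda>s. s - t) (map fst c)" by (simp add: shift_def case_prod_unfold)
    have "distinct (0 # map (\<lambda>s. s - t) l)" if "distinct l" "t \<notin> set l" for l
      using that by (auto simp: distinct_map inj_on_def)
    then have "distinct (0 # map (\<lambda>s. s - t) (map fst c))" using that by (metis set_map)
    then show ?thesis by (simp only: eq)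
  qed
  moreover have "\<exists>m m'. 1 \<le> m \<and> chain m (map snd a) m'" "\<exists>m m'. 1 \<le> m \<and> chain m (map snd b) m'"
  proof -
    from * obtain k l m n where "1 \<le> k" "chain k (map snd a) l" "l < m" "chain m (map snd b) n"
      by (auto simp: regular_word_chain chain_append elim!: chain_ConsE)
    moreover from this have "1 \<le> m" using chain_ge[of k "map snd a" l] by simp
    ultimately show "\<exists>m m'. 1 \<le> m \<and> chain m (map snd a) m'" "\<exists>m m'. 1 \<le> m \<and> chain m (map snd b) m'"
      by blast+
  qed
  ultimately show "regular_word (shift (fst x) a) \<and> regular_word (shift (fst x) b)"
    using * unfolding regular_word_chain by auto
qed

section \<open>The series of regular and of inverted symbols\<close>

definition reg_series :: "laurent_monomial word \<Rightarrow> symb_alg fps" where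
  "reg_series xs = gen_value (symb (map snd xs)) (map fst xs)"

text \<open>The sign absorbs both the alternating signs in the recursion for inversion and the
  factors \<open>(-1)^(j - i)\<close> of the coproduct. The labels are reversed and negated because
  inversion is defined on \<open>[y_d^-1, ..., y_1^-1 | -t_d, ..., -t_1]\<close>.\<close>

definition inv_series :: "laurent_monomial word \<Rightarrow> symb_alg fps" where
  "inv_series xs = (- 1) ^ length xs * gen_value (inv_symb (map snd xs)) (rev (map (\<lambda>e. - fst e) xs))"

definition exp_log :: "rat \<Rightarrow> laurent_monomial \<Rightarrow> symb_alg fps" where
  "exp_log t y = exps (smult t (log_symb y))"

lemma inv_symb_Nil [simp]: "inv_symb [] ns = 1"
  by (subst inv_symb.simps) simp

declare inv_symb.simps [simp del]

lemma reg_series_Nil [simp]: "reg_series [] = 1"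
  by (simp add: reg_series_def gen_value_Nil symb_def)

lemma inv_series_Nil [simp]: "inv_series [] = 1"
  by (simp add: inv_series_def gen_value_Nil)

lemma log_symb_superset:
  "finite A \<Longrightarrow> keys y \<subseteq> A \<Longrightarrow> log_symb y = (\<Sum>i\<in>A. of_int (lookup y i) * gen (Log i))"
  unfolding log_symb_def by (rule sum.mono_neutral_left) (auto simp: in_keys_iff)

lemma log_symb_add: "log_symb (y + z) = log_symb y + log_symb z"
  using keys_add[of y z]
  by (simp add: log_symb_superset[of "keys y \<union> keys z"] lookup_add distrib_right sum.distrib)

lemma log_symb_zero [simp]: "log_symb 0 = 0"
  by (simp add: log_symb_def)

lemma additive_exp_log: "additive_exp exp_log"
  by (simp add: additive_exp_def exp_log_def log_symb_add pm.scale_left_distrib pm.scale_right_distrib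
      exps_add exps_zero)

lemma gen_value_rev: "gen_value c (rev qs) = gen_value (\<lambda>ns. c (rev ns)) qs"
proof (rule fps_ext)
  fix k
  have rev: "(\<Prod>r<length qs. rev qs ! r ^ (rev ns ! r - 1)) = (\<Prod>r<length qs. qs ! r ^ (ns ! r - 1))"
    if "length ns = length qs" for ns :: "nat list"
  proof -
    have "(\<Prod>r<length qs. rev qs ! r ^ (rev ns ! r - 1))
      = (\<Prod>r<length qs. qs ! (length qs - Suc r) ^ (ns ! (length qs - Suc r) - 1))"
      by (rule prod.cong) (simp_all add: rev_nth that)
    then show ?thesis
      using prod.nat_diff_reindex[of "\<lambda>r. qs ! r ^ (ns ! r - 1)" "length qs"] by simp
  qed
  have "(\<Prod>r<length qs. rev qs ! r ^ (ns ! r - 1)) = (\<Prod>r<length qs. qs ! r ^ (rev ns ! r - 1))"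
    if "length ns = length qs" for ns :: "nat list"
    using rev[of "rev ns"] that by simp
  then show "fps_nth (gen_value c (rev qs)) k = fps_nth (gen_value (\<lambda>ns. c (rev ns)) qs) k"
    unfolding gen_value_def fps_nth_Abs_fps
    by (intro sum.reindex_bij_witness[of _ rev rev]) auto
qed

lemma gen_value_uminus:
  "gen_value c (map uminus qs) = gen_value (\<lambda>ns. (- 1) ^ sum_list (map (\<lambda>n. n - 1) ns) * c ns) qs"
proof (rule fps_ext)
  fix k
  have "(\<Prod>r<length qs. map uminus qs ! r ^ (ns ! r - 1))
      = (- 1) ^ sum_list (map (\<lambda>n. n - 1) ns) * (\<Prod>r<length qs. qs ! r ^ (ns ! r - 1))"
    if "length ns = length qs" for ns :: "nat list"
  proof -
    have "sum_list (map (\<lambda>n. n - 1) ns) = (\<Sum>r<length qs. ns ! r - 1)"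
      using that by (simp add: sum_list_sum_nth lessThan_atLeast0)
    moreover have "(\<Prod>r<length qs. map uminus qs ! r ^ (ns ! r - 1))
      = (\<Prod>r<length qs. (- 1) ^ (ns ! r - 1) * qs ! r ^ (ns ! r - 1))"
      by (rule prod.cong) (simp_all add: power_mult_distrib[symmetric])
    ultimately show ?thesis by (simp add: prod.distrib power_sum)
  qed
  then show "fps_nth (gen_value c (map uminus qs)) k
      = fps_nth (gen_value (\<lambda>ns. (- 1) ^ sum_list (map (\<lambda>n. n - 1) ns) * c ns) qs) k"
    unfolding gen_value_def fps_nth_Abs_fps
    by (intro sum.cong) (simp_all add: scalar_simps scalar_minus_one_power mult_ac)
qed

lemma gen_value_minus_one_power:
  "gen_value (\<lambda>ns. (- 1) ^ m * c ns) qs = (- 1) ^ m * gen_value c qs"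
proof -
  have "gen_value (\<lambda>ns. - c ns) qs = - gen_value c qs" for c :: "nat list \<Rightarrow> 'a \<Rightarrow>\<^sub>0 rat"
    by (simp add: fps_eq_iff gen_value_def sum_negf)
  then show ?thesis by (induction m) simp_all
qed

lemma gen_value_sum: "gen_value (\<lambda>ns. \<Sum>j\<in>A. c j ns) qs = (\<Sum>j\<in>A. gen_value (c j) qs)"
proof (induction A rule: infinite_finite_induct)
  case (insert x A)
  then show ?case by (simp add: gen_value_add)
qed (simp_all add: fps_eq_iff gen_value_def)

text \<open>Setting \<open>t_j\<close> to 0 keeps exactly the terms with \<open>n_j = 1\<close>. The
  others contain a factor \<open>t_j\<close>; splitting it off shifts the index \<open>n_j\<close>
  by one, and \<open>fps_X\<close> accounts for the weight.\<close>

lemma gen_value_divided_difference: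
  assumes j: "j < length qs"
  shows "gen_value c qs - gen_value c (qs[j := 0])
    = fps_X * (fps_const (scalar (qs ! j)) * gen_value (\<lambda>ns. c (ns[j := ns ! j + 1])) qs)"
proof (rule fps_ext)
  fix k
  let ?I = "\<lambda>k :: nat. {ns. length ns = length qs \<and> (\<forall>n\<in>set ns. 1 \<le> n) \<and> sum_list ns = k}"
  let ?m = "\<lambda>qs ns. \<Prod>r<length qs. qs ! r ^ (ns ! r - 1) :: rat"
  have split: "?m qs' ns = qs' ! j ^ (ns ! j - 1) * (\<Prod>r\<in>{..<length qs} - {j}. qs' ! r ^ (ns ! r - 1))"
    if "length qs' = length qs" for qs' :: "rat list" and ns
    using prod.remove[of "{..<length qs}" j] j that by simp
  have zero: "?m (qs[j := 0]) ns = (if ns ! j - 1 = 0 then ?m qs ns else 0)" for ns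
  proof -
    have "(\<Prod>r\<in>{..<length qs} - {j}. qs[j := 0] ! r ^ (ns ! r - 1)) = (\<Prod>r\<in>{..<length qs} - {j}. qs ! r ^ (ns ! r - 1))"
      by (rule prod.cong) auto
    then show ?thesis using j split[of "qs[j := 0]" ns] split[of qs ns] by (simp add: power_0_left)
  qed
  have fin: "finite (?I k)" by (rule finite_gen_series_index)
  have "fps_nth (gen_value c qs - gen_value c (qs[j := 0])) k
    = (\<Sum>ns\<in>?I k. c ns * scalar (?m qs ns) - c ns * scalar (?m (qs[j := 0]) ns))"
    by (simp add: gen_value_def sum_subtractf)
  also have "\<dots> = (\<Sum>ns\<in>?I k. if 2 \<le> ns ! j then c ns * scalar (?m qs ns) else 0)"
  proof (rule sum.cong[OF refl])
    fix ns assume ns: "ns \<in> ?I k"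
    then have "1 \<le> ns ! j" using j by auto
    then show "c ns * scalar (?m qs ns) - c ns * scalar (?m (qs[j := 0]) ns)
      = (if 2 \<le> ns ! j then c ns * scalar (?m qs ns) else 0)"
      unfolding zero by (auto simp: scalar_simps)
  qed
  also have "\<dots> = (\<Sum>ns | ns \<in> ?I k \<and> 2 \<le> ns ! j. c ns * scalar (?m qs ns))"
    using fin by (rule sum.inter_filter[symmetric])
  also have "\<dots> = fps_nth (fps_X * (fps_const (scalar (qs ! j)) * gen_value (\<lambda>ns. c (ns[j := ns ! j + 1])) qs)) k"
  proof (cases k)
    case 0
    have "{ns. ns \<in> ?I k \<and> 2 \<le> ns ! j} = {}"
      using 0 j by auto (metis nth_mem not_numeral_le_zero)
    then show ?thesis using 0 by (simp only: sum.empty) simp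
  next
    case (Suc k')
    have upd: "sum_list (ns[j := x]) + ns ! j = sum_list ns + x" if "j < length ns" for ns :: "nat list" and x
      using elem_le_sum_list[OF that] that by (simp add: sum_list_update)
    have "(\<Sum>ns | ns \<in> ?I k \<and> 2 \<le> ns ! j. c ns * scalar (?m qs ns))
      = (\<Sum>ns\<in>?I k'. scalar (qs ! j) * (c (ns[j := ns ! j + 1]) * scalar (?m qs ns)))"
    proof (rule sum.reindex_bij_witness[of _ "\<lambda>ns. ns[j := ns ! j + 1]" "\<lambda>ns. ns[j := ns ! j - 1]"], goal_cases)
      case (1 ns)
      then show ?case using j by simp
    next
      case (2 ns)
      have "sum_list (ns[j := ns ! j - 1]) = k'" using 2 j Suc upd[of ns "ns ! j - 1"] by auto
      then show ?case using 2 by (auto dest!: set_update_subset_insert[THEN subsetD])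
    next
      case (3 ns)
      then show ?case using j by simp
    next
      case (4 ns)
      have "sum_list (ns[j := ns ! j + 1]) = k" using 4 j Suc upd[of ns "ns ! j + 1"] by auto
      moreover have "1 \<le> ns ! j" using 4 j by auto
      ultimately show ?case using 4 j by (auto dest!: set_update_subset_insert[THEN subsetD])
    next
      case (5 ns)
      let ?ns = "ns[j := ns ! j - 1]"
      have len: "length ns = length qs" and ge: "2 \<le> ns ! j" using 5 by auto
      have prod: "(\<Prod>r\<in>{..<length qs} - {j}. qs ! r ^ (?ns ! r - 1)) = (\<Prod>r\<in>{..<length qs} - {j}. qs ! r ^ (ns ! r - 1))"
        by (rule prod.cong) auto
      have "ns ! j - 1 = Suc (?ns ! j - 1)" using ge j len by simp
      then have "qs ! j ^ (ns ! j - 1) = qs ! j * qs ! j ^ (?ns ! j - 1)" by (metis power_Suc)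
      then have "?m qs ns = qs ! j * ?m qs ?ns"
        by (simp only: split[OF refl] prod mult.assoc)
      moreover have "?ns[j := ?ns ! j + 1] = ns" using ge j len by (simp add: list_update_same_conv)
      ultimately show ?case by (simp add: scalar_simps mult_ac)
    qed
    then show ?thesis using Suc by (simp add: gen_value_def sum_distrib_left)
  qed
  finally show "fps_nth (gen_value c qs - gen_value c (qs[j := 0])) k
    = fps_nth (fps_X * (fps_const (scalar (qs ! j)) * gen_value (\<lambda>ns. c (ns[j := ns ! j + 1])) qs)) k" .
qed

lemma splits_upt:
  "a \<le> b \<Longrightarrow> splits (map e [a..<b]) g = (\<Sum>i=a..b. g (map e [a..<i]) (map e [i..<b]))"
proof (induction "b - a" arbitrary: a g)
  case (Suc n)
  then have ab: "a < b" by simp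
  have "splits (map e [a..<b]) g = g [] (map e [a..<b]) + splits (map e [a + 1..<b]) (\<lambda>x. g (e a # x))"
    using ab by (simp add: upt_conv_Cons)
  also have "splits (map e [a + 1..<b]) (\<lambda>x. g (e a # x)) = (\<Sum>i=a + 1..b. g (e a # map e [a + 1..<i]) (map e [i..<b]))"
    using Suc.hyps ab by (intro Suc.hyps(1)) simp_all
  also have "\<dots> = (\<Sum>i=a + 1..b. g (map e [a..<i]) (map e [i..<b]))"
    by (rule sum.cong) (simp_all add: upt_conv_Cons)
  finally show ?case using ab by (simp add: sum.atLeast_Suc_atMost)
qed simp

lemma marks_upt:
  "marks (map e [a..<b]) g = (\<Sum>j=a..<b. g (map e [a..<j]) (e j) (map e [j + 1..<b]))"
proof (induction "b - a" arbitrary: a g)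
  case (Suc n)
  then have ab: "a < b" by simp
  have "marks (map e [a..<b]) g = g [] (e a) (map e [a + 1..<b]) + marks (map e [a + 1..<b]) (\<lambda>x. g (e a # x))"
    using ab by (simp add: upt_conv_Cons)
  also have "marks (map e [a + 1..<b]) (\<lambda>x. g (e a # x))
      = (\<Sum>j=a + 1..<b. g (e a # map e [a + 1..<j]) (e j) (map e [j + 1..<b]))"
    using Suc.hyps ab by (intro Suc.hyps(1)) simp_all
  also have "\<dots> = (\<Sum>j=a + 1..<b. g (map e [a..<j]) (e j) (map e [j + 1..<b]))"
    by (rule sum.cong) (simp_all add: upt_conv_Cons)
  finally show ?case using ab by (simp add: sum.atLeast_Suc_lessThan)
qed simp

lemma series_value_reg:
  assumes "\<And>r. r \<in> set idx \<Longrightarrow> poly_value v (l r) = scalar (q r)"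
  shows "fps_X ^ length idx * series_value v (gen_series (symb (map y idx)) (map l idx))
    = reg_series (map (\<lambda>r. (q r, y r)) idx)"
  using series_value_gen_series[of "map q idx" "map l idx" v "symb (map y idx)"] assms
  by (simp add: reg_series_def comp_def)

lemma inv_series_index:
  "gen_value (inv_symb (map y idx)) (map (\<lambda>r. - q r) (rev idx)) = (- 1) ^ length idx * inv_series (map (\<lambda>r. (q r, y r)) idx)"
  by (simp add: inv_series_def comp_def rev_map flip: power_mult_distrib mult.assoc)

lemma series_value_inv:
  assumes "\<And>r. r \<in> set idx \<Longrightarrow> poly_value v (l r) = scalar (- q r)"
  shows "fps_X ^ length idx * series_value v (gen_series (inv_symb (map y idx)) (map l (rev idx)))
    = (- 1) ^ length idx * inv_series (map (\<lambda>r. (q r, y r)) idx)"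
proof -
  have "poly_value v (map l (rev idx) ! r) = scalar (map (\<lambda>r. - q r) (rev idx) ! r)" if "r < length idx" for r
    using that assms[of "rev idx ! r"] nth_mem[of r "rev idx"] by simp
  then show ?thesis
    using series_value_gen_series[of "map (\<lambda>r. - q r) (rev idx)" "map l (rev idx)" v "inv_symb (map y idx)"]
    by (simp add: inv_series_index)
qed

lemma fps_X_mult_cancel:
  fixes a b :: "'a::comm_ring_1 fps"
  assumes "fps_X * a = fps_X * b" shows "a = b"
proof (rule fps_ext)
  fix n show "fps_nth a n = fps_nth b n"
    using arg_cong[OF assms, of "\<lambda>f. fps_nth f (Suc n)"] by simp
qed

lemma tcoeff_outside:
  assumes "homogeneous_series V F" "i \<in> keys e" "i \<notin> V"
  shows "tcoeff e F = 0"
proof (rule ccontr)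
  assume "tcoeff e F \<noteq> 0"
  then have "e \<in> keys (fps_nth F (mdegree e))" by (simp add: tcoeff_mdegree in_keys_iff)
  then show False using assms by (auto simp: homogeneous_series_def homogeneous_def)
qed

lemma texponent_update:
  assumes "j < length ns" "1 \<le> ns ! j"
  shows "texponent (ns[j := ns ! j + 1]) = texponent ns + single (Suc j) 1"
  by (rule poly_mapping_eqI) (use assms in \<open>auto simp: lookup_texponent lookup_add lookup_single when_def nth_list_update\<close>)

text \<open>
  The coefficient extractions \<open>tcoeff (e + single j 1)\<close> in \<open>inv_symb\<close> amount to taking the divided
  difference at \<open>t\<^sub>j\<close> and \<open>0\<close>, and the second sum does not contribute since it does not involve \<open>t\<^sub>j\<close>.
\<close>

lemma inv_series_rec:
  fixes v :: "nat \<Rightarrow> rat" and y :: "nat \<Rightarrow> laurent_monomial"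
  defines "e \<equiv> \<lambda>r. (v r, y r)"
  assumes d: "1 \<le> d" and v: "\<And>r. r \<in> {1..d} \<Longrightarrow> v r \<noteq> 0"
  shows "inv_series (map e [1..<d + 1]) =
    - (\<Sum>j=0..<d. inv_series (map e [1..<j + 1]) * reg_series (map e [j + 1..<d + 1]))
    - (\<Sum>j=1..<d + 1. fps_const (scalar (1 / v j)) *
        (exp_log (v j) (ysum (map e [1..<d + 1])) * inv_series (shift (v j) (map e [1..<j])) *
           reg_series (shift (v j) (map e [j + 1..<d + 1]))
         - inv_series (map e [1..<j]) * reg_series (map e [j + 1..<d + 1])))"
proof -
  define ys where "ys = map y [1..<d + 1]"
  define A where "A j = gen_series (inv_symb (map y [1..<j + 1])) (map (\<lambda>r. - tvar r) (rev [1..<j + 1])) *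
    gen_series (symb (map y [j + 1..<d + 1])) (map tvar [j + 1..<d + 1])" for j
  define P where "P j = gen_series (inv_symb (map y [1..<j])) (map (\<lambda>r. - tvar r) (rev [1..<j])) *
    gen_series (symb (map y [j + 1..<d + 1])) (map tvar [j + 1..<d + 1])" for j
  define Q where "Q j = gen_series (inv_symb (map y [1..<j])) (map (\<lambda>r. tvar j - tvar r) (rev [1..<j])) *
    exp_series (log_symb (sum_list ys)) (tvar j) *
    gen_series (symb (map y [j + 1..<d + 1])) (map (\<lambda>r. tvar r - tvar j) [j + 1..<d + 1])" for j
  let ?ts = "map v [1..<d + 1]"
  have len: "length ys = d" and ne: "ys \<noteq> []" using d by (auto simp: ys_def simp del: upt_Suc)
  have y: "map (\<lambda>r. ys ! (r - 1)) [i + 1..<d + 1] = map y [i + 1..<d + 1]" for i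
    unfolding ys_def by (rule map_cong) (auto simp del: upt_Suc)
  have take: "take i ys = map y [1..<i + 1]" if "i \<le> d" for i
    unfolding ys_def take_map by (subst take_upt) (use that in auto)
  have take': "take (j - 1) ys = map y [1..<j]" if "j \<in> {1..<d + 1}" for j
    using take[of "j - 1"] that by (auto simp del: upt_Suc)
  \<comment> \<open>The coefficients in the variables \<open>t_1, ..., t_d\<close> themselves: the
    index is put back in the order of the \<open>t_i\<close>, and the sign due to the arguments
    \<open>- t_i\<close> is removed.\<close>
  define c where "c ns = (- 1) ^ sum_list (map (\<lambda>n. n - 1) ns) * inv_symb ys (rev ns)" for ns
  have c: "c ns = (\<Sum>j=0..<d. (- 1) ^ (d - 1 + j) * tcoeff (texponent ns) (A j)) +
      (\<Sum>j=1..<d + 1. (- 1) ^ (d + j) * tcoeff (texponent ns + single j 1) (Q j))" for ns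
  proof -
    have A: "(\<Sum>j=0..<d. (- 1) ^ (d - 1 + j) * tcoeff (texponent ns) (gen_series (\<lambda>ks. inv_symb (take j ys) ks)
        (map (\<lambda>r. - tvar r) (rev [1..<j + 1])) * gen_series (symb (map (\<lambda>r. ys ! (r - 1)) [j + 1..<d + 1])) (map tvar [j + 1..<d + 1])))
      = (\<Sum>j=0..<d. (- 1) ^ (d - 1 + j) * tcoeff (texponent ns) (A j))"
      unfolding A_def y by (rule sum.cong) (simp_all add: take del: upt_Suc)
    have Q: "(\<Sum>j=1..<d + 1. (- 1) ^ (d + j) * tcoeff (texponent ns + single j 1)
        (gen_series (\<lambda>ks. inv_symb (take (j - 1) ys) ks) (map (\<lambda>r. tvar j - tvar r) (rev [1..<j])) *
         exp_series (log_symb (sum_list ys)) (tvar j) *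
         gen_series (symb (map (\<lambda>r. ys ! (r - 1)) [j + 1..<d + 1])) (map (\<lambda>r. tvar r - tvar j) [j + 1..<d + 1])))
      = (\<Sum>j=1..<d + 1. (- 1) ^ (d + j) * tcoeff (texponent ns + single j 1) (Q j))"
      unfolding Q_def y by (rule sum.cong) (simp_all only: take')
    have P: "(\<Sum>j=1..<d + 1. (- 1) ^ (d - 1 + j) * tcoeff (texponent ns + single j 1)
        (gen_series (\<lambda>ks. inv_symb (take (j - 1) ys) ks) (map (\<lambda>r. - tvar r) (rev [1..<j])) *
         gen_series (symb (map (\<lambda>r. ys ! (r - 1)) [j + 1..<d + 1])) (map tvar [j + 1..<d + 1]))) = 0"
    proof (rule sum.neutral, rule ballI)
      fix j assume j: "j \<in> {1..<d + 1}"
      have "homogeneous_series ({1..d} - {j}) (P j)"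
        unfolding P_def
        by (intro homogeneous_series_mult homogeneous_series_gen_series)
          (use j in \<open>auto intro!: homogeneous_uminus homogeneous_tvar[unfolded One_nat_def] simp del: upt_Suc\<close>)
      then have "tcoeff (texponent ns + single j 1) (P j) = 0"
        by (rule tcoeff_outside[of _ _ j]) (auto simp: in_keys_iff lookup_add)
      then show "(- 1) ^ (d - 1 + j) * tcoeff (texponent ns + single j 1)
        (gen_series (\<lambda>ks. inv_symb (take (j - 1) ys) ks) (map (\<lambda>r. - tvar r) (rev [1..<j])) *
         gen_series (symb (map (\<lambda>r. ys ! (r - 1)) [j + 1..<d + 1])) (map tvar [j + 1..<d + 1])) = 0"
        unfolding P_def y take'[OF j] by simp
    qed
    have sign: "(- 1) ^ s * ((- 1) ^ s * z) = z" for s and z :: symb_alg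
      by (simp flip: mult.assoc power_add mult_2)
    have s: "sum_list (map (\<lambda>n. n - 1) (rev ns)) = sum_list (map (\<lambda>n. n - 1) ns)"
      by (metis rev_map sum_list_rev)
    show ?thesis
      unfolding c_def
      by (subst inv_symb.simps) (simp only: if_not_P[OF ne] Let_def len rev_rev_ident s sign A P Q add_0_right)
  qed
  have "inv_series (map e [1..<d + 1]) = (- 1) ^ d * gen_value c ?ts"
    unfolding inv_series_def c_def gen_value_uminus[symmetric] gen_value_rev[symmetric]
    by (simp add: e_def comp_def ys_def gen_value_rev flip: gen_value_uminus del: upt_Suc)
  also have "gen_value c ?ts = (\<Sum>j=0..<d. (- 1) ^ (d - 1 + j) * gen_value (\<lambda>ns. tcoeff (texponent ns) (A j)) ?ts)
      + (\<Sum>j=1..<d + 1. (- 1) ^ (d + j) * gen_value (\<lambda>ns. tcoeff (texponent ns + single j 1) (Q j)) ?ts)"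
    unfolding c by (simp only: gen_value_add gen_value_sum gen_value_minus_one_power)
  also have "(\<Sum>j=0..<d. (- 1) ^ (d - 1 + j) * gen_value (\<lambda>ns. tcoeff (texponent ns) (A j)) ?ts)
    = (\<Sum>j=0..<d. (- 1) ^ (d - 1 + j) * ((- 1) ^ j * (inv_series (map e [1..<j + 1]) * reg_series (map e [j + 1..<d + 1]))))"
  proof (rule sum.cong[OF refl])
    fix j assume j: "j \<in> {0..<d}"
    have "homogeneous_series {1..d} (A j)"
      unfolding A_def
      by (intro homogeneous_series_mult homogeneous_series_gen_series)
        (use j in \<open>auto intro!: homogeneous_uminus homogeneous_tvar[unfolded One_nat_def] simp del: upt_Suc\<close>)
    then have "gen_value (\<lambda>ns. tcoeff (texponent ns) (A j)) ?ts = fps_X ^ d * series_value v (A j)"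
      by (simp only: homogeneous_series_value)
    also have "\<dots> = (fps_X ^ length [1..<j + 1] * series_value v (gen_series (inv_symb (map y [1..<j + 1])) (map (\<lambda>r. - tvar r) (rev [1..<j + 1])))) *
       (fps_X ^ length [j + 1..<d + 1] * series_value v (gen_series (symb (map y [j + 1..<d + 1])) (map tvar [j + 1..<d + 1])))"
      using j by (simp add: A_def series_value_simps power_add[symmetric] mult_ac del: upt_Suc)
        (simp add: mult.assoc[symmetric] power_add[symmetric] del: upt_Suc)
    also have "\<dots> = (- 1) ^ j * (inv_series (map e [1..<j + 1]) * reg_series (map e [j + 1..<d + 1]))"
      by (subst series_value_inv[where q = v], simp add: poly_value_uminus poly_value_tvar scalar_simps,
          subst series_value_reg[where q = v], simp add: poly_value_tvar)
        (simp add: e_def mult.assoc del: upt_Suc)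
    finally show "(- 1) ^ (d - 1 + j) * gen_value (\<lambda>ns. tcoeff (texponent ns) (A j)) ?ts
      = (- 1) ^ (d - 1 + j) * ((- 1) ^ j * (inv_series (map e [1..<j + 1]) * reg_series (map e [j + 1..<d + 1])))"
      by simp
  qed
  also have "(\<Sum>j=1..<d + 1. (- 1) ^ (d + j) * gen_value (\<lambda>ns. tcoeff (texponent ns + single j 1) (Q j)) ?ts)
    = (\<Sum>j=1..<d + 1. (- 1) ^ (d + j) * ((- 1) ^ (j - 1) * (fps_const (scalar (1 / v j)) *
        (exp_log (v j) (ysum (map e [1..<d + 1])) * inv_series (shift (v j) (map e [1..<j])) *
           reg_series (shift (v j) (map e [j + 1..<d + 1]))
         - inv_series (map e [1..<j]) * reg_series (map e [j + 1..<d + 1])))))"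
  proof (rule sum.cong[OF refl])
    fix j assume j: "j \<in> {1..<d + 1}"
    \<comment> \<open>At \<open>t_j = 0\<close> the exponential becomes 1 and the translation by
      \<open>t_j\<close> disappears, so this value of the divided difference is the untranslated
      product.\<close>
    let ?v0 = "v(j := 0)"
    have ysum: "ysum (map e [1..<d + 1]) = sum_list ys" by (simp add: ysum_def e_def ys_def comp_def del: upt_Suc)
    have hom: "homogeneous_series {1..d} (Q j)"
      unfolding Q_def
      by (intro homogeneous_series_mult homogeneous_series_gen_series homogeneous_series_exp_series)
        (use j in \<open>auto intro!: homogeneous_diff homogeneous_tvar[unfolded One_nat_def] simp del: upt_Suc\<close>)
    \<comment> \<open>Only \<open>d - 1\<close> powers of \<open>fps_X\<close>: the edge
      \<open>j\<close> is an argument of neither generating series.\<close>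
    have val: "fps_X ^ (d - 1) * series_value w (Q j) = (- 1) ^ (j - 1) *
        (exp_log (w j) (sum_list ys) * inv_series (map (\<lambda>r. (w r - w j, y r)) [1..<j]) *
         reg_series (map (\<lambda>r. (w r - w j, y r)) [j + 1..<d + 1]))" for w
    proof -
      have "fps_X ^ (d - 1) * series_value w (Q j)
        = (fps_X ^ length [1..<j] * series_value w (gen_series (inv_symb (map y [1..<j])) (map (\<lambda>r. tvar j - tvar r) (rev [1..<j])))) *
          series_value w (exp_series (log_symb (sum_list ys)) (tvar j)) *
         (fps_X ^ length [j + 1..<d + 1] * series_value w (gen_series (symb (map y [j + 1..<d + 1])) (map (\<lambda>r. tvar r - tvar j) [j + 1..<d + 1])))"
      proof -
        have "fps_X ^ (d - 1) = fps_X ^ length [1..<j] * (fps_X ^ length [j + 1..<d + 1] :: symb_alg fps)"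
          using j by (simp add: power_add[symmetric] del: upt_Suc)
        then show ?thesis by (simp only: Q_def series_value_simps mult_ac)
      qed
      also have "\<dots> = ((- 1) ^ (j - 1) * inv_series (map (\<lambda>r. (w r - w j, y r)) [1..<j])) * exp_log (w j) (sum_list ys)
         * reg_series (map (\<lambda>r. (w r - w j, y r)) [j + 1..<d + 1])"
        by (subst series_value_inv[where q = "\<lambda>r. w r - w j"], simp add: poly_value_diff poly_value_tvar scalar_simps,
          subst series_value_reg[where q = "\<lambda>r. w r - w j"], simp add: poly_value_diff poly_value_tvar scalar_simps,
          subst series_value_exp_series[where q = "w j"], simp add: poly_value_tvar)
          (simp add: exp_log_def del: upt_Suc)
      finally show ?thesis by (simp only: mult_ac)
    qed
    let ?V = "gen_value (\<lambda>ns. tcoeff (texponent ns + single j 1) (Q j)) ?ts"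
    have pow: "fps_X ^ d = fps_X * (fps_X ^ (d - 1) :: symb_alg fps)" using d by (simp flip: power_Suc)
    have nth: "?ts ! (j - 1) = v j" using j by (auto simp del: upt_Suc)
    have upd: "?ts[j - 1 := 0] = map ?v0 [1..<d + 1]"
      by (rule nth_equalityI) (use j in \<open>auto simp: nth_list_update simp del: upt_Suc\<close>)
    have "fps_X * (fps_const (scalar (v j)) * ?V)
      = fps_X * (fps_const (scalar (?ts ! (j - 1))) * gen_value (\<lambda>ns. (\<lambda>ns. tcoeff (texponent ns) (Q j)) (ns[j - 1 := ns ! (j - 1) + 1])) ?ts)"
      unfolding nth
      by (intro arg_cong[where f = "\<lambda>z. fps_X * (fps_const (scalar (v j)) * z)"] gen_value_cong, subst texponent_update)
        (use j in \<open>auto simp del: upt_Suc\<close>)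
    also have "\<dots> = gen_value (\<lambda>ns. tcoeff (texponent ns) (Q j)) ?ts - gen_value (\<lambda>ns. tcoeff (texponent ns) (Q j)) (?ts[j - 1 := 0])"
      by (rule gen_value_divided_difference[symmetric]) (use j in \<open>auto simp del: upt_Suc\<close>)
    also have "\<dots> = fps_X * (fps_X ^ (d - 1) * series_value v (Q j) - fps_X ^ (d - 1) * series_value ?v0 (Q j))"
      unfolding upd homogeneous_series_value[OF hom, symmetric] pow by (simp only: right_diff_distrib mult.assoc)
    finally have "fps_const (scalar (v j)) * ?V = fps_X ^ (d - 1) * series_value v (Q j) - fps_X ^ (d - 1) * series_value ?v0 (Q j)"
      by (rule fps_X_mult_cancel)
    \<comment> \<open>The one place where the labels have to be nonzero.\<close>
    moreover have "fps_const (scalar (1 / v j)) * (fps_const (scalar (v j)) * ?V) = ?V"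
      using v[of j] j by (simp add: mult.assoc[symmetric] scalar_simps flip: scalar_simps(4))
    ultimately have "?V = fps_const (scalar (1 / v j)) * (fps_X ^ (d - 1) * series_value v (Q j) - fps_X ^ (d - 1) * series_value ?v0 (Q j))"
      by simp
    also have "fps_X ^ (d - 1) * series_value v (Q j) = (- 1) ^ (j - 1) *
        (exp_log (v j) (ysum (map e [1..<d + 1])) * inv_series (shift (v j) (map e [1..<j])) *
           reg_series (shift (v j) (map e [j + 1..<d + 1])))"
      unfolding val ysum by (simp add: shift_def e_def comp_def del: upt_Suc)
    also have "fps_X ^ (d - 1) * series_value ?v0 (Q j) = (- 1) ^ (j - 1) *
        (inv_series (map e [1..<j]) * reg_series (map e [j + 1..<d + 1]))"
    proof -
      have "map (\<lambda>r. (?v0 r - ?v0 j, y r)) [1..<j] = map e [1..<j]"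
        "map (\<lambda>r. (?v0 r - ?v0 j, y r)) [j + 1..<d + 1] = map e [j + 1..<d + 1]"
        by (auto simp: e_def simp del: upt_Suc)
      moreover have "exp_log (?v0 j) (sum_list ys) = 1" by (simp add: exp_log_def exps_zero)
      ultimately show ?thesis by (simp only: val mult_1_left)
    qed
    finally show "(- 1) ^ (d + j) * ?V = (- 1) ^ (d + j) * ((- 1) ^ (j - 1) * (fps_const (scalar (1 / v j)) *
        (exp_log (v j) (ysum (map e [1..<d + 1])) * inv_series (shift (v j) (map e [1..<j])) *
           reg_series (shift (v j) (map e [j + 1..<d + 1]))
         - inv_series (map e [1..<j]) * reg_series (map e [j + 1..<d + 1]))))"
      by (simp only: right_diff_distrib mult_ac)
  qed
  finally have *: "inv_series (map e [1..<d + 1]) = (- 1) ^ d * (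
    (\<Sum>j=0..<d. (- 1) ^ (d - 1 + j) * ((- 1) ^ j * (inv_series (map e [1..<j + 1]) * reg_series (map e [j + 1..<d + 1]))))
    + (\<Sum>j=1..<d + 1. (- 1) ^ (d + j) * ((- 1) ^ (j - 1) * (fps_const (scalar (1 / v j)) *
        (exp_log (v j) (ysum (map e [1..<d + 1])) * inv_series (shift (v j) (map e [1..<j])) *
           reg_series (shift (v j) (map e [j + 1..<d + 1]))
         - inv_series (map e [1..<j]) * reg_series (map e [j + 1..<d + 1]))))))" .
  \<comment> \<open>The signs in \<open>inv_series\<close> at the word and at its prefix meet the
    one of the recursion; a single minus sign survives.\<close>
  have sign1: "(- 1) ^ d * ((- 1) ^ (d - 1 + j) * ((- 1) ^ j * z)) = - z" for j and z :: "symb_alg fps"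
  proof -
    obtain d' where "d = Suc d'" using d by (cases d) auto
    then show ?thesis by (simp add: power_add flip: mult.assoc power_mult_distrib)
  qed
  have sign2: "(- 1) ^ d * ((- 1) ^ (d + j) * ((- 1) ^ (j - 1) * z)) = - z" if "1 \<le> j" for j and z :: "symb_alg fps"
  proof -
    from that obtain j' where "j = Suc j'" by (auto dest: Suc_le_D)
    then show ?thesis by (simp add: power_add flip: mult.assoc power_mult_distrib)
  qed
  have sign2': "(\<Sum>j=1..<d + 1. (- 1) ^ d * ((- 1) ^ (d + j) * ((- 1) ^ (j - 1) * z j))) = - (\<Sum>j=1..<d + 1. z j)"
    for z :: "nat \<Rightarrow> symb_alg fps"
    unfolding sum_negf[symmetric] by (rule sum.cong[OF refl], rule sign2) simp
  show ?thesis
    unfolding * distrib_left sum_distrib_left sign1 sign2' sum_negf by (simp only: diff_conv_add_uminus)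
qed

lemma conv_single_edge:
  "conv G (conv (single_edge \<tau>) F) xs = marks xs (\<lambda>a x b. G a * \<tau> x * F b)"
proof -
  have "single_edge \<tau> m * F b = single_edge (\<lambda>x. \<tau> x * F b) m" for m b
    by (cases m rule: remdups_adj.cases) simp_all
  then have "conv (single_edge \<tau>) F r = (case r of [] \<Rightarrow> 0 | x # b \<Rightarrow> \<tau> x * F b)" for r
    by (simp add: conv_def splits_single_edge)
  then show ?thesis
    unfolding conv_def[of G] marks_eq_splits
    by (intro splits_cong refl) (auto simp: mult.assoc split: list.splits)
qed

lemma word_as_map: "xs = map (\<lambda>r. (fst (xs ! (r - 1)), snd (xs ! (r - 1)))) [1..<length xs + 1]"
  by (rule nth_equalityI) (simp_all del: upt_Suc)

definition inverse_label :: "rat \<times> 'y \<Rightarrow> ('m::comm_monoid_add \<Rightarrow>\<^sub>0 rat) fps" where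
  "inverse_label e = fps_const (scalar (1 / fst e))"

text \<open>This is \<open>inv_series_rec\<close> rearranged: the trivial factorisation
  \<open>xs @ []\<close> supplies \<open>inv_series xs\<close>, and the untranslated parts of the
  divided differences cancel the terms of the product that contain
  \<open>inverse_label\<close>.\<close>

lemma inversion_relation_symb:
  "regular_words.inversion_relation inverse_label reg_series inv_series exp_log"
  unfolding regular_words.inversion_relation_def
proof (intro conjI allI impI additive_exp_log)
  fix xs assume xs: "regular_word xs"
  let ?u = "\<lambda>w. unit_word w - single_edge inverse_label w"
  show "conv inv_series (conv ?u reg_series) xs = unit_word xs - contract_block reg_series inv_series exp_log inverse_label xs"
  proof (cases "xs = []")
    case True
    then show ?thesis by (simp add: conv_Nil unit_word_def)
  next
    case False
    define d where "d = length xs"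
    define v where "v r = fst (xs ! (r - 1))" for r
    define y where "y r = snd (xs ! (r - 1))" for r
    let ?e = "\<lambda>r. (v r, y r)"
    have eq: "xs = map ?e [1..<d + 1]" unfolding v_def y_def d_def by (rule word_as_map)
    have d: "1 \<le> d" using False by (simp add: d_def Suc_le_eq)
    have v: "v r \<noteq> 0" if "r \<in> {1..d}" for r
    proof -
      have "v r \<in> fst ` set xs" using that by (auto simp: v_def d_def)
      moreover have "0 \<notin> fst ` set xs" using xs by (simp add: regular_word_def)
      ultimately show ?thesis by metis
    qed
    let ?B = "\<lambda>j. inv_series (map ?e [1..<j + 1]) * reg_series (map ?e [j + 1..<d + 1])"
    let ?U = "\<lambda>j. exp_log (v j) (ysum xs) * inv_series (shift (v j) (map ?e [1..<j])) *
        reg_series (shift (v j) (map ?e [j + 1..<d + 1]))"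
    let ?W = "\<lambda>j. inv_series (map ?e [1..<j]) * reg_series (map ?e [j + 1..<d + 1])"
    let ?q = "\<lambda>j. fps_const (scalar (1 / v j)) :: symb_alg fps"
    have marks: "marks xs h = (\<Sum>j=1..<d + 1. h (map ?e [1..<j]) (?e j) (map ?e [j + 1..<d + 1]))"
      for h :: "laurent_monomial word \<Rightarrow> _ \<Rightarrow> _ \<Rightarrow> symb_alg fps"
      using marks_upt[of ?e 1 "d + 1" h] unfolding eq[symmetric] .
    have "conv inv_series (conv ?u reg_series) xs
      = conv inv_series reg_series xs - conv inv_series (conv (single_edge inverse_label) reg_series) xs"
    proof -
      have "conv ?u reg_series = (\<lambda>w. conv unit_word reg_series w - conv (single_edge inverse_label) reg_series w)"
        by (rule ext) (simp add: conv_def left_diff_distrib splits_diff)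
      then show ?thesis
        by (simp add: conv_unit_left) (simp add: conv_def right_diff_distrib splits_diff)
    qed
    also have "conv inv_series reg_series xs = (\<Sum>j=0..<d. ?B j) + inv_series xs"
    proof -
      have "conv inv_series reg_series xs
        = (\<Sum>i=1..d + 1. inv_series (map ?e [1..<i]) * reg_series (map ?e [i..<d + 1]))"
        unfolding conv_def by (subst (1) eq, subst splits_upt) (simp_all del: upt_Suc)
      also have "\<dots> = (\<Sum>j=0..<d + 1. ?B j)"
        by (rule sum.reindex_bij_witness[of _ "\<lambda>j. j + 1" "\<lambda>i. i - 1"]) auto
      also have "\<dots> = (\<Sum>j=0..<d. ?B j) + ?B d" by simp
      finally show ?thesis unfolding eq[symmetric] by (simp del: upt_Suc)
    qed
    also have "conv inv_series (conv (single_edge inverse_label) reg_series) xs = (\<Sum>j=1..<d + 1. ?q j * ?W j)"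
      unfolding conv_single_edge
      by (simp add: marks inverse_label_def mult_ac del: upt_Suc)
    also have "inv_series xs = - (\<Sum>j=0..<d. ?B j) - (\<Sum>j=1..<d + 1. ?q j * (?U j - ?W j))"
      using inv_series_rec[where v = v and y = y, OF d v] unfolding eq[symmetric] .
    also have "(\<Sum>j=1..<d + 1. ?q j * (?U j - ?W j)) = (\<Sum>j=1..<d + 1. ?q j * ?U j) - (\<Sum>j=1..<d + 1. ?q j * ?W j)"
      by (simp only: right_diff_distrib sum_subtractf)
    also have "(\<Sum>j=1..<d + 1. ?q j * ?U j) = contract_block reg_series inv_series exp_log inverse_label xs"
      unfolding contract_block_def
      by (simp add: marks inverse_label_def mult_ac del: upt_Suc)
    finally show ?thesis using False by (simp add: unit_word_def)
  qed
qed simp_all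

section \<open>The coproduct of a generating series\<close>

text \<open>For \<open>a \<ge> 1\<close>, the part of \<open>comul_indices d\<close> with first
  index \<open>a\<close>; fixing it allows a recursion on the first block that matches the one of
  \<open>subst\<close>.\<close>

definition blocks :: "nat \<Rightarrow> nat \<Rightarrow> (nat list \<times> nat list) set" where
  "blocks a d = {(iv, jv). length iv = length jv + 1 \<and> last iv = d + 1 \<and> hd iv = a \<and>
     (\<forall>\<alpha><length jv. iv ! \<alpha> \<le> jv ! \<alpha> \<and> jv ! \<alpha> < iv ! (\<alpha> + 1))}"

lemma blocks_Nil: "(iv, []) \<in> blocks a d \<longleftrightarrow> a = d + 1 \<and> iv = [d + 1]"
  by (auto simp: blocks_def length_Suc_conv)

lemma blocks_Cons: "(i # iv, j # jv) \<in> blocks a d \<longleftrightarrow> i = a \<and> a \<le> j \<and> j < hd iv \<and> (iv, jv) \<in> blocks (hd iv) d"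
  by (cases iv) (auto simp: blocks_def All_less_Suc2)

lemma blocks_nonempty: "(iv, jv) \<in> blocks a d \<Longrightarrow> iv \<noteq> [] \<and> hd iv = a"
  by (auto simp: blocks_def)

lemma blocks_induct [consumes 1, case_names Nil Cons]:
  assumes "(iv, jv) \<in> blocks a d"
    and "P (d + 1) [d + 1] []"
    and "\<And>a i j iv jv. a \<le> j \<Longrightarrow> j < i \<Longrightarrow> i \<le> d + 1 \<Longrightarrow> (iv, jv) \<in> blocks i d \<Longrightarrow> iv \<noteq> [] \<Longrightarrow> hd iv = i \<Longrightarrow>
      P i iv jv \<Longrightarrow> P a (a # iv) (j # jv)"
  shows "P a iv jv"
proof -
  have "a \<le> d + 1 \<and> P a iv jv"
    using assms(1)
  proof (induction jv arbitrary: iv a)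
    case Nil
    then show ?case using assms(2) by (simp add: blocks_Nil)
  next
    case (Cons j jv)
    then obtain i iv' where iv: "iv = i # iv'" using blocks_nonempty[OF Cons.prems] by (cases iv) auto
    with Cons.prems have *: "i = a" "a \<le> j" "j < hd iv'" "(iv', jv) \<in> blocks (hd iv') d"
      by (simp_all add: blocks_Cons)
    with Cons.IH have "hd iv' \<le> d + 1" "P (hd iv') iv' jv" by blast+
    then show ?case using assms(3)[of a j "hd iv'" iv' jv] * blocks_nonempty[OF *(4)] iv by simp
  qed
  then show ?thesis ..
qed

lemma finite_blocks: "1 \<le> a \<Longrightarrow> finite (blocks a d)"
  by (rule finite_subset[OF _ finite_comul_indices[of d]]) (auto simp: blocks_def comul_indices_def)

lemma blocks_last: "blocks (Suc d) d = {([Suc d], [])}"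
proof -
  have "iv = [Suc d] \<and> jv = []" if p: "(iv, jv) \<in> blocks (Suc d) d" for iv jv
    using p
  proof (cases jv)
    case (Cons j jv')
    from p obtain i iv' where iv: "iv = i # iv'" by (cases iv) (auto dest: blocks_nonempty)
    have *: "d + 1 \<le> j" "j < hd iv'" "(iv', jv') \<in> blocks (hd iv') d"
      using p by (auto simp: iv Cons blocks_Cons)
    have "hd iv' \<le> d + 1" using *(3) by (induction rule: blocks_induct) auto
    then show ?thesis using * by simp
  qed (simp add: blocks_Nil)
  then show ?thesis by (auto simp: blocks_Nil)
qed

text \<open>A first block from \<open>a\<close> to \<open>i\<close>, a marked position
  \<open>j\<close> in it and a pair starting at \<open>i\<close> make up a pair starting at
  \<open>a\<close>, uniquely.\<close>

lemma sum_blocks_Cons: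
  assumes a: "1 \<le> a" "a \<le> d"
  shows "(\<Sum>(iv, jv)\<in>blocks a d. h iv jv)
    = (\<Sum>i=a+1..d+1. \<Sum>j=a..<i. \<Sum>(iv, jv)\<in>blocks i d. h (a # iv) (j # jv))"
proof -
  have le: "hd iv \<le> d + 1" if "(iv, jv) \<in> blocks i d" for iv jv i
    using that by (induction rule: blocks_induct) auto
  have "(\<Sum>(iv, jv)\<in>blocks a d. h iv jv)
    = (\<Sum>(i, j, iv, jv)\<in>(SIGMA i:{a+1..d+1}. SIGMA j:{a..<i}. blocks i d). h (a # iv) (j # jv))"
  proof (rule sum.reindex_bij_witness[of _ "\<lambda>(i, j, iv, jv). (a # iv, j # jv)"
        "\<lambda>(iv, jv). (iv ! 1, hd jv, tl iv, tl jv)"], goal_cases)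
    case (1 p)
    obtain iv jv where p: "p = (iv, jv)" by (cases p)
    then have "jv \<noteq> []" using 1 a by (auto simp: blocks_Nil)
    then obtain i iv' j jv' where iv: "iv = i # iv'" "jv = j # jv'"
      using 1 blocks_nonempty p by (cases iv; cases jv) auto
    with 1 p show ?case by (auto simp: blocks_Cons)
  next
    case (2 p)
    obtain iv jv where p: "p = (iv, jv)" by (cases p)
    then have "jv \<noteq> []" using 2 a by (auto simp: blocks_Nil)
    then obtain i iv' j jv' where iv: "iv = i # iv'" "jv = j # jv'"
      using 2 blocks_nonempty p by (cases iv; cases jv) auto
    have *: "i = a" "a \<le> j" "j < hd iv'" "(iv', jv') \<in> blocks (hd iv') d"
      using 2 p iv by (auto simp: blocks_Cons)
    then have "iv' \<noteq> []" "hd iv' \<le> d + 1" using blocks_nonempty le by blast+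
    then show ?case using * p iv by (auto simp: hd_conv_nth)
  next
    case (3 p)
    then show ?case by (auto simp: hd_conv_nth dest!: blocks_nonempty)
  next
    case (4 p)
    obtain i j iv jv where p: "p = (i, j, iv, jv)" by (cases p)
    then have "hd iv = i" using 4 by (auto dest: blocks_nonempty)
    then show ?case using 4 p by (auto simp: blocks_Cons)
  next
    case (5 p)
    obtain iv jv where p: "p = (iv, jv)" by (cases p)
    then have "jv \<noteq> []" using 5 a by (auto simp: blocks_Nil)
    then show ?case using 5 p blocks_nonempty[of iv jv a d] by (cases iv; cases jv) auto
  qed
  also have "\<dots> = (\<Sum>i=a+1..d+1. \<Sum>(j, iv, jv)\<in>(SIGMA j:{a..<i}. blocks i d). h (a # iv) (j # jv))"
    by (subst sum.Sigma) (use a in \<open>auto intro!: finite_blocks\<close>)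
  also have "\<dots> = (\<Sum>i=a+1..d+1. \<Sum>j=a..<i. \<Sum>(iv, jv)\<in>blocks i d. h (a # iv) (j # jv))"
    by (intro sum.cong refl, subst sum.Sigma) (use a in \<open>auto intro!: finite_blocks\<close>)
  finally show ?thesis .
qed

lemma sum_comul_indices:
  "(\<Sum>(iv, jv)\<in>comul_indices d. h iv jv) = (\<Sum>a=1..d + 1. \<Sum>(iv, jv)\<in>blocks a d. h iv jv)"
proof -
  have le: "hd iv \<le> d + 1" if "(iv, jv) \<in> blocks i d" for iv jv i
    using that by (induction rule: blocks_induct) auto
  have mem: "(iv, jv) \<in> comul_indices d \<Longrightarrow> (iv, jv) \<in> blocks (hd iv) d" for iv jv
    by (auto simp: comul_indices_def blocks_def)
  have "(\<lambda>p. hd (fst p)) ` comul_indices d \<subseteq> {1..d + 1}"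
  proof clarify
    fix iv jv assume p: "(iv, jv) \<in> comul_indices d"
    then show "hd (fst (iv, jv)) \<in> {1..d + 1}" using le[OF mem[OF p]] by (simp add: comul_indices_def)
  qed
  then have "(\<Sum>(iv, jv)\<in>comul_indices d. h iv jv)
    = (\<Sum>a=1..d + 1. \<Sum>(iv, jv)\<in>{p \<in> comul_indices d. hd (fst p) = a}. h iv jv)"
    by (intro sum.group[symmetric] finite_comul_indices finite_atLeastAtMost)
  also have "\<dots> = (\<Sum>a=1..d + 1. \<Sum>(iv, jv)\<in>blocks a d. h iv jv)"
    by (intro sum.cong refl) (auto simp: comul_indices_def blocks_def)
  finally show ?thesis .
qed

lemma blocks_range:
  "(iv, jv) \<in> blocks a d \<Longrightarrow> \<alpha> < length jv \<Longrightarrow>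
    a \<le> iv ! \<alpha> \<and> iv ! \<alpha> \<le> jv ! \<alpha> \<and> jv ! \<alpha> < iv ! (\<alpha> + 1) \<and> iv ! (\<alpha> + 1) \<le> d + 1"
proof (induction arbitrary: \<alpha> rule: blocks_induct)
  case (Cons a i j iv jv)
  show ?case
  proof (cases \<alpha>)
    case 0
    then show ?thesis using Cons by (simp add: hd_conv_nth)
  next
    case (Suc \<beta>)
    then have "i \<le> iv ! \<beta>" "iv ! \<beta> \<le> jv ! \<beta>" "jv ! \<beta> < iv ! (\<beta> + 1)" "iv ! (\<beta> + 1) \<le> d + 1"
      using Cons.IH[of \<beta>] Cons.prems by simp_all
    then show ?thesis using Cons.hyps Suc by simp
  qed
qed simp

text \<open>Bookkeeping for the powers of \<open>fps_X\<close>: each block contributes one argument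
  on the left and all its positions but the marked one on the right, the initial segment another
  \<open>a - 1\<close>.\<close>

lemma blocks_telescope:
  "(iv, jv) \<in> blocks a d \<Longrightarrow> 1 \<le> a \<Longrightarrow>
    (\<Sum>\<alpha><length jv. iv ! (\<alpha> + 1) - 1 - iv ! \<alpha>) + length jv + (a - 1) = d"
proof (induction rule: blocks_induct)
  case (Cons a i j iv jv)
  then show ?case by (simp add: sum.lessThan_Suc_shift hd_conv_nth del: sum.lessThan_Suc)
qed simp

text \<open>The arguments and variables of the left tensor factor in the coproduct formula, as a
  word.\<close>

definition block_word :: "(nat \<Rightarrow> rat \<times> 'y::comm_monoid_add) \<Rightarrow> nat list \<Rightarrow> nat list \<Rightarrow> 'y word" where
  "block_word e iv jv = map (\<lambda>\<alpha>. (fst (e (jv ! \<alpha>)), \<Sum>r=iv ! \<alpha>..<iv ! (\<alpha> + 1). snd (e r))) [0..<length jv]"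

lemma block_word_Cons:
  "iv \<noteq> [] \<Longrightarrow> block_word e (i # iv) (j # jv) = (fst (e j), \<Sum>r=i..<hd iv. snd (e r)) # block_word e iv jv"
  by (auto simp: block_word_def upt_conv_Cons hd_conv_nth simp flip: map_Suc_upt simp del: upt_Suc)

lemma ysum_upt: "ysum (map e [i..<j]) = (\<Sum>r=i..<j. snd (e r))"
  by (simp add: ysum_def comp_def interv_sum_list_conv_sum_set_nat)

lemma upt_split: "i \<le> j \<Longrightarrow> j \<le> k \<Longrightarrow> [i..<k] = [i..<j] @ [j..<k]"
  using upt_add_eq_append[of i j "k - j"] by simp

lemma contracts_block_word:
  "(iv, jv) \<in> blocks a d \<Longrightarrow> contracts (block_word e iv jv) (map e [a..<d + 1])"
proof (induction rule: blocks_induct)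
  case Nil
  then show ?case by (simp add: block_word_def contracts_Nil)
next
  case (Cons a i j iv jv)
  have "map e [a..<d + 1] = map e [a..<i] @ map e [i..<d + 1]"
    using Cons by (simp add: upt_split[of a i "Suc d"] del: upt_Suc)
  moreover have "e j \<in> set (map e [a..<i])" using Cons by auto
  ultimately show ?case
    using contracts_Cons[OF Cons.IH, of "e j" "map e [a..<i]"] Cons
    by (simp add: block_word_Cons ysum_upt del: upt_Suc)
qed

text \<open>The recursion of \<open>subst\<close> unrolled over the index set of the coproduct, so
  that the two formulas can be compared term by term.\<close>

lemma subst_blocks:
  fixes e :: "nat \<Rightarrow> rat \<times> 'y::comm_monoid_add" and F G :: "'y word \<Rightarrow> 'r::comm_ring_1" and ex :: "rat \<Rightarrow> 'y \<Rightarrow> 'r"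
  assumes "1 \<le> a" "a \<le> d + 1"
  defines "w \<equiv> \<lambda>i j i'. ex (fst (e j)) (\<Sum>r=i..<i'. snd (e r)) * G (shift (fst (e j)) (map e [i..<j]))
      * F (shift (fst (e j)) (map e [j + 1..<i']))"
  shows "subst F G ex f (map e [a..<d + 1])
    = (\<Sum>(iv, jv)\<in>blocks a d. f (block_word e iv jv) * (\<Prod>\<alpha><length jv. w (iv ! \<alpha>) (jv ! \<alpha>) (iv ! (\<alpha> + 1))))"
  using assms(1,2)
proof (induction "d + 1 - a" arbitrary: a f rule: less_induct)
  case less
  show ?case
  proof (cases "a = d + 1")
    case True
    then show ?thesis by (simp add: blocks_last block_word_def)
  next
    case False
    then have a: "a \<le> d" using less.prems by simp
    let ?W = "\<lambda>iv jv. \<Prod>\<alpha><length jv. w (iv ! \<alpha>) (jv ! \<alpha>) (iv ! (\<alpha> + 1))"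
    let ?K = "contract_block F G ex" and ?S = "subst F G ex"
    have "?S f (map e [a..<d + 1])
      = (\<Sum>i=a..d + 1. ?K (\<lambda>x. ?S (\<lambda>w. f (x # w)) (map e [i..<d + 1])) (map e [a..<i]))"
      using less.prems a by (subst subst_unfold, subst splits_upt) (auto simp del: upt_Suc)
    also have "\<dots> = (\<Sum>i=a+1..d + 1. ?K (\<lambda>x. ?S (\<lambda>w. f (x # w)) (map e [i..<d + 1])) (map e [a..<i]))"
      using a by (subst sum.atLeast_Suc_atMost) (simp_all del: upt_Suc)
    also have "\<dots> = (\<Sum>i=a+1..d+1. \<Sum>j=a..<i. \<Sum>(iv, jv)\<in>blocks i d.
        f (block_word e (a # iv) (j # jv)) * ?W (a # iv) (j # jv))"
    proof (rule sum.cong[OF refl])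
      fix i assume i: "i \<in> {a+1..d+1}"
      have "?K (\<lambda>x. ?S (\<lambda>w. f (x # w)) (map e [i..<d + 1])) (map e [a..<i])
        = (\<Sum>j=a..<i. ?S (\<lambda>w. f ((fst (e j), \<Sum>r=a..<i. snd (e r)) # w)) (map e [i..<d + 1]) * w a j i)"
        unfolding contract_block_def by (subst marks_upt) (simp add: ysum_upt w_def mult.assoc del: upt_Suc)
      also have "\<dots> = (\<Sum>j=a..<i. \<Sum>(iv, jv)\<in>blocks i d.
        f (block_word e (a # iv) (j # jv)) * ?W (a # iv) (j # jv))"
      proof (rule sum.cong[OF refl])
        fix j assume j: "j \<in> {a..<i}"
        have "?S (\<lambda>w. f ((fst (e j), \<Sum>r=a..<i. snd (e r)) # w)) (map e [i..<d + 1])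
          = (\<Sum>(iv, jv)\<in>blocks i d. f ((fst (e j), \<Sum>r=a..<i. snd (e r)) # block_word e iv jv) * ?W iv jv)"
          by (rule less.hyps) (use i a less.prems in auto)
        then show "?S (\<lambda>w. f ((fst (e j), \<Sum>r=a..<i. snd (e r)) # w)) (map e [i..<d + 1]) * w a j i
          = (\<Sum>(iv, jv)\<in>blocks i d. f (block_word e (a # iv) (j # jv)) * ?W (a # iv) (j # jv))"
          unfolding sum_distrib_right
        proof (simp only: sum_distrib_right, intro sum.cong refl, clarify)
          fix iv jv assume "(iv, jv) \<in> blocks i d"
          then have iv: "iv \<noteq> []" "hd iv = i" using blocks_nonempty by blast+
          then have "?W (a # iv) (j # jv) = w a j i * ?W iv jv"
            by (simp add: prod.lessThan_Suc_shift hd_conv_nth del: prod.lessThan_Suc)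
          then show "f ((fst (e j), \<Sum>r=a..<i. snd (e r)) # block_word e iv jv) * ?W iv jv * w a j i
            = f (block_word e (a # iv) (j # jv)) * ?W (a # iv) (j # jv)"
            using iv by (simp add: block_word_Cons mult_ac)
        qed
      qed
      finally show "?K (\<lambda>x. ?S (\<lambda>w. f (x # w)) (map e [i..<d + 1])) (map e [a..<i])
        = (\<Sum>j=a..<i. \<Sum>(iv, jv)\<in>blocks i d. f (block_word e (a # iv) (j # jv)) * ?W (a # iv) (j # jv))" .
    qed
    also have "\<dots> = (\<Sum>(iv, jv)\<in>blocks a d. f (block_word e iv jv) * ?W iv jv)"
      by (rule sum_blocks_Cons[symmetric]) (use less.prems a in auto)
    finally show ?thesis .
  qed
qed

lemma lookup_xprod: "lookup (xprod a b) i = (if a \<le> i \<and> i < b then 1 else 0)"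
proof -
  have "lookup (xprod a b) i = (\<Sum>r=a..<b. if r = i then 1 else 0)"
    unfolding xprod_def lookup_sum lookup_single when_def ..
  then show ?thesis by (auto simp: sum.delta)
qed

lemma chain_nonneg: "chain a ys c \<Longrightarrow> y \<in> set ys \<Longrightarrow> (\<forall>i. 0 \<le> lookup y i) \<and> (\<exists>i. 0 < lookup y i)"
  by (induction rule: chain.induct) (auto simp: lookup_xprod)

text \<open>The exponents of a regular argument are nonnegative and not all 0, which fails for its
  inverse. Hence \<open>INV_gen\<close> takes no regular symbol for an inverted one.\<close>

lemma not_regular_invert:
  assumes "chain a ys c" "1 \<le> a"
  shows "\<not> regular (invert ys)"
proof
  assume r: "regular (invert ys)"
  then obtain y where y: "y \<in> set ys" by (cases ys) (auto simp: regular_def invert_def)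
  then have "- y \<in> set (invert ys)" by (auto simp: invert_def)
  moreover obtain a' c' where "chain a' (invert ys) c'" using r by (auto simp: regular_iff_chain)
  ultimately have "\<forall>i. 0 \<le> lookup (- y) i" using chain_nonneg by blast
  then have "\<forall>i. lookup y i \<le> 0" by simp
  then show False using chain_nonneg[OF assms(1) y] by (meson leD)
qed

lemma invert_invert [simp]: "invert (invert ys) = ys"
  by (simp add: invert_def rev_map comp_def)

lemma algebra_map_INV: "algebra_map INV"
  unfolding INV_def by (rule algebra_map_alg_hom)

lemma INV_gen: "INV (gen g) = INV_gen g"
  unfolding INV_def gen_def by (rule alg_hom_generator)

lemma INV_symb:
  assumes "chain a ys c" "1 \<le> a"
  shows "INV (symb ys ns) = symb ys ns"
  using not_regular_invert[OF assms] by (simp add: symb_def algebra_map_simps[OF algebra_map_INV] INV_gen)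

lemma INV_symb_invert:
  assumes "chain a ys c" "1 \<le> a"
  shows "INV (symb (invert ys) ns) = inv_symb ys ns"
proof (cases "ys = []")
  case True
  then show ?thesis by (simp add: invert_def symb_def algebra_map_simps[OF algebra_map_INV])
next
  case False
  then have "invert ys \<noteq> []" "regular ys" using assms by (auto simp: invert_def regular_iff_chain)
  then show ?thesis by (simp add: symb_def INV_gen)
qed

lemma INV_log: "INV (log_symb y) = log_symb y"
proof -
  have "INV (of_int n) = of_int n" for n
    using algebra_map_simps(9)[OF algebra_map_INV, of "of_int n"]
    by (cases n) (simp_all add: scalar_simps scalar_of_nat)
  then show ?thesis
    by (simp add: log_symb_def algebra_map_simps[OF algebra_map_INV] INV_gen)
qed

definition inv_inv :: "symb_alg2 \<Rightarrow> symb_alg2" where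
  "inv_inv = tensor_map INV INV"

lemma algebra_map_inv_inv: "algebra_map inv_inv"
  unfolding inv_inv_def by (intro algebra_map_tensor_map algebra_map_INV)

lemma inv_inv_tensor: "inv_inv (tensor a b) = tensor (INV a) (INV b)"
  unfolding inv_inv_def using algebra_map_INV by (intro tensor_map_tensor) (auto simp: algebra_map_def)

lemma algebra_map_inv_comul: "algebra_map inv_comul"
proof -
  have "inv_comul = (\<lambda>a. inv_inv (alg_hom comul_gen a))"
    by (simp add: fun_eq_iff inv_comul_def inv_inv_def comul_def)
  then show ?thesis
    using algebra_map_compose[OF algebra_map_inv_inv algebra_map_alg_hom, of comul_gen] by simp
qed

lemma inv_comul_gen: "inv_comul (gen g) = inv_inv (comul_gen g)"
  unfolding inv_comul_def comul_def gen_def inv_inv_def alg_hom_generator ..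

lemma chain_segment:
  assumes "chain k (map y [1..<d + 1]) c" "1 \<le> k" "1 \<le> i" "i \<le> j" "j \<le> d + 1"
  obtains k' c' where "chain k' (map y [i..<j]) c'" "1 \<le> k'"
proof -
  have "map y [1..<d + 1] = map y [1..<i] @ map y [i..<j] @ map y [j..<d + 1]"
    using assms by (simp add: upt_split[of "Suc 0" i "Suc d"] upt_split[of i j "Suc d"] del: upt_Suc)
  then obtain b b' where "chain k (map y [1..<i]) b" "chain b (map y [i..<j]) b'"
    using assms(1) by (auto simp: chain_append)
  then show thesis using that chain_ge assms(2) by blast
qed

text \<open>The composite of two data with the substituting one in the right tensor factor: the
  initial segment and the weights of the blocks stand on the right, the contracted arguments on the
  left.\<close>

definition coproduct_value :: "laurent_monomial word \<Rightarrow> symb_alg2 fps" where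
  "coproduct_value = conv (\<lambda>xs. map_fps (tensor 1) (reg_series xs))
     (subst (\<lambda>xs. map_fps (tensor 1) (reg_series xs)) (\<lambda>xs. map_fps (tensor 1) (inv_series xs))
       (\<lambda>t y. map_fps (tensor 1) (exp_log t y)) (\<lambda>xs. map_fps (\<lambda>a. tensor a 1) (reg_series xs)))"

lemma comul_series_value:
  fixes ys :: "laurent_monomial list" and v :: "nat \<Rightarrow> rat"
  defines "d \<equiv> length ys" and "y \<equiv> \<lambda>r. ys ! (r - 1)"
  assumes ch: "chain k ys c" "1 \<le> k"
  shows "fps_X ^ d * map_fps inv_inv (series_value v (comul_series ys))
    = coproduct_value (map (\<lambda>r. (v r, y r)) [1..<d + 1])"
proof -
  let ?e = "\<lambda>r. (v r, y r)"
  define H where "H F = map_fps inv_inv (series_value v F)" for F :: "symb_alg2 series"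
  define yprod where "yprod i j = (\<Sum>r=i..<j. y r)" for i j
  define L where "L iv jv = gen_series (\<lambda>ns. tensor (symb (map (\<lambda>\<alpha>. yprod (iv ! \<alpha>) (iv ! (\<alpha> + 1))) [0..<length jv]) ns) 1 :: symb_alg2) (map tvar jv)"
    for iv jv :: "nat list"
  define R where "R idx l = gen_series (\<lambda>ns. tensor 1 (symb (map y idx) ns) :: symb_alg2) (map l idx)" for idx l
  define M where "M i j = gen_series (\<lambda>ns. tensor 1 (symb (map (\<lambda>r. - y r) (rev [i..<j])) ns) :: symb_alg2)
     (map (\<lambda>r. tvar j - tvar r) (rev [i..<j]))" for i j
  define f where "f i j i' = (- 1) ^ (j - i) * exp_series (tensor 1 (log_symb (yprod i i')) :: symb_alg2) (tvar j) *
     M i j * R [j + 1..<i'] (\<lambda>r. tvar r - tvar j)" for i j i'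
  let ?F1 = "\<lambda>xs. map_fps (\<lambda>a. tensor a (1 :: symb_alg)) (reg_series xs)"
    and ?F2 = "\<lambda>xs. map_fps (tensor (1 :: symb_alg)) (reg_series xs)"
    and ?G2 = "\<lambda>xs. map_fps (tensor (1 :: symb_alg)) (inv_series xs)"
    and ?ex2 = "\<lambda>t y. map_fps (tensor (1 :: symb_alg)) (exp_log t y)"
  define w where "w i j i' = ?ex2 (v j) (yprod i i') * ?G2 (shift (v j) (map ?e [i..<j]))
      * ?F2 (shift (v j) (map ?e [j + 1..<i']))" for i j i'
  have ys: "ys = map y [1..<d + 1]"
    by (rule nth_equalityI) (simp_all add: y_def d_def del: upt_Suc)
  have ch': "chain k (map y [1..<d + 1]) c" using ch(1) unfolding ys[symmetric] .
  have Hm: "H (F * G) = H F * H G" for F G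
    by (simp add: H_def series_value_simps map_fps_mult algebra_map_inv_inv)
  have Hs: "H (sum g A) = (\<Sum>x\<in>A. H (g x))" for g :: "'z \<Rightarrow> symb_alg2 series" and A
    by (simp add: H_def series_value_sum map_fps_sum algebra_map_inv_inv)
  have Hp: "H (prod g A) = (\<Prod>x\<in>A. H (g x))" for g :: "'z \<Rightarrow> symb_alg2 series" and A
    by (simp add: H_def series_value_prod map_fps_prod algebra_map_inv_inv)
  have H1: "H ((- 1) ^ n) = (- 1) ^ n" for n
    by (simp add: H_def series_value_minus_one_power map_fps_power map_fps_simps algebra_map_inv_inv)
  have Hg: "fps_X ^ length ls * H (gen_series g ls) = gen_value (\<lambda>ns. inv_inv (g ns)) qs"
    if "length qs = length ls" "\<And>r. r < length ls \<Longrightarrow> poly_value v (ls ! r) = scalar (qs ! r)" for g ls qs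
  proof -
    have "fps_X ^ length ls * H (gen_series g ls) = map_fps inv_inv (fps_X ^ length ls * series_value v (gen_series g ls))"
      by (simp add: H_def map_fps_mult map_fps_power map_fps_simps algebra_map_inv_inv)
    then show ?thesis
      by (simp add: series_value_gen_series[OF that] map_fps_gen_value algebra_map_inv_inv)
  qed
  have inv1: "INV 1 = 1" by (simp add: algebra_map_simps[OF algebra_map_INV])
  have HL: "fps_X ^ length jv * H (L iv jv) = ?F1 (block_word ?e iv jv)"
    if p: "(iv, jv) \<in> blocks a d" "1 \<le> a" "a \<le> d + 1" for iv jv a
  proof -
    let ?zs = "map (\<lambda>\<alpha>. yprod (iv ! \<alpha>) (iv ! (\<alpha> + 1))) [0..<length jv]"
    obtain k' c' where k': "chain k' (map y [a..<d + 1]) c'" "1 \<le> k'"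
      by (rule chain_segment[OF ch' ch(2), of a "d + 1"]) (use p in \<open>auto simp del: upt_Suc\<close>)
    have snd: "map snd (block_word ?e iv jv) = ?zs" "map fst (block_word ?e iv jv) = map v jv"
      by (simp_all add: block_word_def yprod_def comp_def map_nth flip: map_map[of v "\<lambda>\<alpha>. jv ! \<alpha>", unfolded comp_def])
    \<comment> \<open>Products over consecutive blocks of a regular sequence form a regular
      sequence, so inversion fixes the left factor.\<close>
    have "chain k' ?zs c'"
      using chain_contracts[OF contracts_block_word[OF p(1), of ?e], of k' c'] k' by (simp only: snd) (simp add: comp_def del: upt_Suc)
    then have "inv_inv (tensor (symb ?zs ns) 1) = tensor (symb ?zs ns) 1" for ns
      using INV_symb k'(2) by (simp add: inv_inv_tensor inv1)
    moreover have "fps_X ^ length jv * H (L iv jv) = gen_value (\<lambda>ns. inv_inv (tensor (symb ?zs ns) 1)) (map v jv)"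
      using Hg[of "map v jv" "map tvar jv"] by (simp add: L_def poly_value_tvar)
    ultimately show ?thesis
      by (simp add: reg_series_def snd map_fps_gen_value algebra_map_tensor_left)
  qed
  have HR: "fps_X ^ (j - i) * H (R [i..<j] l) = ?F2 (map (\<lambda>r. (q r, y r)) [i..<j])"
    if p: "1 \<le> i" "i \<le> j" "j \<le> d + 1" and l: "\<And>r. r \<in> {i..<j} \<Longrightarrow> poly_value v (l r) = scalar (q r)" for i j l q
  proof -
    obtain k' c' where k': "chain k' (map y [i..<j]) c'" "1 \<le> k'"
      by (rule chain_segment[OF ch' ch(2), of i j]) (use p in auto)
    have "inv_inv (tensor 1 (symb (map y [i..<j]) ns)) = tensor 1 (symb (map y [i..<j]) ns)" for ns
      using INV_symb[OF k'] by (simp add: inv_inv_tensor inv1)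
    then show ?thesis
      using Hg[of "map q [i..<j]" "map l [i..<j]"] l
      by (simp add: R_def reg_series_def comp_def map_fps_gen_value algebra_map_tensor_right)
  qed
  have HM: "fps_X ^ (j - i) * H (M i j) = (- 1) ^ (j - i) * ?G2 (shift (v j) (map ?e [i..<j]))"
    if p: "1 \<le> i" "i \<le> j" "j \<le> d" for i j
  proof -
    obtain k' c' where k': "chain k' (map y [i..<j]) c'" "1 \<le> k'"
      by (rule chain_segment[OF ch' ch(2), of i j]) (use p in auto)
    have inv: "map (\<lambda>r. - y r) (rev [i..<j]) = invert (map y [i..<j])"
      by (simp add: invert_def rev_map comp_def)
    have "inv_inv (tensor 1 (symb (map (\<lambda>r. - y r) (rev [i..<j])) ns)) = tensor 1 (inv_symb (map y [i..<j]) ns)" for ns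
      unfolding inv using INV_symb_invert[OF k'] by (simp add: inv_inv_tensor inv1)
    moreover have "poly_value v (map (\<lambda>r. tvar j - tvar r) (rev [i..<j]) ! r)
       = (scalar (map (\<lambda>r. - (v r - v j)) (rev [i..<j]) ! r) :: symb_alg2)" if "r < j - i" for r
      using that by (simp add: poly_value_diff poly_value_tvar scalar_simps)
    ultimately have "fps_X ^ (j - i) * H (M i j)
      = gen_value (\<lambda>ns. tensor 1 (inv_symb (map y [i..<j]) ns)) (map (\<lambda>r. - (v r - v j)) (rev [i..<j]))"
      using Hg[of "map (\<lambda>r. - (v r - v j)) (rev [i..<j])" "map (\<lambda>r. tvar j - tvar r) (rev [i..<j])"]
      by (simp add: M_def)
    also have "\<dots> = map_fps (tensor 1) ((- 1) ^ (j - i) * inv_series (map (\<lambda>r. (v r - v j, y r)) [i..<j]))"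
      using inv_series_index[of y "[i..<j]" "\<lambda>r. v r - v j"]
      by (simp add: algebra_map_tensor_right flip: map_fps_gen_value)
    finally show ?thesis
      by (simp add: map_fps_mult map_fps_power map_fps_simps algebra_map_tensor_right shift_def comp_def)
  qed
  have Hf: "fps_X ^ (i' - 1 - i) * H (f i j i') = w i j i'" if "1 \<le> i" "i \<le> j" "j < i'" "i' \<le> d + 1" for i j i'
  proof -
    have "fps_X ^ (i' - 1 - i) = fps_X ^ (j - i) * (fps_X ^ (i' - (j + 1)) :: symb_alg2 fps)"
      using that by (simp add: power_add[symmetric])
    moreover have "H (exp_series (tensor 1 (log_symb (yprod i i'))) (tvar j)) = ?ex2 (v j) (yprod i i')"
      by (simp add: H_def series_value_exp_series[OF poly_value_tvar] exp_log_def map_fps_exps algebra_map_inv_inv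
          algebra_map_tensor_right algebra_map_simps[OF algebra_map_inv_inv] inv_inv_tensor INV_log inv1 tensor_smult_right)
    moreover have "fps_X ^ (i' - (j + 1)) * H (R [j + 1..<i'] (\<lambda>r. tvar r - tvar j)) = ?F2 (shift (v j) (map ?e [j + 1..<i']))"
      using that HR[of "j + 1" i' "\<lambda>r. tvar r - tvar j" "\<lambda>r. v r - v j"]
      by (simp add: poly_value_diff poly_value_tvar scalar_simps shift_def comp_def)
    ultimately have "fps_X ^ (i' - 1 - i) * H (f i j i') = (- 1) ^ (j - i) * ?ex2 (v j) (yprod i i') *
        (fps_X ^ (j - i) * H (M i j)) * ?F2 (shift (v j) (map ?e [j + 1..<i']))"
      by (simp add: f_def Hm H1 mult_ac)
    \<comment> \<open>The sign of the coproduct formula meets the one in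
      \<open>inv_series\<close>.\<close>
    also have "\<dots> = ((- 1) ^ (j - i) * (- 1) ^ (j - i)) * w i j i'"
    proof -
      have "j \<le> d" using that by simp
      from HM[OF that(1,2) this] show ?thesis by (simp only: w_def mult_ac)
    qed
    finally show ?thesis by (simp flip: power_mult_distrib)
  qed
  have "comul_series ys = (\<Sum>(iv, jv)\<in>comul_indices d. L iv jv * R [1..<hd iv] tvar *
      (\<Prod>\<alpha><length jv. f (iv ! \<alpha>) (jv ! \<alpha>) (iv ! (\<alpha> + 1))))"
    unfolding comul_series_def Let_def L_def R_def f_def M_def yprod_def y_def d_def ..
  then have "fps_X ^ d * H (comul_series ys) = (\<Sum>(iv, jv)\<in>comul_indices d. fps_X ^ d * (H (L iv jv) * H (R [1..<hd iv] tvar) *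
      (\<Prod>\<alpha><length jv. H (f (iv ! \<alpha>) (jv ! \<alpha>) (iv ! (\<alpha> + 1))))))"
    by (simp add: Hs Hm Hp sum_distrib_left case_prod_unfold)
  also have "\<dots> = (\<Sum>a=1..d + 1. \<Sum>(iv, jv)\<in>blocks a d. fps_X ^ d * (H (L iv jv) * H (R [1..<hd iv] tvar) *
      (\<Prod>\<alpha><length jv. H (f (iv ! \<alpha>) (jv ! \<alpha>) (iv ! (\<alpha> + 1))))))"
    by (rule sum_comul_indices)
  also have "\<dots> = (\<Sum>a=1..d + 1. ?F2 (map ?e [1..<a]) * subst ?F2 ?G2 ?ex2 ?F1 (map ?e [a..<d + 1]))"
  proof (rule sum.cong[OF refl])
    fix a assume a: "a \<in> {1..d + 1}"
    have "subst ?F2 ?G2 ?ex2 ?F1 (map ?e [a..<d + 1]) = (\<Sum>(iv, jv)\<in>blocks a d. ?F1 (block_word ?e iv jv) *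
        (\<Prod>\<alpha><length jv. w (iv ! \<alpha>) (jv ! \<alpha>) (iv ! (\<alpha> + 1))))"
      using a by (subst subst_blocks) (simp_all add: w_def yprod_def del: upt_Suc)
    moreover have "fps_X ^ d * (H (L iv jv) * H (R [1..<hd iv] tvar) *
        (\<Prod>\<alpha><length jv. H (f (iv ! \<alpha>) (jv ! \<alpha>) (iv ! (\<alpha> + 1)))))
      = ?F2 (map ?e [1..<a]) * (?F1 (block_word ?e iv jv) * (\<Prod>\<alpha><length jv. w (iv ! \<alpha>) (jv ! \<alpha>) (iv ! (\<alpha> + 1))))"
      if iv: "(iv, jv) \<in> blocks a d" for iv jv
    proof -
      have hd: "hd iv = a" using iv blocks_nonempty by blast
      \<comment> \<open>The powers of \<open>fps_X\<close> are handed out to the factors, each of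
        which takes as many as it has arguments.\<close>
      have "d = (\<Sum>\<alpha><length jv. iv ! (\<alpha> + 1) - 1 - iv ! \<alpha>) + length jv + (a - 1)"
        using blocks_telescope[OF iv] a by simp
      then have "fps_X ^ d = (\<Prod>\<alpha><length jv. fps_X ^ (iv ! (\<alpha> + 1) - 1 - iv ! \<alpha>)) * fps_X ^ length jv * (fps_X ^ (a - 1) :: symb_alg2 fps)"
        unfolding power_add[symmetric] power_sum[symmetric] by (rule arg_cong)
      then have "fps_X ^ d * (H (L iv jv) * H (R [1..<hd iv] tvar) *
          (\<Prod>\<alpha><length jv. H (f (iv ! \<alpha>) (jv ! \<alpha>) (iv ! (\<alpha> + 1)))))
        = (fps_X ^ (a - 1) * H (R [1..<a] tvar)) * ((fps_X ^ length jv * H (L iv jv)) *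
          (\<Prod>\<alpha><length jv. fps_X ^ (iv ! (\<alpha> + 1) - 1 - iv ! \<alpha>) * H (f (iv ! \<alpha>) (jv ! \<alpha>) (iv ! (\<alpha> + 1)))))"
        unfolding hd prod.distrib by (simp only: mult_ac)
      also have "fps_X ^ (a - 1) * H (R [1..<a] tvar) = ?F2 (map ?e [1..<a])"
        using a HR[of 1 a tvar v] by (simp add: poly_value_tvar)
      also have "fps_X ^ length jv * H (L iv jv) = ?F1 (block_word ?e iv jv)"
        using HL[OF iv] a by simp
      also have "(\<Prod>\<alpha><length jv. fps_X ^ (iv ! (\<alpha> + 1) - 1 - iv ! \<alpha>) * H (f (iv ! \<alpha>) (jv ! \<alpha>) (iv ! (\<alpha> + 1))))
        = (\<Prod>\<alpha><length jv. w (iv ! \<alpha>) (jv ! \<alpha>) (iv ! (\<alpha> + 1)))"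
      proof (rule prod.cong[OF refl])
        fix \<alpha> assume "\<alpha> \<in> {..<length jv}"
        then show "fps_X ^ (iv ! (\<alpha> + 1) - 1 - iv ! \<alpha>) * H (f (iv ! \<alpha>) (jv ! \<alpha>) (iv ! (\<alpha> + 1)))
          = w (iv ! \<alpha>) (jv ! \<alpha>) (iv ! (\<alpha> + 1))"
          using blocks_range[OF iv, of \<alpha>] a by (intro Hf) auto
      qed
      finally show ?thesis .
    qed
    ultimately show "(\<Sum>(iv, jv)\<in>blocks a d. fps_X ^ d * (H (L iv jv) * H (R [1..<hd iv] tvar) *
        (\<Prod>\<alpha><length jv. H (f (iv ! \<alpha>) (jv ! \<alpha>) (iv ! (\<alpha> + 1))))))
      = ?F2 (map ?e [1..<a]) * subst ?F2 ?G2 ?ex2 ?F1 (map ?e [a..<d + 1])"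
      unfolding sum_distrib_left by (simp only: sum_distrib_left) (rule sum.cong, auto)
  qed
  also have "\<dots> = coproduct_value (map ?e [1..<d + 1])"
    unfolding coproduct_value_def conv_def by (subst splits_upt) simp_all
  finally show ?thesis by (simp add: H_def)
qed

lemma homogeneous_comul_series: "homogeneous_series {1..length ys} (comul_series ys)"
  unfolding comul_series_def Let_def
proof (intro homogeneous_series_sum, clarify)
  fix iv jv assume p: "(iv, jv) \<in> comul_indices (length ys)"
  define a where "a = hd iv"
  have iv: "(iv, jv) \<in> blocks a (length ys)" and a: "1 \<le> a"
    using p by (auto simp: comul_indices_def blocks_def a_def)
  have a': "a \<le> length ys + 1" using iv by (induction rule: blocks_induct) auto
  have range: "1 \<le> iv ! \<alpha> \<and> iv ! \<alpha> \<le> jv ! \<alpha> \<and> jv ! \<alpha> < iv ! (\<alpha> + 1) \<and> iv ! (\<alpha> + 1) \<le> length ys + 1"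
    if "\<alpha> < length jv" for \<alpha> using blocks_range[OF iv that] a by auto
  note hom = homogeneous_series_mult homogeneous_series_gen_series homogeneous_series_exp_series
    homogeneous_series_minus_one_power homogeneous_series_prod homogeneous_diff
  have jv: "j \<in> {1..length ys}" if "j \<in> set jv" for j
    using that range by (fastforce simp: in_set_conv_nth)
  have fac: "homogeneous_series {1..length ys} ((- 1) ^ (j - i) * exp_series c (tvar j) *
      gen_series c' (map (\<lambda>r. tvar j - tvar r) (rev [i..<j])) * gen_series c'' (map (\<lambda>r. tvar r - tvar j) [j + 1..<i']) :: symb_alg2 series)"
    if "1 \<le> i" "i \<le> j" "j < i'" "i' \<le> length ys + 1" for i j i' c c' c''
    using that by (intro hom) (auto intro!: homogeneous_diff homogeneous_tvar[unfolded One_nat_def])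
  show "homogeneous_series {1..length ys}
     (gen_series (\<lambda>ns. tensor (symb (map (\<lambda>\<alpha>. \<Sum>r = iv ! \<alpha>..<iv ! (\<alpha> + 1). ys ! (r - 1)) [0..<length jv]) ns) 1) (map tvar jv) *
      gen_series (\<lambda>ns. tensor 1 (symb (map (\<lambda>r. ys ! (r - 1)) [1..<hd iv]) ns)) (map tvar [1..<hd iv]) *
      (\<Prod>\<alpha><length jv. (- 1) ^ (jv ! \<alpha> - iv ! \<alpha>) *
         exp_series (tensor 1 (log_symb (\<Sum>r = iv ! \<alpha>..<iv ! (\<alpha> + 1). ys ! (r - 1)))) (tvar (jv ! \<alpha>)) *
         gen_series (\<lambda>ns. tensor 1 (symb (map (\<lambda>r. - ys ! (r - 1)) (rev [iv ! \<alpha>..<jv ! \<alpha>])) ns))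
          (map (\<lambda>r. tvar (jv ! \<alpha>) - tvar r) (rev [iv ! \<alpha>..<jv ! \<alpha>])) *
         gen_series (\<lambda>ns. tensor 1 (symb (map (\<lambda>r. ys ! (r - 1)) [jv ! \<alpha> + 1..<iv ! (\<alpha> + 1)]) ns))
          (map (\<lambda>r. tvar r - tvar (jv ! \<alpha>)) [jv ! \<alpha> + 1..<iv ! (\<alpha> + 1)])))"
  proof (rule homogeneous_series_mult[OF homogeneous_series_mult homogeneous_series_prod[OF fac]], goal_cases)
    case 1
    show ?case by (rule homogeneous_series_gen_series) (use jv in \<open>auto intro!: homogeneous_tvar[unfolded One_nat_def]\<close>)
  next
    case 2
    show ?case by (rule homogeneous_series_gen_series) (use a a' in \<open>auto simp: a_def intro!: homogeneous_tvar[unfolded One_nat_def]\<close>)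
  qed (use range in auto)
qed

text \<open>\<open>comul_gen\<close> reads off the coefficients of \<open>comul_series\<close>, and
  \<open>reg_series\<close> sums them up again; by \<open>homogeneous_series_value\<close> nothing
  is lost in between.\<close>

lemma inv_comul_reg_series:
  assumes "regular_word xs"
  shows "map_fps inv_comul (reg_series xs) = coproduct_value xs"
proof (cases "xs = []")
  case True
  then show ?thesis
    by (simp add: coproduct_value_def conv_Nil map_fps_simps algebra_map_inv_comul algebra_map_tensor_left
        algebra_map_tensor_right)
next
  case False
  define ys where "ys = map snd xs"
  define v where "v r = fst (xs ! (r - 1))" for r
  obtain k c where ch: "chain k ys c" "1 \<le> k" using assms by (auto simp: regular_word_chain ys_def)
  have len: "length ys = length xs" and ne: "ys \<noteq> []" using False by (simp_all add: ys_def)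
  have ts: "map fst xs = map v [1..<length ys + 1]"
    by (rule nth_equalityI) (simp_all add: v_def len del: upt_Suc)
  have xs: "xs = map (\<lambda>r. (v r, ys ! (r - 1))) [1..<length ys + 1]"
    by (rule nth_equalityI) (simp_all add: v_def len ys_def del: upt_Suc)
  have "inv_comul (symb ys ns) = inv_inv (tcoeff (texponent ns) (comul_series ys))" if "length ns = length ys" for ns
    using ne by (simp add: symb_def inv_comul_gen)
  then have "map_fps inv_comul (reg_series xs)
    = gen_value (\<lambda>ns. inv_inv (tcoeff (texponent ns) (comul_series ys))) (map v [1..<length ys + 1])"
    unfolding reg_series_def ts ys_def[symmetric]
    by (simp add: map_fps_gen_value algebra_map_inv_comul del: upt_Suc cong: gen_value_cong)
  also have "\<dots> = map_fps inv_inv (fps_X ^ length ys * series_value v (comul_series ys))"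
    by (simp only: homogeneous_series_value[OF homogeneous_comul_series] map_fps_gen_value algebra_map_inv_inv)
  also have "\<dots> = coproduct_value xs"
    unfolding xs by (subst comul_series_value[OF ch, symmetric])
      (simp add: map_fps_mult map_fps_power map_fps_simps algebra_map_inv_inv)
  finally show ?thesis .
qed

lemma inv_comul_log: "inv_comul (gen (Log i)) = tensor (gen (Log i)) 1 + tensor 1 (gen (Log i))"
  by (simp add: inv_comul_gen algebra_map_simps[OF algebra_map_inv_inv] inv_inv_tensor INV_gen
      algebra_map_simps[OF algebra_map_INV])

lemma inv_comul_log_symb: "inv_comul (log_symb y) = tensor (log_symb y) 1 + tensor 1 (log_symb y)"
proof -
  have of_int: "h (of_int n) = of_int n" if "algebra_map h" for h :: "symb_alg \<Rightarrow> symb_alg2" and n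
    using algebra_map_simps(9)[OF that, of "of_int n"] algebra_map_simps(5)[OF that]
    by (cases n) (simp_all add: scalar_simps scalar_of_nat)
  note maps = algebra_map_inv_comul algebra_map_tensor_left algebra_map_tensor_right
  show ?thesis
    by (simp add: log_symb_def algebra_map_simps[OF maps(1)] algebra_map_simps(6,8)[OF maps(2)]
        algebra_map_simps(6,8)[OF maps(3)] of_int[OF maps(1)] of_int[OF maps(2)] of_int[OF maps(3)]
        inv_comul_log distrib_left sum.distrib)
qed

section \<open>Transport along algebra maps\<close>

text \<open>\<open>algebra_map\<close> speaks of monoid algebras, whereas \<open>map_fps h\<close>
  is a map between power series rings over them.\<close>

definition ring_map :: "('r::comm_ring_1 \<Rightarrow> 's::comm_ring_1) \<Rightarrow> bool" where
  "ring_map h \<longleftrightarrow> h 0 = 0 \<and> h 1 = 1 \<and> (\<forall>a b. h (a + b) = h a + h b \<and> h (a * b) = h a * h b)"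

lemma ring_map_map_fps: "algebra_map h \<Longrightarrow> ring_map (map_fps h)"
  by (simp add: ring_map_def map_fps_simps map_fps_mult)

context
  fixes h :: "'r::comm_ring_1 \<Rightarrow> 's::comm_ring_1"
  assumes h: "ring_map h"
begin

lemma ring_map_diff: "h (a - b) = h a - h b"
proof -
  have "h (a - b) + h b = h a" using h unfolding ring_map_def by (metis diff_add_cancel)
  then show ?thesis by (simp add: algebra_simps)
qed

lemma ring_map_splits: "h (splits xs g) = splits xs (\<lambda>a b. h (g a b))"
  by (induction xs arbitrary: g) (use h in \<open>simp_all add: ring_map_def\<close>)

lemma ring_map_marks: "h (marks xs g) = marks xs (\<lambda>a x b. h (g a x b))"
  by (induction xs arbitrary: g) (use h in \<open>simp_all add: ring_map_def\<close>)

lemma ring_map_conv: "h (conv f g xs) = conv (\<lambda>w. h (f w)) (\<lambda>w. h (g w)) xs"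
  using h by (simp add: conv_def ring_map_splits ring_map_def)

lemma ring_map_contract_block: "h (contract_block F G ex c b)
    = contract_block (\<lambda>w. h (F w)) (\<lambda>w. h (G w)) (\<lambda>t y. h (ex t y)) (\<lambda>e. h (c e)) b"
  using h by (simp add: contract_block_def ring_map_marks ring_map_def)

lemma ring_map_subst: "h (subst F G ex f xs)
    = subst (\<lambda>w. h (F w)) (\<lambda>w. h (G w)) (\<lambda>t y. h (ex t y)) (\<lambda>w. h (f w)) xs"
proof (induction xs arbitrary: f rule: length_induct)
  case (1 xs)
  have zero: "h 0 = 0" and add: "h (a + b) = h a + h b" for a b using h by (simp_all add: ring_map_def)
  let ?S = "subst (\<lambda>w. h (F w)) (\<lambda>w. h (G w)) (\<lambda>t y. h (ex t y))"
  let ?K = "contract_block (\<lambda>w. h (F w)) (\<lambda>w. h (G w)) (\<lambda>t y. h (ex t y))"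
  have "h (contract_block F G ex (\<lambda>e. subst F G ex (\<lambda>w. f (e # w)) r) b) = ?K (\<lambda>e. ?S (\<lambda>w. h (f (e # w))) r) b"
    if br: "b @ r = xs" for b r
  proof (cases "b = []")
    case False
    then show ?thesis using 1 br by (auto simp: ring_map_contract_block)
  qed (simp add: zero)
  then have "splits xs (\<lambda>b r. h (contract_block F G ex (\<lambda>e. subst F G ex (\<lambda>w. f (e # w)) r) b))
    = splits xs (\<lambda>b r. ?K (\<lambda>e. ?S (\<lambda>w. h (f (e # w))) r) b)"
    by (rule splits_cong[OF refl])
  then show ?case
    unfolding subst_unfold[of F G ex f xs] subst_unfold[of _ _ _ "\<lambda>w. h (f w)" xs] add ring_map_splits
    by (simp add: zero)
qed

lemma ring_map_unit_word: "h (unit_word w) = unit_word w"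
  using h by (simp add: unit_word_def ring_map_def)

lemma ring_map_single_edge: "h (single_edge c w) = single_edge (\<lambda>e. h (c e)) w"
  using h by (cases w rule: remdups_adj.cases) (simp_all add: ring_map_def)

lemma ring_map_additive_exp: "additive_exp ex \<Longrightarrow> additive_exp (\<lambda>t y. h (ex t y))"
  using h by (simp add: additive_exp_def ring_map_def)

end

text \<open>\<open>reg_at\<close>, \<open>inv_at\<close> and \<open>exp_at\<close> are the data
  \<open>F\<close>, \<open>G\<close> and the exponential seen through an algebra map
  \<open>h\<close>. This functor-of-points view turns identities in tensor powers into identities
  between compositions of data.\<close>

abbreviation reg_at :: "(symb_alg \<Rightarrow> 'm::comm_monoid_add \<Rightarrow>\<^sub>0 rat) \<Rightarrow> laurent_monomial word \<Rightarrow> ('m \<Rightarrow>\<^sub>0 rat) fps" where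
  "reg_at h xs \<equiv> map_fps h (reg_series xs)"

abbreviation inv_at :: "(symb_alg \<Rightarrow> 'm::comm_monoid_add \<Rightarrow>\<^sub>0 rat) \<Rightarrow> laurent_monomial word \<Rightarrow> ('m \<Rightarrow>\<^sub>0 rat) fps" where
  "inv_at h xs \<equiv> map_fps h (inv_series xs)"

abbreviation exp_at :: "(symb_alg \<Rightarrow> 'm::comm_monoid_add \<Rightarrow>\<^sub>0 rat) \<Rightarrow> rat \<Rightarrow> laurent_monomial \<Rightarrow> ('m \<Rightarrow>\<^sub>0 rat) fps" where
  "exp_at h t y \<equiv> map_fps h (exp_log t y)"

abbreviation subst_at :: "(symb_alg \<Rightarrow> 'm::comm_monoid_add \<Rightarrow>\<^sub>0 rat) \<Rightarrow> (laurent_monomial word \<Rightarrow> ('m \<Rightarrow>\<^sub>0 rat) fps)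
    \<Rightarrow> laurent_monomial word \<Rightarrow> ('m \<Rightarrow>\<^sub>0 rat) fps" where
  "subst_at h \<equiv> subst (reg_at h) (inv_at h) (exp_at h)"

lemma inversion_relation_at:
  assumes h: "algebra_map h"
  shows "regular_words.inversion_relation inverse_label (reg_at h) (inv_at h) (exp_at h)"
  unfolding regular_words.inversion_relation_def
proof (intro conjI allI impI)
  note r = ring_map_map_fps[OF h]
  show "reg_at h [] = 1" "inv_at h [] = 1" by (simp_all add: map_fps_simps h)
  show "additive_exp (exp_at h)" by (rule ring_map_additive_exp[OF r additive_exp_log])
  fix xs assume "regular_word xs"
  then have "conv inv_series (conv (\<lambda>w. unit_word w - single_edge inverse_label w) reg_series) xs
    = unit_word xs - contract_block reg_series inv_series exp_log inverse_label xs"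
    using inversion_relation_symb by (simp add: regular_words.inversion_relation_def)
  moreover have "map_fps h (inverse_label e) = inverse_label e" for e :: "rat \<times> laurent_monomial"
    by (simp add: inverse_label_def map_fps_simps h)
  ultimately show "conv (inv_at h) (conv (\<lambda>w. unit_word w - single_edge inverse_label w) (reg_at h)) xs
    = unit_word xs - contract_block (reg_at h) (inv_at h) (exp_at h) inverse_label xs"
    using ring_map_conv[OF r, of inv_series "conv (\<lambda>w. unit_word w - single_edge inverse_label w) reg_series" xs]
    by (simp add: ring_map_conv[OF r] ring_map_diff[OF r] ring_map_unit_word[OF r] ring_map_single_edge[OF r]
        ring_map_contract_block[OF r])
qed

text \<open>Composing with the coproduct composes the data of the two restrictions of
  \<open>A\<close>; the restriction to the right factor acts by substitution.\<close>

lemma reg_at_comul: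
  assumes A: "algebra_map A" and xs: "regular_word xs"
  shows "reg_at (\<lambda>a. A (inv_comul a)) xs
    = conv (reg_at (\<lambda>a. A (tensor 1 a))) (subst_at (\<lambda>a. A (tensor 1 a)) (reg_at (\<lambda>a. A (tensor a 1)))) xs"
proof -
  have "reg_at (\<lambda>a. A (inv_comul a)) xs = map_fps A (coproduct_value xs)"
    by (simp add: map_fps_map_fps flip: inv_comul_reg_series[OF xs])
  then show ?thesis
    by (simp add: coproduct_value_def ring_map_conv ring_map_subst ring_map_map_fps A map_fps_map_fps)
qed

lemma exp_at_comul:
  assumes A: "algebra_map A"
  shows "exp_at (\<lambda>a. A (inv_comul a)) t y = exp_at (\<lambda>a. A (tensor 1 a)) t y * exp_at (\<lambda>a. A (tensor a 1)) t y"
  using algebra_map_compose[OF A algebra_map_inv_comul] algebra_map_compose[OF A algebra_map_tensor_left]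
    algebra_map_compose[OF A algebra_map_tensor_right]
  by (simp add: exp_log_def map_fps_exps algebra_map_simps(3)[OF algebra_map_inv_comul] inv_comul_log_symb
      algebra_map_simps(1,3)[OF A] tensor_smult_left tensor_smult_right pm.scale_right_distrib exps_add mult.commute)

text \<open>The data of \<open>A\<close> after the coproduct are the composed ones: for
  \<open>F\<close> by \<open>reg_at_comul\<close>, and for \<open>G\<close> by uniqueness, since
  both candidates satisfy the inversion relation with the same \<open>F\<close>. Then
  \<open>subst_subst\<close> applies.\<close>

lemma subst_at_comul:
  assumes A: "algebra_map A" and xs: "regular_word xs"
  shows "subst_at (\<lambda>a. A (inv_comul a)) f xs
    = subst_at (\<lambda>a. A (tensor 1 a)) (subst_at (\<lambda>a. A (tensor a 1)) f) xs"
proof -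
  let ?B = "\<lambda>a. A (inv_comul a)" and ?A1 = "\<lambda>a. A (tensor a 1)" and ?A2 = "\<lambda>a. A (tensor 1 a)"
  note maps = algebra_map_compose[OF A algebra_map_inv_comul] algebra_map_compose[OF A algebra_map_tensor_left]
    algebra_map_compose[OF A algebra_map_tensor_right]
  note rel = inversion_relation_at[OF maps(1)] inversion_relation_at[OF maps(2)] inversion_relation_at[OF maps(3)]
  have ex: "additive_exp (exp_at ?A1)" "additive_exp (exp_at ?A2)"
    using rel by (simp_all add: regular_words.inversion_relation_def)
  have inv: "inv_at ?B w = conv (subst_at ?A2 (inv_at ?A1)) (inv_at ?A2) w" if "regular_word w" for w
    by (rule regular_words.inversion_relation_unique[OF rel(1) regular_words.inversion_relation_compose[OF rel(2,3)]])
      (use that reg_at_comul[OF A] exp_at_comul[OF A] in simp_all)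
  have "subst_at ?B f xs = subst (conv (reg_at ?A2) (subst_at ?A2 (reg_at ?A1)))
      (conv (subst_at ?A2 (inv_at ?A1)) (inv_at ?A2)) (\<lambda>t y. exp_at ?A2 t y * exp_at ?A1 t y) f xs"
    by (rule regular_words.subst_adm_cong_data[OF xs]) (simp_all add: reg_at_comul[OF A] exp_at_comul[OF A] inv)
  then show ?thesis by (simp add: subst_subst[OF ex])
qed

section \<open>Maps on regular symbols\<close>

lemma gen_in_H_symb: "g \<in> regular_generators \<Longrightarrow> gen g \<in> H_symb"
  unfolding H_symb_def by (rule hull_inc) simp

lemma subalgebra_H_symb: "subalgebra H_symb"
  unfolding H_symb_def by (rule subalgebra_generated)

text \<open>Algebra maps agree on a subalgebra, so generators suffice, and
  \<open>gen_value_eqD\<close> recovers the values at symbols from those of the series at regular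
  words.\<close>

lemma algebra_map_eq_on_H:
  assumes f: "algebra_map f" and g: "algebra_map g"
    and log: "\<And>i. 1 \<le> i \<Longrightarrow> f (gen (Log i)) = g (gen (Log i))"
    and reg: "\<And>xs. regular_word xs \<Longrightarrow> reg_at f xs = reg_at g xs"
    and a: "a \<in> H_symb"
  shows "f a = g a"
proof -
  have sym: "f (gen (Sym ys ns)) = g (gen (Sym ys ns))" if "regular ys" "index_for ys ns" for ys ns
  proof -
    have "f (symb ys ns) = g (symb ys ns)"
    proof (rule gen_value_eqD[where d = "length ys"])
      fix qs :: "rat list" assume qs: "length qs = length ys" "distinct (0 # qs)"
      then have "regular_word (zip qs ys)" using that by (simp add: regular_word_def)
      from reg[OF this] show "gen_value (\<lambda>ns. f (symb ys ns)) qs = gen_value (\<lambda>ns. g (symb ys ns)) qs"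
        using qs by (simp add: reg_series_def map_fps_gen_value f g)
    qed (use that in \<open>auto simp: index_for_def\<close>)
    then show ?thesis using that by (simp add: symb_def regular_def)
  qed
  have "subalgebra {a. f a = g a}"
    unfolding subalgebra_def pm.subspace_def by (simp add: algebra_map_simps f g)
  moreover have "gen ` regular_generators \<subseteq> {a. f a = g a}"
    using log sym by (auto simp: regular_generators_def)
  ultimately have "H_symb \<subseteq> {a. f a = g a}"
    unfolding H_symb_def by (rule hull_minimal[rotated])
  then show ?thesis using a by blast
qed

lemma coassociative_inv_comul: "coassociative_on H_symb inv_comul"
  unfolding coassociative_on_def
proof
  fix a assume a: "a \<in> H_symb"
  let ?P = "\<lambda>u. tensor_assoc (tensor_map inv_comul (id :: symb_alg \<Rightarrow> symb_alg) u)"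
    and ?Q = "tensor_map (id :: symb_alg \<Rightarrow> symb_alg) inv_comul"
  let ?A = "\<lambda>u. tensor_assoc (tensor u (1 :: symb_alg))" and ?B = "tensor (1 :: symb_alg)"
  have id: "algebra_map (id :: symb_alg \<Rightarrow> symb_alg)" unfolding id_def by (rule algebra_map_id)
  have lin: "linear_map inv_comul" "linear_map (id :: symb_alg \<Rightarrow> symb_alg)"
    using id algebra_map_inv_comul by (simp_all add: algebra_map_def)
  have P: "algebra_map ?P"
    by (intro algebra_map_compose[OF algebra_map_tensor_assoc] algebra_map_tensor_map algebra_map_inv_comul id)
  have Q: "algebra_map ?Q" by (intro algebra_map_tensor_map algebra_map_inv_comul id)
  have A: "algebra_map ?A" by (intro algebra_map_compose[OF algebra_map_tensor_assoc] algebra_map_tensor_left)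
  have B: "algebra_map ?B" by (rule algebra_map_tensor_right)
  have one: "inv_comul 1 = 1" by (rule algebra_map_simps(7)[OF algebra_map_inv_comul])
  have A': "?A (tensor x 1) = tensor x 1" "?A (tensor 1 x) = tensor 1 (tensor x 1)" for x
    by (simp_all add: tensor_assoc_tensor tensor_one)
  have P': "?P (tensor x 1) = ?A (inv_comul x)" "?P (tensor 1 x) = tensor 1 (tensor 1 x)" for x
  proof -
    show "?P (tensor x 1) = ?A (inv_comul x)" by (simp add: tensor_map_tensor[OF lin])
    show "?P (tensor 1 x) = tensor 1 (tensor 1 x)"
      by (simp add: tensor_map_tensor[OF lin] one tensor_assoc_tensor flip: tensor_one)
  qed
  have Q': "?Q (tensor x 1) = tensor x 1" "?Q (tensor 1 x) = ?B (inv_comul x)" for x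
    by (simp_all add: tensor_map_tensor[OF lin(2,1)] one)
  have "?P (inv_comul a) = ?Q (inv_comul a)"
  proof (rule algebra_map_eq_on_H[OF _ _ _ _ a])
    show "algebra_map (\<lambda>a. ?P (inv_comul a))" "algebra_map (\<lambda>a. ?Q (inv_comul a))"
      by (rule algebra_map_compose[OF P algebra_map_inv_comul] algebra_map_compose[OF Q algebra_map_inv_comul])+
    fix i
    show "?P (inv_comul (gen (Log i))) = ?Q (inv_comul (gen (Log i)))"
      unfolding inv_comul_log algebra_map_simps(1)[OF P] algebra_map_simps(1)[OF Q] P' Q'
      unfolding inv_comul_log algebra_map_simps(1)[OF A] algebra_map_simps(1)[OF B] A'
      by (simp add: add.assoc)
  next
    fix xs assume xs: "regular_word xs"
    \<comment> \<open>The three inclusions into the threefold tensor product. Both sides turn out to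
      be the composite of their data.\<close>
    let ?j1 = "\<lambda>a :: symb_alg. tensor a (1 :: symb_alg2)"
      and ?j2 = "\<lambda>a :: symb_alg. tensor (1 :: symb_alg) (tensor a (1 :: symb_alg))"
      and ?j3 = "\<lambda>a :: symb_alg. tensor (1 :: symb_alg) (tensor (1 :: symb_alg) a)"
    let ?S2 = "subst_at ?j2" and ?S3 = "subst_at ?j3"
    have "reg_at (\<lambda>a. ?P (inv_comul a)) xs = conv (reg_at ?j3) (?S3 (reg_at (\<lambda>a. ?A (inv_comul a)))) xs"
      unfolding reg_at_comul[OF P xs] P' ..
    \<comment> \<open>The second coproduct sits in the left factor, whose data enter only through
      \<open>F\<close>.\<close>
    also have "\<dots> = conv (reg_at ?j3) (?S3 (conv (reg_at ?j2) (?S2 (reg_at ?j1)))) xs"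
      by (intro regular_words.conv_adm_cong[OF xs] regular_words.subst_adm_cong refl)
        (simp_all only: reg_at_comul[OF A] A')
    finally have 1: "reg_at (\<lambda>a. ?P (inv_comul a)) xs
      = conv (reg_at ?j3) (?S3 (conv (reg_at ?j2) (?S2 (reg_at ?j1)))) xs" .
    have "reg_at (\<lambda>a. ?Q (inv_comul a)) xs
      = conv (reg_at (\<lambda>a. ?B (inv_comul a))) (subst_at (\<lambda>a. ?B (inv_comul a)) (reg_at ?j1)) xs"
      unfolding reg_at_comul[OF Q xs] Q' ..
    \<comment> \<open>Here it sits in the right factor, which acts by substitution and thus involves
      \<open>G\<close>; this is where inversion has to be compatible with composition.\<close>
    also have "\<dots> = conv (conv (reg_at ?j3) (?S3 (reg_at ?j2))) (?S3 (?S2 (reg_at ?j1))) xs"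
      by (rule regular_words.conv_adm_cong[OF xs]) (simp_all only: reg_at_comul[OF B] subst_at_comul[OF B])
    also have "\<dots> = reg_at (\<lambda>a. ?P (inv_comul a)) xs"
      unfolding 1 by (simp only: subst_conv conv_assoc)
    finally show "reg_at (\<lambda>a. ?P (inv_comul a)) xs = reg_at (\<lambda>a. ?Q (inv_comul a)) xs" ..
  qed
  then show "tensor_assoc (tensor_map inv_comul id (inv_comul a)) = tensor_map id inv_comul (inv_comul a)" .
qed

section \<open>The counit\<close>

text \<open>The counit followed by the unit, as an endomorphism of the algebra to which
  \<open>reg_at\<close> and \<open>subst_at\<close> apply.\<close>

definition counit_map :: "symb_alg \<Rightarrow> symb_alg" where
  "counit_map = alg_hom (\<lambda>g. 0)"

lemma algebra_map_counit: "algebra_map counit_map"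
  unfolding counit_map_def by (rule algebra_map_alg_hom)

lemma counit_map_eq: "counit_map a = scalar (symb_counit a)"
proof -
  have "(\<Prod>g\<in>keys m. 0 ^ lookup m g) = (if m = 0 then 1 else 0 :: symb_alg)" for m :: monomial
  proof (cases "m = 0")
    case False
    then obtain g where "g \<in> keys m" using keys_eq_empty[of m] by blast
    then show ?thesis using False by (auto simp: in_keys_iff power_0_left intro!: prod_zero bexI[of _ g])
  qed simp
  then have "counit_map a = (\<Sum>m\<in>keys a. if m = 0 then smult (lookup a m) 1 else 0)"
    unfolding counit_map_def alg_hom_def by (intro sum.cong) auto
  also have "\<dots> = smult (lookup a 0) 1" by (auto simp: sum.delta' in_keys_iff)
  finally show ?thesis by (simp add: smult_scalar symb_counit_def)
qed

lemma counit_map_gen: "counit_map (gen g) = 0"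
  by (simp only: counit_map_def gen_def alg_hom_generator)

lemma scalar_inject: "scalar a = scalar b \<longleftrightarrow> a = b"
  by (metis lookup_single_eq scalar_def)

lemma reg_at_counit: "reg_at counit_map xs = unit_word xs"
proof (cases "xs = []")
  case True
  then show ?thesis by (simp add: unit_word_def map_fps_simps algebra_map_counit)
next
  case False
  then have "counit_map (symb (map snd xs) ns) = 0" for ns by (simp add: symb_def counit_map_gen)
  then show ?thesis using False
    unfolding reg_series_def map_fps_gen_value[OF algebra_map_counit]
    by (simp add: unit_word_def gen_value_def fps_eq_iff)
qed

lemma exp_at_counit: "exp_at counit_map t y = 1"
  by (simp add: exp_log_def map_fps_exps algebra_map_counit algebra_map_simps[OF algebra_map_counit]
      log_symb_def counit_map_gen exps_zero)

text \<open>With trivial data a block has weight 0 unless it consists of the marked letter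
  alone.\<close>

lemma contract_block_unit: "contract_block unit_word unit_word (\<lambda>t y. 1) c = single_edge c"
proof
  fix xs
  have "contract_block unit_word unit_word (\<lambda>t y. 1) c xs = marks xs (\<lambda>a x b. unit_word a * c x * unit_word b)"
    unfolding contract_block_def by (rule marks_cong) (auto simp: unit_word_def)
  also have "\<dots> = single_edge c xs"
    by (simp add: conv_unit_left conv_unit_right flip: conv_single_edge)
  finally show "contract_block unit_word unit_word (\<lambda>t y. 1) c xs = single_edge c xs" .
qed

lemma subst_unit_data: "subst unit_word unit_word (\<lambda>t y. 1) f xs = f xs"
proof (induction xs arbitrary: f)
  case (Cons x xs)
  then show ?case
    by (subst subst_unfold) (simp add: contract_block_unit splits_single_edge del: splits.simps)
qed simp

text \<open>The trivial data satisfy the inversion relation, so by uniqueness the counit makes the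
  series of inverted symbols trivial as well.\<close>

lemma subst_at_counit:
  assumes "regular_word xs"
  shows "subst_at counit_map f xs = f xs"
proof -
  have "regular_words.inversion_relation inverse_label (unit_word :: _ \<Rightarrow> symb_alg fps) unit_word (\<lambda>t y. 1)"
    unfolding regular_words.inversion_relation_def
    by (simp add: conv_unit_left conv_unit_right contract_block_unit additive_exp_def) (simp add: unit_word_def)
  then have "inv_at counit_map w = unit_word w" if "regular_word w" for w
    by (rule regular_words.inversion_relation_unique[OF inversion_relation_at[OF algebra_map_counit]])
      (simp_all add: that reg_at_counit exp_at_counit)
  then have "subst_at counit_map f xs = subst unit_word unit_word (\<lambda>t y. 1) f xs"
    by (intro regular_words.subst_adm_cong_data[OF assms]) (simp_all add: reg_at_counit exp_at_counit)
  then show ?thesis by (simp add: subst_unit_data)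
qed

lemma symb_counit_simps: "symb_counit (a + b) = symb_counit a + symb_counit b"
  "symb_counit (smult c a) = c * symb_counit a"
  by (simp_all add: symb_counit_def lookup_add lookup_smult)

text \<open>With the counit on the left factor the function to be substituted becomes the unit,
  which substitutions preserve; with the counit on the right factor the substitution becomes the
  identity.\<close>

lemma counit_lift:
  assumes a: "a \<in> H_symb"
  shows "tensor_lift (\<lambda>b c. smult (symb_counit b) c) (inv_comul a) = a"
    and "tensor_lift (\<lambda>b c. smult (symb_counit c) b) (inv_comul a) = a"
proof -
  let ?L = "tensor_lift (\<lambda>b c. smult (symb_counit b) c) :: symb_alg2 \<Rightarrow> symb_alg"
  let ?R = "tensor_lift (\<lambda>b c. smult (symb_counit c) b) :: symb_alg2 \<Rightarrow> symb_alg"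
  have counit: "smult (symb_counit b) c = counit_map b * c" for b c
    by (simp add: smult_scalar counit_map_eq)
  have L': "?L (tensor b c) = counit_map b * c" for b c
    unfolding counit by (subst tensor_lift_tensor)
      (auto intro!: linear_mapI simp: algebra_map_simps[OF algebra_map_counit] distrib_left distrib_right
        smult_mult_left smult_mult_right)
  have R': "?R (tensor b c) = b * counit_map c" for b c
    unfolding counit by (subst tensor_lift_tensor)
      (auto intro!: linear_mapI simp: algebra_map_simps[OF algebra_map_counit] distrib_left distrib_right
        smult_mult_left smult_mult_right mult.commute)
  have one: "counit_map 1 = 1" by (rule algebra_map_simps(7)[OF algebra_map_counit])
  have L: "algebra_map ?L"
    by (rule algebra_map_tensorI)
      (simp_all add: linear_tensor_lift tensor_mult L' one algebra_map_simps[OF algebra_map_counit] mult_ac flip: tensor_one)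
  have R: "algebra_map ?R"
    by (rule algebra_map_tensorI)
      (simp_all add: linear_tensor_lift tensor_mult R' one algebra_map_simps[OF algebra_map_counit] mult_ac flip: tensor_one)
  have idf: "map_fps (\<lambda>a. a) F = F" for F :: "symb_alg fps" by (simp add: fps_eq_iff)
  have log: "?L (inv_comul (gen (Log i))) = gen (Log i)" "?R (inv_comul (gen (Log i))) = gen (Log i)" for i
    unfolding inv_comul_log algebra_map_simps(1)[OF L] algebra_map_simps(1)[OF R] L' R'
    by (simp_all add: one counit_map_gen)
  show "?L (inv_comul a) = a"
  proof (rule algebra_map_eq_on_H[OF _ algebra_map_id _ _ a, of "\<lambda>a. ?L (inv_comul a)"])
    fix xs assume xs: "regular_word xs"
    have c: "reg_at counit_map = unit_word" by (rule ext) (rule reg_at_counit)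
    show "reg_at (\<lambda>a. ?L (inv_comul a)) xs = reg_at (\<lambda>a. a) xs"
      unfolding reg_at_comul[OF L xs] L' one mult_1_left mult_1_right c idf subst_unit conv_unit_right ..
  qed (simp_all add: log algebra_map_compose[OF L algebra_map_inv_comul])
  show "?R (inv_comul a) = a"
  proof (rule algebra_map_eq_on_H[OF _ algebra_map_id _ _ a, of "\<lambda>a. ?R (inv_comul a)"])
    fix xs assume xs: "regular_word xs"
    have c: "reg_at counit_map = unit_word" by (rule ext) (rule reg_at_counit)
    have "conv (reg_at counit_map) (subst_at counit_map (reg_at (\<lambda>a. a))) xs = conv unit_word (reg_at (\<lambda>a. a)) xs"
      by (rule regular_words.conv_adm_cong[OF xs]) (rule reg_at_counit, rule subst_at_counit)
    then show "reg_at (\<lambda>a. ?R (inv_comul a)) xs = reg_at (\<lambda>a. a) xs"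
      unfolding reg_at_comul[OF R xs] R' one mult_1_left mult_1_right conv_unit_left .
  qed (simp_all add: log algebra_map_compose[OF R algebra_map_inv_comul])
qed

section \<open>The grading\<close>

lemma poly_mapping_sum_single_nat: "(m :: 'a \<Rightarrow>\<^sub>0 nat) = (\<Sum>g\<in>keys m. single g (lookup m g))"
  by (rule poly_mapping_eqI) (simp add: lookup_sum lookup_single when_def in_keys_iff sum.delta)

lemma gen_power: "gen g ^ n = single (single g n) 1"
proof (induction n)
  case (Suc n)
  then show ?case by (simp add: gen_def mult_single flip: single_add)
qed simp

lemma single_eq_prod_gen: "(single m 1 :: symb_alg) = (\<Prod>g\<in>keys m. gen g ^ lookup m g)"
proof -
  have "(\<Prod>g\<in>A. gen g ^ lookup m g) = single (\<Sum>g\<in>A. single g (lookup m g)) 1" if "finite A" for A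
    using that by (induction A) (simp_all add: gen_power mult_single)
  then show ?thesis using poly_mapping_sum_single_nat[of m] by simp
qed

lemma subalgebra_sum: "subalgebra B \<Longrightarrow> (\<And>x. x \<in> A \<Longrightarrow> f x \<in> B) \<Longrightarrow> sum f A \<in> B"
  unfolding subalgebra_def by (blast intro: pm.subspace_sum)

lemma subalgebra_power: "subalgebra B \<Longrightarrow> a \<in> B \<Longrightarrow> a ^ n \<in> B"
  by (induction n) (auto simp: subalgebra_def)

lemma subalgebra_prod: "subalgebra B \<Longrightarrow> (\<And>x. x \<in> A \<Longrightarrow> f x \<in> B) \<Longrightarrow> prod f A \<in> B"
  by (induction A rule: infinite_finite_induct) (auto simp: subalgebra_def)

lemma single_in_H_symb: "keys m \<subseteq> regular_generators \<Longrightarrow> single m 1 \<in> H_symb"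
  unfolding single_eq_prod_gen
  by (intro subalgebra_prod[OF subalgebra_H_symb] subalgebra_power[OF subalgebra_H_symb] gen_in_H_symb) auto

lemma H_symb_iff: "a \<in> H_symb \<longleftrightarrow> (\<forall>m\<in>keys a. keys m \<subseteq> regular_generators)"
proof
  assume *: "\<forall>m\<in>keys a. keys m \<subseteq> regular_generators"
  have "(\<Sum>m\<in>keys a. smult (lookup a m) (single m 1)) \<in> H_symb"
    by (rule subalgebra_sum[OF subalgebra_H_symb])
      (use * subalgebra_H_symb in \<open>auto simp: subalgebra_def intro!: pm.subspace_scale single_in_H_symb\<close>)
  then show "a \<in> H_symb" using poly_mapping_expand[of a] by simp
qed (use H_symb_keys in blast)

definition regular_monomials :: "nat \<Rightarrow> monomial set" where
  "regular_monomials n = {m. keys m \<subseteq> regular_generators \<and> weight m = n}"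

definition regular_monomial_pairs :: "nat \<Rightarrow> (monomial \<times> monomial) set" where
  "regular_monomial_pairs n = {(m, m'). keys m \<subseteq> regular_generators \<and> keys m' \<subseteq> regular_generators
     \<and> weight m + weight m' = n}"

lemma H_symb_gr_iff: "a \<in> H_symb_gr n \<longleftrightarrow> keys a \<subseteq> regular_monomials n"
  by (auto simp: H_symb_gr_def H_symb_iff regular_monomials_def)

lemma weight_superset:
  "finite A \<Longrightarrow> keys m \<subseteq> A \<Longrightarrow> weight m = (\<Sum>g\<in>A. lookup m g * gen_weight g)"
  unfolding weight_def by (rule sum.mono_neutral_left) (auto simp: in_keys_iff)

lemma weight_add: "weight (m + m') = weight m + weight m'"
  using keys_add[of m m']
  by (simp add: weight_superset[of "keys m \<union> keys m'"] lookup_add distrib_right sum.distrib)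

lemma weight_zero [simp]: "weight 0 = 0"
  by (simp add: weight_def)

text \<open>Connectedness of the grading, in terms of monomials.\<close>

lemma weight_eq_0: "keys m \<subseteq> regular_generators \<Longrightarrow> weight m = 0 \<Longrightarrow> m = 0"
proof -
  assume m: "keys m \<subseteq> regular_generators" "weight m = 0"
  then have "single m 1 \<in> H_symb_gr 0" by (simp add: H_symb_gr_iff regular_monomials_def)
  then obtain c where "single m 1 = smult c 1" by (auto simp: H_symb_gr_0)
  from arg_cong[OF this, of "\<lambda>a. lookup a m"] show "m = 0"
    by (auto simp: lookup_smult lookup_one when_def split: if_splits)
qed

text \<open>A common frame for \<open>H_symb\<close> and its tensor square, whose graded parts are
  spanned by monomials and by pairs of monomials.\<close>

definition monomial_grading :: "(nat \<Rightarrow> 'm::comm_monoid_add set) \<Rightarrow> bool" where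
  "monomial_grading M \<longleftrightarrow> 0 \<in> M 0 \<and> (\<forall>i j a b. a \<in> M i \<longrightarrow> b \<in> M j \<longrightarrow> a + b \<in> M (i + j))"

text \<open>The degree of the series is the weight; this is the purpose of the degree convention in
  \<open>gen_value\<close>.\<close>

definition graded_series :: "(nat \<Rightarrow> 'm::comm_monoid_add set) \<Rightarrow> ('m \<Rightarrow>\<^sub>0 rat) fps \<Rightarrow> bool" where
  "graded_series M F \<longleftrightarrow> (\<forall>k. keys (fps_nth F k) \<subseteq> M k)"

lemma monomial_grading_regular: "monomial_grading regular_monomials"
proof -
  have "keys (a + b) \<subseteq> regular_generators" if "keys a \<subseteq> regular_generators" "keys b \<subseteq> regular_generators" for a b :: monomial
    using keys_add[of a b] that by blast
  then show ?thesis by (simp add: monomial_grading_def regular_monomials_def weight_add)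
qed

lemma monomial_grading_pairs: "monomial_grading regular_monomial_pairs"
proof -
  have "keys (a + b) \<subseteq> regular_generators" if "keys a \<subseteq> regular_generators" "keys b \<subseteq> regular_generators" for a b :: monomial
    using keys_add[of a b] that by blast
  then show ?thesis by (auto simp: monomial_grading_def regular_monomial_pairs_def weight_add zero_prod_def)
qed

lemma keys_smult: "keys (smult c a) \<subseteq> keys a"
  by (auto simp: in_keys_iff lookup_smult)

lemma keys_mult_scalar: "keys (a * scalar c) \<subseteq> keys a"
  by (auto simp: in_keys_iff lookup_mult_scalar)

lemma keys_sum_subset: "(\<And>x. x \<in> A \<Longrightarrow> keys (f x) \<subseteq> M) \<Longrightarrow> keys (sum f A) \<subseteq> M"
proof (induction A rule: infinite_finite_induct)
  case (insert x A)
  then show ?case using keys_add[of "f x" "sum f A"] by fastforce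
qed simp_all

lemma keys_mult_graded:
  "monomial_grading M \<Longrightarrow> keys a \<subseteq> M i \<Longrightarrow> keys b \<subseteq> M j \<Longrightarrow> keys (a * b) \<subseteq> M (i + j)"
  using keys_mult[of a b] by (fastforce simp: monomial_grading_def)

lemma keys_power_graded: "monomial_grading M \<Longrightarrow> keys a \<subseteq> M i \<Longrightarrow> keys (a ^ n) \<subseteq> M (n * i)"
proof (induction n)
  case (Suc n)
  then show ?case using keys_mult_graded[of M a i "a ^ n" "n * i"] by simp
qed (auto simp: monomial_grading_def lookup_one in_keys_iff when_def split: if_splits)

lemma keys_prod_graded:
  "monomial_grading M \<Longrightarrow> (\<And>x. x \<in> A \<Longrightarrow> keys (f x) \<subseteq> M (d x)) \<Longrightarrow> keys (prod f A) \<subseteq> M (sum d A)"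
proof (induction A rule: infinite_finite_induct)
  case (insert x A)
  then show ?case using keys_mult_graded[of M "f x" "d x" "prod f A" "sum d A"] by simp
qed (auto simp: monomial_grading_def lookup_one in_keys_iff when_def split: if_splits)

context
  fixes M :: "nat \<Rightarrow> 'm::comm_monoid_add set"
  assumes M: "monomial_grading M"
begin

lemma graded_series_zero: "graded_series M 0"
  by (simp add: graded_series_def)

lemma graded_series_const: "graded_series M (fps_const (scalar c))"
  using M by (auto simp: graded_series_def scalar_def monomial_grading_def split: if_splits)

lemma graded_series_one: "graded_series M 1"
  using graded_series_const[of 1] by (simp add: scalar_simps)

lemma graded_series_add: "graded_series M F \<Longrightarrow> graded_series M G \<Longrightarrow> graded_series M (F + G)"
  using keys_add unfolding graded_series_def by fastforce

lemma graded_series_uminus: "graded_series M F \<Longrightarrow> graded_series M (- F)"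
  by (simp add: graded_series_def)

lemma graded_series_diff: "graded_series M F \<Longrightarrow> graded_series M G \<Longrightarrow> graded_series M (F - G)"
  using graded_series_add[of F "- G"] graded_series_uminus[of G] by simp

lemma graded_series_mult: "graded_series M F \<Longrightarrow> graded_series M G \<Longrightarrow> graded_series M (F * G)"
  unfolding graded_series_def fps_mult_nth
proof (intro allI keys_sum_subset)
  fix k i :: nat assume "\<forall>k. keys (fps_nth F k) \<subseteq> M k" "\<forall>k. keys (fps_nth G k) \<subseteq> M k" "i \<in> {0..k}"
  then show "keys (fps_nth F i * fps_nth G (k - i)) \<subseteq> M k"
    using keys_mult_graded[OF M, of "fps_nth F i" i "fps_nth G (k - i)" "k - i"] by auto
qed

lemma graded_series_splits:
  "(\<And>a b. a @ b = xs \<Longrightarrow> graded_series M (g a b)) \<Longrightarrow> graded_series M (splits xs g)"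
proof (induction xs arbitrary: g)
  case (Cons x xs)
  have "graded_series M (splits xs (\<lambda>a. g (x # a)))" by (rule Cons.IH) (simp add: Cons.prems)
  then show ?case using Cons.prems[of "[]" "x # xs"] by (simp add: graded_series_add)
qed simp

lemma graded_series_marks:
  "(\<And>a x b. a @ x # b = xs \<Longrightarrow> graded_series M (g a x b)) \<Longrightarrow> graded_series M (marks xs g)"
proof (induction xs arbitrary: g)
  case (Cons x xs)
  have "graded_series M (marks xs (\<lambda>a. g (x # a)))" by (rule Cons.IH) (simp add: Cons.prems)
  then show ?case using Cons.prems[of "[]" x xs] by (simp add: graded_series_add)
qed (simp add: graded_series_zero)

lemma graded_series_exps: "keys a \<subseteq> M 1 \<Longrightarrow> graded_series M (exps a)"
  unfolding graded_series_def exps_def fps_nth_Abs_fps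
  using keys_power_graded[OF M, of a 1] keys_smult by fastforce

lemma graded_series_gen_value:
  "(\<And>ns. length ns = length qs \<Longrightarrow> \<forall>n\<in>set ns. 1 \<le> n \<Longrightarrow> keys (c ns) \<subseteq> M (sum_list ns)) \<Longrightarrow>
    graded_series M (gen_value c qs)"
  unfolding graded_series_def gen_value_def fps_nth_Abs_fps
  by (intro allI keys_sum_subset) (use keys_mult_scalar in blast)

text \<open>The exponential is asked to be graded only at sums of regular words, since the logarithm
  of another Laurent monomial may involve \<open>Log 0\<close>.\<close>

lemma graded_series_subst:
  assumes G: "\<And>w. regular_word w \<Longrightarrow> graded_series M (G w)"
    and F: "\<And>w. regular_word w \<Longrightarrow> graded_series M (F w)"
    and ex: "\<And>t w. regular_word w \<Longrightarrow> graded_series M (ex t (ysum w))"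
    and f: "\<And>w. regular_word w \<Longrightarrow> graded_series M (f w)"
    and xs: "regular_word xs"
  shows "graded_series M (subst F G ex f xs)"
proof -
  have "graded_series M (subst F G ex f xs)" if "\<And>w. contracts w xs \<Longrightarrow> graded_series M (f w)" for f
    using that xs
  proof (induction xs arbitrary: f rule: length_induct)
    case (1 xs)
    have "graded_series M (contract_block F G ex (\<lambda>e. subst F G ex (\<lambda>w. f (e # w)) r) b)" if br: "b @ r = xs" for b r
    proof (cases "b = []")
      case False
      have b: "regular_word b" and r: "regular_word r"
        using regular_words.adm_append[of b r] br 1(3) by auto
      show ?thesis
        unfolding contract_block_def
      proof (intro graded_series_marks graded_series_mult)
        fix a x a' assume b': "a @ x # a' = b"
        have reg: "regular_word (shift (fst x) a)" "regular_word (shift (fst x) a')"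
          using regular_words.adm_shift[of a x a'] b b' by auto
        show "graded_series M (ex (fst x) (ysum b))" "graded_series M (G (shift (fst x) a))"
          "graded_series M (F (shift (fst x) a'))" using b reg ex G F by blast+
        have "graded_series M (f ((fst x, ysum b) # w))" if "contracts w r" for w
          using contracts_Cons[OF that, of x b] b' br 1(2) by auto
        then show "graded_series M (subst F G ex (\<lambda>w. f ((fst x, ysum b) # w)) r)"
          using 1(1)[rule_format, of r "\<lambda>w. f ((fst x, ysum b) # w)"] False br r by auto
      qed
    qed (simp add: graded_series_zero)
    moreover have "graded_series M (if xs = [] then f [] else 0)"
      using 1(2)[of "[]"] by (auto simp: contracts_Nil graded_series_zero)
    ultimately show ?case
      unfolding subst_unfold[of F G ex f xs] by (intro graded_series_add graded_series_splits)
  qed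
  then show ?thesis using f regular_words.adm_contracts xs by blast
qed

end

lemma keys_symb:
  assumes "ys = [] \<or> regular ys" "length ns = length ys" "\<forall>n\<in>set ns. 1 \<le> n"
  shows "keys (symb ys ns) \<subseteq> regular_monomials (sum_list ns)"
proof (cases "ys = []")
  case True
  then show ?thesis using assms by (auto simp: symb_def in_keys_iff lookup_one when_def regular_monomials_def split: if_splits)
next
  case False
  then have "Sym ys ns \<in> regular_generators" using assms by (auto simp: regular_generators_def index_for_def)
  then show ?thesis using False by (simp add: symb_def gen_def regular_monomials_def weight_def)
qed

lemma graded_reg_series: "regular_word xs \<Longrightarrow> graded_series regular_monomials (reg_series xs)"
  unfolding reg_series_def
  by (rule graded_series_gen_value[OF monomial_grading_regular], rule keys_symb)
    (auto simp: regular_word_def)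

lemma keys_log_symb:
  assumes "regular_word w"
  shows "keys (log_symb (ysum w)) \<subseteq> regular_monomials 1"
proof -
  obtain a c where ac: "1 \<le> a" "chain a (map snd w) c" using assms by (auto simp: regular_word_chain)
  have y: "ysum w = xprod a c" using chain_sum[OF ac(2)] by (simp add: ysum_def)
  show ?thesis
    unfolding log_symb_def
  proof (rule keys_sum_subset)
    fix i assume "i \<in> keys (ysum w)"
    then have "a \<le> i" "lookup (ysum w) i = 1" unfolding y by (auto simp: in_keys_iff lookup_xprod split: if_splits)
    then have "of_int (lookup (ysum w) i) * gen (Log i) = gen (Log i)" "Log i \<in> regular_generators"
      using ac(1) by (auto simp: regular_generators_def)
    then show "keys (of_int (lookup (ysum w) i) * gen (Log i)) \<subseteq> regular_monomials 1"
      by (simp add: gen_def regular_monomials_def weight_def)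
  qed
qed

lemma graded_exp_log: "regular_word w \<Longrightarrow> graded_series regular_monomials (exp_log t (ysum w))"
  unfolding exp_log_def
  by (intro graded_series_exps[OF monomial_grading_regular] order_trans[OF keys_smult keys_log_symb])

text \<open>The inversion relation, solved for the value at the whole word, expresses it by regular
  series, exponentials, values at shorter words and the constants \<open>1 / t\<close> of weight 0,
  all of which are graded.\<close>

lemma graded_inv_series: "regular_word xs \<Longrightarrow> graded_series regular_monomials (inv_series xs)"
proof (induction xs rule: length_induct)
  case (1 xs)
  note gr = monomial_grading_regular
  let ?B = "conv (\<lambda>w. unit_word w - single_edge inverse_label w) reg_series"
  have unit: "graded_series regular_monomials (unit_word w)" for w :: "laurent_monomial word"
    by (simp add: unit_word_def graded_series_zero graded_series_one gr)
  have single: "graded_series regular_monomials (single_edge inverse_label w)" for w :: "laurent_monomial word"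
    by (cases w rule: remdups_adj.cases) (simp_all add: graded_series_zero graded_series_const gr inverse_label_def)
  have B: "graded_series regular_monomials (?B w)" if w: "regular_word w" for w
    unfolding conv_def
  proof (intro graded_series_splits[OF gr] graded_series_mult[OF gr] graded_series_diff[OF gr] unit single)
    fix a b assume "a @ b = w"
    then show "graded_series regular_monomials (reg_series b)"
      using regular_words.adm_append[of a b] w graded_reg_series by blast
  qed
  have Nil: "?B [] = 1" by (simp add: conv_Nil unit_word_def)
  have "conv inv_series ?B xs = unit_word xs - contract_block reg_series inv_series exp_log inverse_label xs"
    using inversion_relation_symb 1(2) by (simp add: regular_words.inversion_relation_def)
  then have eq: "inv_series xs = unit_word xs - contract_block reg_series inv_series exp_log inverse_label xs
      - splits xs (\<lambda>a b. if b = [] then 0 else inv_series a * ?B b)"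
    unfolding conv_split_last[of _ _ xs] Nil by (simp add: algebra_simps)
  have "graded_series regular_monomials (contract_block reg_series inv_series exp_log inverse_label xs)"
    unfolding contract_block_def
  proof (intro graded_series_marks[OF gr] graded_series_mult[OF gr] graded_exp_log 1(2))
    fix a x a' assume "a @ x # a' = xs"
    then have "regular_word (shift (fst x) a)" "regular_word (shift (fst x) a')" "length a < length xs"
      using regular_words.adm_shift[of a x a'] 1(2) by auto
    then show "graded_series regular_monomials (inv_series (shift (fst x) a))"
      "graded_series regular_monomials (reg_series (shift (fst x) a'))"
      using 1(1) graded_reg_series by auto
  qed (simp add: inverse_label_def graded_series_const gr)
  moreover have "graded_series regular_monomials (splits xs (\<lambda>a b. if b = [] then 0 else inv_series a * ?B b))"
  proof (rule graded_series_splits[OF gr])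
    fix a b assume ab: "a @ b = xs"
    then have "regular_word a" "regular_word b" using regular_words.adm_append[of a b] 1(2) by auto
    then show "graded_series regular_monomials (if b = [] then 0 else inv_series a * ?B b)"
      using 1(1)[rule_format, of a] ab B by (auto simp: graded_series_zero gr intro!: graded_series_mult)
  qed
  ultimately show ?case unfolding eq by (intro graded_series_diff[OF gr] unit)
qed

lemma keys_tensor_left: "keys (tensor a 1) \<subseteq> (\<lambda>m. (m, 0)) ` keys a"
  and keys_tensor_right: "keys (tensor 1 a) \<subseteq> (\<lambda>m. (0, m)) ` keys a"
  by (auto simp: in_keys_iff lookup_tensor lookup_one when_def image_iff split: if_splits)

lemma pairs_left: "(\<lambda>m. (m, 0)) ` regular_monomials n \<subseteq> regular_monomial_pairs n"
  and pairs_right: "(\<lambda>m. (0, m)) ` regular_monomials n \<subseteq> regular_monomial_pairs n"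
  by (auto simp: regular_monomials_def regular_monomial_pairs_def)

lemma graded_map_left: "graded_series regular_monomials F \<Longrightarrow> graded_series regular_monomial_pairs (map_fps (\<lambda>a. tensor a 1) F)"
  and graded_map_right: "graded_series regular_monomials F \<Longrightarrow> graded_series regular_monomial_pairs (map_fps (tensor 1) F)"
  unfolding graded_series_def map_fps_nth
  by (meson order_trans image_mono keys_tensor_left pairs_left keys_tensor_right pairs_right)+

lemma graded_coproduct_value:
  assumes xs: "regular_word xs"
  shows "graded_series regular_monomial_pairs (coproduct_value xs)"
  unfolding coproduct_value_def conv_def
proof (intro graded_series_splits[OF monomial_grading_pairs] graded_series_mult[OF monomial_grading_pairs])
  fix a b assume "a @ b = xs"
  then have ab: "regular_word a" "regular_word b" using regular_words.adm_append[of a b] xs by auto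
  then show "graded_series regular_monomial_pairs (reg_at (tensor 1) a)"
    by (intro graded_map_right graded_reg_series)
  show "graded_series regular_monomial_pairs (subst_at (tensor 1) (reg_at (\<lambda>a. tensor a 1)) b)"
    by (rule graded_series_subst[OF monomial_grading_pairs _ _ _ _ ab(2)])
      (intro graded_map_left graded_map_right graded_reg_series graded_inv_series graded_exp_log; assumption)+
qed

lemma keys_inv_comul_gen:
  assumes "g \<in> regular_generators"
  shows "keys (inv_comul (gen g)) \<subseteq> regular_monomial_pairs (gen_weight g)"
proof (cases g)
  case (Log i)
  have g: "keys (gen g) = {single g 1}" by (simp add: gen_def)
  have "keys (inv_comul (gen g)) \<subseteq> {(single g 1, 0), (0, single g 1)}"
    using keys_add[of "tensor (gen g) 1" "tensor 1 (gen g)"] keys_tensor_left[of "gen g"] keys_tensor_right[of "gen g"]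
    unfolding Log inv_comul_log unfolding Log[symmetric] g by blast
  moreover have "weight (single g 1) = gen_weight g" by (simp add: weight_def)
  ultimately show ?thesis using assms by (auto simp: regular_monomial_pairs_def)
next
  case (Sym ys ns)
  then have reg: "regular ys" "length ns = length ys" "\<forall>n\<in>set ns. 1 \<le> n"
    using assms by (auto simp: regular_generators_def index_for_def)
  \<comment> \<open>With the graded parts for \<open>M\<close>, Kronecker substitution passes from a
    grading of the values at all points to one of the coefficients.\<close>
  have "keys (inv_comul (symb ys ns)) \<subseteq> regular_monomial_pairs (sum_list ns)"
  proof (rule gen_value_coeff_keys[where d = "length ys"])
    fix qs :: "rat list" and k assume qs: "length qs = length ys" "distinct (0 # qs)"
    then have w: "regular_word (zip qs ys)" using reg by (simp add: regular_word_def)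
    have "gen_value (\<lambda>ns. inv_comul (symb ys ns)) qs = coproduct_value (zip qs ys)"
      using qs by (simp add: reg_series_def map_fps_gen_value algebra_map_inv_comul flip: inv_comul_reg_series[OF w])
    then show "keys (fps_nth (gen_value (\<lambda>ns. inv_comul (symb ys ns)) qs) k) \<subseteq> regular_monomial_pairs k"
      using graded_coproduct_value[OF w] by (simp add: graded_series_def)
  qed (use reg in auto)
  then show ?thesis using reg Sym by (simp add: symb_def regular_def)
qed

lemma keys_inv_comul_single:
  assumes "keys m \<subseteq> regular_generators"
  shows "keys (inv_comul (single m 1)) \<subseteq> regular_monomial_pairs (weight m)"
proof -
  have "inv_comul (single m 1) = (\<Prod>g\<in>keys m. inv_comul (gen g) ^ lookup m g)"
    unfolding single_eq_prod_gen
    by (simp add: algebra_map_prod algebra_map_power algebra_map_inv_comul)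
  also have "keys \<dots> \<subseteq> regular_monomial_pairs (\<Sum>g\<in>keys m. lookup m g * gen_weight g)"
    by (intro keys_prod_graded[OF monomial_grading_pairs] keys_power_graded[OF monomial_grading_pairs] keys_inv_comul_gen)
      (use assms in auto)
  finally show ?thesis by (simp add: weight_def)
qed

lemma inv_comul_expand: "inv_comul a = (\<Sum>m\<in>keys a. smult (lookup a m) (inv_comul (single m 1)))"
  by (subst poly_mapping_expand[of a]) (simp only: algebra_map_simps[OF algebra_map_inv_comul])

lemma keys_inv_comul_gr:
  assumes "a \<in> H_symb_gr n"
  shows "keys (inv_comul a) \<subseteq> regular_monomial_pairs n"
  unfolding inv_comul_expand[of a]
proof (intro keys_sum_subset order_trans[OF keys_smult])
  fix m assume "m \<in> keys a"
  then have "keys m \<subseteq> regular_generators" "weight m = n"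
    using assms by (auto simp: H_symb_gr_iff regular_monomials_def)
  then show "keys (inv_comul (single m 1)) \<subseteq> regular_monomial_pairs n"
    using keys_inv_comul_single[of m] by simp
qed

lemma keys_inv_comul:
  assumes "a \<in> H_symb"
  shows "keys (inv_comul a) \<subseteq> (\<Union>n. regular_monomial_pairs n)"
  unfolding inv_comul_expand[of a]
proof (intro keys_sum_subset order_trans[OF keys_smult])
  fix m assume "m \<in> keys a"
  then have "keys (inv_comul (single m 1)) \<subseteq> regular_monomial_pairs (weight m)"
    using assms by (intro keys_inv_comul_single) (simp add: H_symb_iff)
  also have "\<dots> \<subseteq> (\<Union>n. regular_monomial_pairs n)" by (rule UN_upper) simp
  finally show "keys (inv_comul (single m 1)) \<subseteq> (\<Union>n. regular_monomial_pairs n)" .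
qed

lemma span_singles:
  fixes w :: "'m::comm_monoid_add \<Rightarrow>\<^sub>0 rat"
  assumes "\<And>p. p \<in> keys w \<Longrightarrow> single p 1 \<in> pm.span B"
  shows "w \<in> pm.span B"
  by (subst poly_mapping_expand[of w]) (intro pm.span_sum pm.span_scale assms)

lemma inv_comul_gr:
  assumes "a \<in> H_symb_gr n"
  shows "inv_comul a \<in> pm.span (\<Union>i\<le>n. tensor_space (H_symb_gr i) (H_symb_gr (n - i)))"
proof (rule span_singles)
  fix p assume "p \<in> keys (inv_comul a)"
  then obtain m m' where p: "p = (m, m')" "keys m \<subseteq> regular_generators" "keys m' \<subseteq> regular_generators"
    "weight m + weight m' = n" using keys_inv_comul_gr[OF assms] by (auto simp: regular_monomial_pairs_def)
  then have "single m 1 \<in> H_symb_gr (weight m)" "single m' 1 \<in> H_symb_gr (n - weight m)"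
    by (auto simp: H_symb_gr_iff regular_monomials_def)
  then have "tensor (single m 1) (single m' 1) \<in> tensor_space (H_symb_gr (weight m)) (H_symb_gr (n - weight m))"
    unfolding tensor_space_def by (intro pm.span_base) blast
  then show "single p 1 \<in> pm.span (\<Union>i\<le>n. tensor_space (H_symb_gr i) (H_symb_gr (n - i)))"
    using p by (intro pm.span_base) (auto simp: tensor_single intro!: bexI[of _ "weight m"])
qed

lemma inv_comul_closed:
  assumes "a \<in> H_symb"
  shows "inv_comul a \<in> tensor_space H_symb H_symb"
  unfolding tensor_space_def
proof (rule span_singles)
  fix p assume "p \<in> keys (inv_comul a)"
  then obtain m m' where p: "p = (m, m')" "keys m \<subseteq> regular_generators" "keys m' \<subseteq> regular_generators"
    using keys_inv_comul[OF assms] by (auto simp: regular_monomial_pairs_def)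
  then have "single p 1 = tensor (single m 1) (single m' 1)" "single m 1 \<in> H_symb" "single m' 1 \<in> H_symb"
    by (auto simp: tensor_single single_in_H_symb)
  then show "single p 1 \<in> pm.span {tensor a b |a b. a \<in> H_symb \<and> b \<in> H_symb}"
    by (intro pm.span_base) blast
qed

lemma graded_algebra_H_symb: "graded_algebra H_symb H_symb_gr"
proof
  show "subalgebra H_symb" by (rule subalgebra_H_symb)
  show "pm.subspace (H_symb_gr n)" for n
  proof (unfold pm.subspace_def, intro conjI ballI allI)
    show "0 \<in> H_symb_gr n" by (simp add: H_symb_gr_iff)
    show "a + b \<in> H_symb_gr n" if "a \<in> H_symb_gr n" "b \<in> H_symb_gr n" for a b
      using keys_add[of a b] that by (auto simp: H_symb_gr_iff)
    show "smult c a \<in> H_symb_gr n" if "a \<in> H_symb_gr n" for c a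
      using keys_smult[of c a] that by (auto simp: H_symb_gr_iff)
  qed
  show "H_symb_gr n \<subseteq> H_symb" for n by (auto simp: H_symb_gr_def)
  show "1 \<in> H_symb_gr 0" using H_symb_gr_0 pm.scale_one[of 1] by (metis rangeI)
  show "a * b \<in> H_symb_gr (i + j)" if "a \<in> H_symb_gr i" "b \<in> H_symb_gr j" for a b i j
    using keys_mult_graded[OF monomial_grading_regular] that by (simp add: H_symb_gr_iff)
  show "\<exists>!f. (\<forall>n. f n \<in> H_symb_gr n) \<and> finite {n. f n \<noteq> 0} \<and> a = (\<Sum>n | f n \<noteq> 0. f n)" if a: "a \<in> H_symb" for a
  proof -
    define comp where "comp n = (\<Sum>m\<in>keys a. if weight m = n then single m (lookup a m) else 0)" for n
    have l: "lookup (comp n) m = (if weight m = n then lookup a m else 0)" for n m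
    proof -
      have "lookup (comp n) m = (\<Sum>m'\<in>keys a. if m' = m then if weight m = n then lookup a m else 0 else 0)"
        unfolding comp_def lookup_sum by (rule sum.cong) (auto simp: lookup_single when_def)
      then show ?thesis by (simp add: sum.delta' in_keys_iff)
    qed
    have "{n. comp n \<noteq> 0} \<subseteq> weight ` keys a"
    proof
      fix n assume "n \<in> {n. comp n \<noteq> 0}"
      then obtain m where "m \<in> keys (comp n)" using keys_eq_empty[of "comp n"] by blast
      then have "lookup (comp n) m \<noteq> 0" by (simp add: in_keys_iff)
      then show "n \<in> weight ` keys a" unfolding l by (auto simp: in_keys_iff split: if_splits)
    qed
    then have fin: "finite {n. comp n \<noteq> 0}" by (rule finite_subset) simp
    have "a = (\<Sum>n | comp n \<noteq> 0. comp n)"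
    proof (rule poly_mapping_eqI)
      fix m
      have "lookup (\<Sum>n | comp n \<noteq> 0. comp n) m = (\<Sum>n | comp n \<noteq> 0. if n = weight m then lookup a m else 0)"
        unfolding lookup_sum[of _ "{n. comp n \<noteq> 0}"] l by (rule sum.cong) auto
      also have "\<dots> = (if comp (weight m) \<noteq> 0 then lookup a m else 0)"
        using fin by (simp add: sum.delta')
      also have "\<dots> = lookup a m" using l[of "weight m" m] by (cases "comp (weight m) = 0") simp_all
      finally show "lookup a m = lookup (\<Sum>n | comp n \<noteq> 0. comp n) m" ..
    qed
    moreover have "comp n \<in> H_symb_gr n" for n
      unfolding H_symb_gr_iff comp_def
      by (rule keys_sum_subset) (use a in \<open>auto simp: H_symb_iff regular_monomials_def\<close>)
    ultimately have f: "(\<forall>n. comp n \<in> H_symb_gr n) \<and> finite {n. comp n \<noteq> 0} \<and> a = (\<Sum>n | comp n \<noteq> 0. comp n)"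
      using fin by blast
    have uniq: "f = comp" if f: "(\<forall>n. f n \<in> H_symb_gr n) \<and> finite {n. f n \<noteq> 0} \<and> a = (\<Sum>n | f n \<noteq> 0. f n)" for f
    proof (intro ext poly_mapping_eqI)
      fix n m
      have w: "lookup (f k) m = 0" if k: "k \<noteq> weight m" for k
        using f k by (auto simp: H_symb_gr_iff regular_monomials_def in_keys_iff subset_iff)
      have "lookup a m = (\<Sum>k | f k \<noteq> 0. lookup (f k) m)" using f by (metis lookup_sum)
      also have "\<dots> = (\<Sum>k | f k \<noteq> 0. if k = weight m then lookup (f (weight m)) m else 0)"
        by (rule sum.cong) (auto simp: w)
      also have "\<dots> = lookup (f (weight m)) m" using f by (simp add: sum.delta')
      finally show "lookup (f n) m = lookup (comp n) m" unfolding l using w[of n] by auto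
    qed
    from f uniq show ?thesis by (rule ex1I)
  qed
qed

lemma symb_counit_mult: "symb_counit (a * b) = symb_counit a * symb_counit b"
  by (metis algebra_map_simps(8)[OF algebra_map_counit] counit_map_eq scalar_inject scalar_simps(4))

lemma graded_bialgebra_H_symb: "graded_bialgebra H_symb H_symb_gr inv_comul symb_counit"
proof (intro graded_bialgebra.intro graded_algebra_H_symb graded_bialgebra_axioms.intro)
  show "linear_map inv_comul" using algebra_map_inv_comul by (simp add: algebra_map_def)
  show "inv_comul 1 = 1" "inv_comul (a * b) = inv_comul a * inv_comul b" for a b
    by (simp_all add: algebra_map_simps[OF algebra_map_inv_comul])
  show "Vector_Spaces.linear smult (*) symb_counit"
    by unfold_locales (simp_all add: symb_counit_simps algebra_simps)
  show "symb_counit 1 = 1" by (simp add: symb_counit_def lookup_one)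
  show "symb_counit a = 0" if "a \<in> H_symb_gr n" "n > 0" for a n
    using that by (auto simp: symb_counit_def H_symb_gr_def in_keys_iff dest: bspec[of _ _ 0])
qed (simp_all add: inv_comul_closed inv_comul_gr coassociative_inv_comul symb_counit_mult counit_lift)

section \<open>The antipode\<close>

definition extend_linear :: "(monomial \<Rightarrow> symb_alg) \<Rightarrow> symb_alg \<Rightarrow> symb_alg" where
  "extend_linear S a = (\<Sum>m\<in>keys a. smult (lookup a m) (S m))"

lemma extend_linear_superset:
  "finite A \<Longrightarrow> keys a \<subseteq> A \<Longrightarrow> extend_linear S a = (\<Sum>m\<in>A. smult (lookup a m) (S m))"
  unfolding extend_linear_def by (rule sum.mono_neutral_left) (auto simp: in_keys_iff)

lemma linear_extend_linear: "linear_map (extend_linear S)"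
proof (rule linear_mapI)
  fix a b c
  show "extend_linear S (a + b) = extend_linear S a + extend_linear S b"
    using keys_add[of a b]
    by (simp add: extend_linear_superset[of "keys a \<union> keys b"] lookup_add pm.scale_left_distrib sum.distrib)
  show "extend_linear S (smult c a) = smult c (extend_linear S a)"
    using keys_smult[of c a]
    by (simp add: extend_linear_superset[of "keys a"] lookup_smult pm.scale_sum_right)
qed

lemma extend_linear_single: "extend_linear S (single m 1) = S m"
  by (simp add: extend_linear_def)

text \<open>Solves \<open>S * id = \<epsilon>\<close> by recursion on the weight. For a nontrivial
  monomial \<open>m\<close> in regular generators the test on the weight leaves out exactly the term
  \<open>m \<otimes> 1\<close>, whose coefficient is 1; for all other monomials it keeps the
  recursion well-founded.\<close>

function antipode_left :: "monomial \<Rightarrow> symb_alg" where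
  "antipode_left m = (if m = 0 then 1 else - (\<Sum>p\<in>keys (inv_comul (single m 1)).
     if weight (fst p) < weight m
     then smult (lookup (inv_comul (single m 1)) p) (antipode_left (fst p) * single (snd p) 1) else 0))"
  by pat_completeness auto
termination by (relation "Wellfounded.measure weight") auto

text \<open>The mirrored recursion for \<open>id * S = \<epsilon>\<close>. That the two agree on
  \<open>H_symb\<close> is a consequence of coassociativity.\<close>

function antipode_right :: "monomial \<Rightarrow> symb_alg" where
  "antipode_right m = (if m = 0 then 1 else - (\<Sum>p\<in>keys (inv_comul (single m 1)).
     if weight (snd p) < weight m
     then smult (lookup (inv_comul (single m 1)) p) (single (fst p) 1 * antipode_right (snd p)) else 0))"
  by pat_completeness auto
termination by (relation "Wellfounded.measure weight") auto

declare antipode_left.simps [simp del] antipode_right.simps [simp del]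

lemma lookup_counit_lift:
  "lookup (tensor_lift (\<lambda>b c. smult (symb_counit b) c) w) m = lookup w (0, m)"
  "lookup (tensor_lift (\<lambda>b c. smult (symb_counit c) b) w) m = lookup w (m, 0)"
proof -
  have "lookup (tensor_lift (\<lambda>b c. smult (symb_counit b) c) w) m
    = (\<Sum>p\<in>keys w. if p = (0, m) then lookup w (0, m) else 0)"
    unfolding tensor_lift_def lookup_sum
    by (rule sum.cong) (auto simp: lookup_smult symb_counit_def lookup_single when_def split: if_splits)
  then show "lookup (tensor_lift (\<lambda>b c. smult (symb_counit b) c) w) m = lookup w (0, m)"
    by (simp add: sum.delta' in_keys_iff)
  have "lookup (tensor_lift (\<lambda>b c. smult (symb_counit c) b) w) m
    = (\<Sum>p\<in>keys w. if p = (m, 0) then lookup w (m, 0) else 0)"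
    unfolding tensor_lift_def lookup_sum
    by (rule sum.cong) (auto simp: lookup_smult symb_counit_def lookup_single when_def split: if_splits)
  then show "lookup (tensor_lift (\<lambda>b c. smult (symb_counit c) b) w) m = lookup w (m, 0)"
    by (simp add: sum.delta' in_keys_iff)
qed

text \<open>The counit axioms, read coefficientwise.\<close>

lemma lookup_inv_comul_single:
  assumes "keys m \<subseteq> regular_generators"
  shows "lookup (inv_comul (single m 1)) (m', 0) = (if m' = m then 1 else 0)"
    and "lookup (inv_comul (single m 1)) (0, m') = (if m' = m then 1 else 0)"
  using counit_lift[OF single_in_H_symb[OF assms]]
  by (simp_all add: lookup_single when_def flip: lookup_counit_lift)

lemma regular_monomial_pairsD:
  assumes "p \<in> regular_monomial_pairs n"
  shows "weight (fst p) + weight (snd p) = n" "keys (fst p) \<subseteq> regular_generators"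
    "keys (snd p) \<subseteq> regular_generators"
  using assms by (cases p; simp add: regular_monomial_pairs_def)+

lemma antipode_single:
  assumes m: "keys m \<subseteq> regular_generators"
  shows "tensor_lift (\<lambda>b c. extend_linear antipode_left b * c) (inv_comul (single m 1)) = smult (symb_counit (single m 1)) 1"
    and "tensor_lift (\<lambda>b c. b * extend_linear antipode_right c) (inv_comul (single m 1)) = smult (symb_counit (single m 1)) 1"
proof -
  let ?c = "lookup (inv_comul (single m 1))" and ?K = "keys (inv_comul (single m 1))"
  let ?l = "\<lambda>p. smult (?c p) (antipode_left (fst p) * single (snd p) 1)"
  let ?r = "\<lambda>p. smult (?c p) (single (fst p) 1 * antipode_right (snd p))"
  have L: "tensor_lift (\<lambda>b c. extend_linear antipode_left b * c) (inv_comul (single m 1)) = (\<Sum>p\<in>?K. ?l p)"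
    and R: "tensor_lift (\<lambda>b c. b * extend_linear antipode_right c) (inv_comul (single m 1)) = (\<Sum>p\<in>?K. ?r p)"
    by (simp_all add: tensor_lift_def extend_linear_single case_prod_unfold)
  have K: "weight (fst p) + weight (snd p) = weight m" "keys (fst p) \<subseteq> regular_generators" "keys (snd p) \<subseteq> regular_generators"
    if "p \<in> ?K" for p
    by (rule regular_monomial_pairsD[OF keys_inv_comul_single[OF m, THEN subsetD, OF that]])+
  have c: "?c (m', 0) = (if m' = m then 1 else 0)" "?c (0, m') = (if m' = m then 1 else 0)" for m'
    by (rule lookup_inv_comul_single[OF m])+
  then have in_K: "(m, 0) \<in> ?K" "(0, m) \<in> ?K" by (simp_all add: in_keys_iff)
  have counit: "symb_counit (single m 1) = (if m = 0 then 1 else 0)" by (simp add: symb_counit_def lookup_single when_def)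
  show "tensor_lift (\<lambda>b c. extend_linear antipode_left b * c) (inv_comul (single m 1)) = smult (symb_counit (single m 1)) 1"
    unfolding L counit
  proof (cases "m = 0")
    case True
    have "p = (0, 0)" if p: "p \<in> ?K" for p
    proof -
      have "fst p = 0" by (rule weight_eq_0[OF K(2)[OF p]]) (use K(1)[OF p] True in simp)
      moreover have "snd p = 0" by (rule weight_eq_0[OF K(3)[OF p]]) (use K(1)[OF p] True in simp)
      ultimately show ?thesis by (simp add: prod_eq_iff)
    qed
    moreover have "(0, 0) \<in> ?K" using in_K(1) unfolding True .
    ultimately have "?K = {(0, 0)}" by blast
    then show "(\<Sum>p\<in>?K. ?l p) = smult (if m = 0 then 1 else 0) 1"
      using True c(1)[of 0] by (simp add: antipode_left.simps[of 0])
  next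
    case False
    have "(\<Sum>p\<in>?K. ?l p) = (\<Sum>p\<in>?K. (if weight (fst p) < weight m then ?l p else 0) + (if p = (m, 0) then ?l p else 0))"
    proof (rule sum.cong[OF refl])
      fix p assume p: "p \<in> ?K"
      \<comment> \<open>The weights add up to that of \<open>m\<close>, so the second component has
        weight 0 and is trivial; by the counit axiom the first one is then \<open>m\<close>.\<close>
      have eq: "p = (m, 0)" if "\<not> weight (fst p) < weight m"
      proof -
        have "snd p = 0" using that K[OF p] weight_eq_0[of "snd p"] by simp
        then show ?thesis using p c(1)[of "fst p"] by (cases p) (auto simp: in_keys_iff split: if_splits)
      qed
      show "?l p = (if weight (fst p) < weight m then ?l p else 0) + (if p = (m, 0) then ?l p else 0)"
      proof (cases "weight (fst p) < weight m")
        case True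
        then have "p \<noteq> (m, 0)" by auto
        with True show ?thesis by simp
      next
        case False
        then show ?thesis using eq[OF False] by simp
      qed
    qed
    also have "\<dots> = - antipode_left m + ?l (m, 0)"
      using False in_K by (simp add: sum.distrib sum.delta' antipode_left.simps[of m])
    finally show "(\<Sum>p\<in>?K. ?l p) = smult (if m = 0 then 1 else 0) 1" using False by (simp add: c)
  qed
  show "tensor_lift (\<lambda>b c. b * extend_linear antipode_right c) (inv_comul (single m 1)) = smult (symb_counit (single m 1)) 1"
    unfolding R counit
  proof (cases "m = 0")
    case True
    have "p = (0, 0)" if p: "p \<in> ?K" for p
    proof -
      have "fst p = 0" by (rule weight_eq_0[OF K(2)[OF p]]) (use K(1)[OF p] True in simp)
      moreover have "snd p = 0" by (rule weight_eq_0[OF K(3)[OF p]]) (use K(1)[OF p] True in simp)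
      ultimately show ?thesis by (simp add: prod_eq_iff)
    qed
    moreover have "(0, 0) \<in> ?K" using in_K(1) unfolding True .
    ultimately have "?K = {(0, 0)}" by blast
    then show "(\<Sum>p\<in>?K. ?r p) = smult (if m = 0 then 1 else 0) 1"
      using True c(1)[of 0] by (simp add: antipode_right.simps[of 0])
  next
    case False
    have "(\<Sum>p\<in>?K. ?r p) = (\<Sum>p\<in>?K. (if weight (snd p) < weight m then ?r p else 0) + (if p = (0, m) then ?r p else 0))"
    proof (rule sum.cong[OF refl])
      fix p assume p: "p \<in> ?K"
      have eq: "p = (0, m)" if "\<not> weight (snd p) < weight m"
      proof -
        have "fst p = 0" using that K[OF p] weight_eq_0[of "fst p"] by simp
        then show ?thesis using p c(2)[of "snd p"] by (cases p) (auto simp: in_keys_iff split: if_splits)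
      qed
      show "?r p = (if weight (snd p) < weight m then ?r p else 0) + (if p = (0, m) then ?r p else 0)"
      proof (cases "weight (snd p) < weight m")
        case True
        then have "p \<noteq> (0, m)" by auto
        with True show ?thesis by simp
      next
        case False
        then show ?thesis using eq[OF False] by simp
      qed
    qed
    also have "\<dots> = - antipode_right m + ?r (0, m)"
      using False in_K by (simp add: sum.distrib sum.delta' antipode_right.simps[of m])
    finally show "(\<Sum>p\<in>?K. ?r p) = smult (if m = 0 then 1 else 0) 1" using False by (simp add: c)
  qed
qed

lemma linear_map_expand:
  assumes "linear_map h"
  shows "h a = (\<Sum>m\<in>keys a. smult (lookup a m) (h (single m 1)))"
  by (subst poly_mapping_expand[of a]) (simp only: linear_map_sum[OF assms] linear_map_scale[OF assms])

lemma linear_map_eq_on_H: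
  assumes f: "linear_map f" and g: "linear_map g"
    and eq: "\<And>m. keys m \<subseteq> regular_generators \<Longrightarrow> f (single m 1) = g (single m 1)" and a: "a \<in> H_symb"
  shows "f a = g a"
  unfolding linear_map_expand[OF f, of a] linear_map_expand[OF g, of a]
  by (rule sum.cong) (use eq a in \<open>auto simp: H_symb_iff\<close>)

lemma antipode_identity:
  assumes a: "a \<in> H_symb"
  shows "tensor_lift (\<lambda>b c. extend_linear antipode_left b * c) (inv_comul a) = smult (symb_counit a) 1"
    and "tensor_lift (\<lambda>b c. b * extend_linear antipode_right c) (inv_comul a) = smult (symb_counit a) 1"
proof -
  have lin: "linear_map (\<lambda>a. tensor_lift f (inv_comul a))" for f :: "symb_alg \<Rightarrow> symb_alg \<Rightarrow> symb_alg"
    by (auto intro!: linear_mapI simp: linear_map_add[OF linear_tensor_lift] linear_map_scale[OF linear_tensor_lift]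
        algebra_map_simps[OF algebra_map_inv_comul])
  have counit: "linear_map (\<lambda>a. smult (symb_counit a) 1 :: symb_alg)"
    by (auto intro!: linear_mapI simp: symb_counit_simps pm.scale_left_distrib)
  show "tensor_lift (\<lambda>b c. extend_linear antipode_left b * c) (inv_comul a) = smult (symb_counit a) 1"
    by (rule linear_map_eq_on_H[OF lin counit antipode_single(1) a])
  show "tensor_lift (\<lambda>b c. b * extend_linear antipode_right c) (inv_comul a) = smult (symb_counit a) 1"
    by (rule linear_map_eq_on_H[OF lin counit antipode_single(2) a])
qed

lemma linear_tensor_expand:
  assumes "linear_map h"
  shows "h w = (\<Sum>(m, n)\<in>keys w. smult (lookup w (m, n)) (h (tensor (single m 1) (single n 1))))"
  using linear_map_expand[OF assms, of w] by (simp add: case_prod_unfold tensor_single)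

text \<open>
  The two one-sided convolution inverses \<open>L\<close> and \<open>R\<close> of the identity agree, since both are
  values of \<open>a \<otimes> b \<otimes> c \<mapsto> L a * b * R c\<close> on the two sides of coassociativity.
\<close>

lemma antipode_left_eq_right:
  assumes a: "a \<in> H_symb"
  shows "extend_linear antipode_left a = extend_linear antipode_right a"
proof -
  let ?L = "extend_linear antipode_left" and ?R = "extend_linear antipode_right"
  have L: "linear_map ?L" and R: "linear_map ?R" by (rule linear_extend_linear)+
  note Ls = linear_map_add[OF L] linear_map_scale[OF L] and Rs = linear_map_add[OF R] linear_map_scale[OF R]
  have id: "algebra_map (id :: symb_alg \<Rightarrow> symb_alg)" unfolding id_def by (rule algebra_map_id)
  have lin: "linear_map inv_comul" "linear_map (id :: symb_alg \<Rightarrow> symb_alg)"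
    using id algebra_map_inv_comul by (simp_all add: algebra_map_def)
  let ?V = "\<lambda>x. tensor_lift (\<lambda>b c. ?L x * b * ?R c)"
  have V: "?V x u = ?L x * tensor_lift (\<lambda>b c. b * ?R c) u" for x u
    by (simp add: tensor_lift_def sum_distrib_left case_prod_unfold smult_mult_right mult.assoc)
  define T where "T = tensor_lift ?V"
  have T: "T (tensor x u) = ?V x u" for x u
    unfolding T_def
    by (rule tensor_lift_tensor)
      (auto intro!: linear_mapI simp: V Ls linear_map_add[OF linear_tensor_lift] linear_map_scale[OF linear_tensor_lift]
        distrib_left distrib_right smult_mult_left smult_mult_right)
  have linT: "linear_map T" unfolding T_def by (rule linear_tensor_lift)
  have T': "T (tensor_assoc (tensor u y)) = tensor_lift (\<lambda>b c. ?L b * c) u * ?R y" for u y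
  proof (rule tensor_linear_eqI[where w = u])
    have "linear_map tensor_assoc" unfolding tensor_assoc_def by (rule linear_tensor_lift)
    note As = linear_map_add[OF this] linear_map_scale[OF this]
    show "linear_map (\<lambda>u. T (tensor_assoc (tensor u y)))"
      by (auto intro!: linear_mapI simp: As linear_map_add[OF linT] linear_map_scale[OF linT] tensor_add_left tensor_smult_left)
    show "linear_map (\<lambda>u. tensor_lift (\<lambda>b c. ?L b * c) u * ?R y)"
      by (auto intro!: linear_mapI simp: linear_map_add[OF linear_tensor_lift] linear_map_scale[OF linear_tensor_lift]
          distrib_right smult_mult_left)
    fix b c
    have 1: "tensor_lift (\<lambda>b c. b * ?R c) (tensor c y) = c * ?R y"
      by (rule tensor_lift_tensor)
        (auto intro!: linear_mapI simp: Rs distrib_left distrib_right smult_mult_left smult_mult_right)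
    have 2: "tensor_lift (\<lambda>b c. ?L b * c) (tensor b c) = ?L b * c"
      by (rule tensor_lift_tensor)
        (auto intro!: linear_mapI simp: Ls distrib_left distrib_right smult_mult_left smult_mult_right)
    show "T (tensor_assoc (tensor (tensor b c) y)) = tensor_lift (\<lambda>b c. ?L b * c) (tensor b c) * ?R y"
      unfolding tensor_assoc_tensor T V 1 2 by (simp add: mult.assoc)
  qed
  have H: "single m 1 \<in> H_symb" "single m' 1 \<in> H_symb" if "(m, m') \<in> keys (inv_comul a)" for m m'
    using keys_inv_comul[OF a] that by (auto simp: regular_monomial_pairs_def intro!: single_in_H_symb)
  have linTQ: "linear_map (\<lambda>w. T (tensor_map id inv_comul w))"
    by (auto intro!: linear_mapI simp: linear_map_add[OF linT] linear_map_scale[OF linT]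
        linear_map_add[OF linear_tensor_map] linear_map_scale[OF linear_tensor_map])
  have "linear_map tensor_assoc" unfolding tensor_assoc_def by (rule linear_tensor_lift)
  note As = linear_map_add[OF this] linear_map_scale[OF this]
  have linTP: "linear_map (\<lambda>w. T (tensor_assoc (tensor_map inv_comul id w)))"
    by (auto intro!: linear_mapI simp: linear_map_add[OF linT] linear_map_scale[OF linT] As
        linear_map_add[OF linear_tensor_map] linear_map_scale[OF linear_tensor_map])
  have "?L a = ?L (tensor_lift (\<lambda>b c. smult (symb_counit c) b) (inv_comul a))"
    by (simp add: counit_lift(2)[OF a])
  also have "\<dots> = (\<Sum>(m, m')\<in>keys (inv_comul a). smult (lookup (inv_comul a) (m, m'))
      (smult (symb_counit (single m' 1)) (?L (single m 1))))"
    by (simp add: tensor_lift_def linear_map_sum[OF L] linear_map_scale[OF L] case_prod_unfold)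
  \<comment> \<open>The right inverse turns the last two of the three factors into the
    counit.\<close>
  also have "\<dots> = T (tensor_map id inv_comul (inv_comul a))"
    unfolding linear_tensor_expand[OF linTQ, of "inv_comul a"]
    by (intro sum.cong refl)
      (auto simp: tensor_map_tensor[OF lin(2,1)] T V antipode_identity(2) H smult_mult_right)
  also have "\<dots> = T (tensor_assoc (tensor_map inv_comul id (inv_comul a)))"
    using coassociative_inv_comul a by (simp add: coassociative_on_def)
  \<comment> \<open>On this side the left inverse does so with the first two factors.\<close>
  also have "\<dots> = (\<Sum>(m, m')\<in>keys (inv_comul a). smult (lookup (inv_comul a) (m, m'))
      (smult (symb_counit (single m 1)) (?R (single m' 1))))"
    unfolding linear_tensor_expand[OF linTP, of "inv_comul a"]
    by (intro sum.cong refl)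
      (auto simp: tensor_map_tensor[OF lin] T' antipode_identity(1) H smult_mult_left)
  also have "\<dots> = ?R (tensor_lift (\<lambda>b c. smult (symb_counit b) c) (inv_comul a))"
    by (simp add: tensor_lift_def linear_map_sum[OF R] linear_map_scale[OF R] case_prod_unfold)
  also have "\<dots> = ?R a" by (simp add: counit_lift(1)[OF a])
  finally show ?thesis .
qed

lemma keys_antipode_left:
  "keys m \<subseteq> regular_generators \<Longrightarrow> keys (antipode_left m) \<subseteq> regular_monomials (weight m)"
proof (induction m rule: measure_induct_rule[of weight])
  case (less m)
  show ?case
  proof (cases "m = 0")
    case True
    then show ?thesis
      by (auto simp: antipode_left.simps[of 0] in_keys_iff lookup_one when_def regular_monomials_def split: if_splits)
  next
    case False
    have "keys (if weight (fst p) < weight m then smult (lookup (inv_comul (single m 1)) p)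
        (antipode_left (fst p) * single (snd p) 1) else 0) \<subseteq> regular_monomials (weight m)"
      if p: "p \<in> keys (inv_comul (single m 1))" for p
    proof (cases "weight (fst p) < weight m")
      case True
      have reg: "weight (fst p) + weight (snd p) = weight m" "keys (fst p) \<subseteq> regular_generators"
        "keys (snd p) \<subseteq> regular_generators"
        by (rule regular_monomial_pairsD[OF keys_inv_comul_single[OF less.prems, THEN subsetD, OF p]])+
      have "keys (antipode_left (fst p) * single (snd p) 1) \<subseteq> regular_monomials (weight (fst p) + weight (snd p))"
        by (rule keys_mult_graded[OF monomial_grading_regular])
          (use less.IH[OF True reg(2)] reg in \<open>auto simp: regular_monomials_def\<close>)
      then show ?thesis unfolding reg(1) if_P[OF True] by (rule order_trans[OF keys_smult])
    qed simp
    then have "keys (\<Sum>p\<in>keys (inv_comul (single m 1)). if weight (fst p) < weight m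
        then smult (lookup (inv_comul (single m 1)) p) (antipode_left (fst p) * single (snd p) 1) else 0)
      \<subseteq> regular_monomials (weight m)"
      by (rule keys_sum_subset)
    then show ?thesis
      unfolding antipode_left.simps[of m] if_not_P[OF False] by simp
  qed
qed

lemma antipode_exists:
  "\<exists>S. linear_map S \<and> (\<forall>n. S ` H_symb_gr n \<subseteq> H_symb_gr n) \<and>
    (\<forall>a\<in>H_symb. tensor_lift (\<lambda>b c. S b * c) (inv_comul a) = smult (symb_counit a) 1 \<and>
       tensor_lift (\<lambda>b c. b * S c) (inv_comul a) = smult (symb_counit a) 1)"
proof (intro exI[of _ "extend_linear antipode_left"] conjI allI ballI)
  show "linear_map (extend_linear antipode_left)" by (rule linear_extend_linear)
  fix n
  show "extend_linear antipode_left ` H_symb_gr n \<subseteq> H_symb_gr n"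
  proof clarify
    fix a assume a: "a \<in> H_symb_gr n"
    have "keys (smult (lookup a m) (antipode_left m)) \<subseteq> regular_monomials n" if "m \<in> keys a" for m
      using a that keys_antipode_left[of m] keys_smult[of "lookup a m" "antipode_left m"]
      by (auto simp: H_symb_gr_iff regular_monomials_def subset_iff)
    then show "extend_linear antipode_left a \<in> H_symb_gr n"
      unfolding H_symb_gr_iff extend_linear_def by (rule keys_sum_subset)
  qed
next
  fix a assume a: "a \<in> H_symb"
  show "tensor_lift (\<lambda>b c. extend_linear antipode_left b * c) (inv_comul a) = smult (symb_counit a) 1"
    by (rule antipode_identity(1)[OF a])
  have "single m' 1 \<in> H_symb" if "(m, m') \<in> keys (inv_comul a)" for m m'
    using keys_inv_comul[OF a] that by (auto simp: regular_monomial_pairs_def intro!: single_in_H_symb)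
  \<comment> \<open>Only monomials of \<open>H_symb\<close> occur in the coproduct of
    \<open>a\<close>, and there the two recursions agree.\<close>
  then have "tensor_lift (\<lambda>b c. b * extend_linear antipode_left c) (inv_comul a)
    = tensor_lift (\<lambda>b c. b * extend_linear antipode_right c) (inv_comul a)"
    unfolding tensor_lift_def by (intro sum.cong refl) (auto simp: antipode_left_eq_right)
  then show "tensor_lift (\<lambda>b c. b * extend_linear antipode_left c) (inv_comul a) = smult (symb_counit a) 1"
    by (simp add: antipode_identity(2)[OF a])
qed

theorem theorem2p8:
  shows "coassociative_on H_symb inv_comul \<and>
    graded_hopf_algebra H_symb H_symb_gr inv_comul symb_counit"
  using coassociative_inv_comul graded_bialgebra_H_symb antipode_exists
  by (simp add: graded_hopf_algebra_def graded_hopf_algebra_axioms_def)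

end
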